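(* Let $\lambda\ge0$, let $\mathcal{X}=\{\mathcal{X}_n\}$ be a spike prior and let $\mathcal{P}$ be a probability distribution on $\mathbb{R}$ with mean $0$ and variance $1$ (with $\lambda,\mathcal{P}$ not depending on $n$). Assume: (i) for some fixed $\alpha<\frac1{32}$, with probability $1-o(1)$ as $n\to\infty$ all entries of $x\sim\mathcal{X}_n$ satisfy $|x_i|\le n^{-1/2+\alpha}$; (ii) $\mathcal{P}$ is a continuous distribution with a density function $p(w)$ that is three times differentiable; (iii) $p(w)>0$ everywhere; (iv) letting $f(w)=-p'(w)/p(w)$, there exist $C>0$ and an even integer $m\ge2$ such that $|f^{(\ell)}(w)|\le C+w^m$ for all $w\in\mathbb{R}$ and all $0\le\ell\le2$; (v) with $m$ as in (iv), $\mathbb{E}_{w\sim\mathcal{P}}|w|^k<\infty$ for all $1\le k\le5m$. Let $\hat Y=\sqrt n\,Y$ where $Y$ is drawn from $\mathrm{Wig}_n(\lambda,\mathcal{P},\mathcal{X})$ with spike $x$. Let $f(\hat Y)$ denote the matrix obtained by applying $f$ entrywise to $\hat Y$, except that the diagonal entries remain zero. Let $$F_{\mathcal{P}}=\mathbb{E}_{w\sim\mathcal{P}}[f(w)^2]=\int_{-\infty}^\infty\frac{p'(w)^2}{p(w)}\,dw.$$ Then: - If $\lambda\le1/\sqrt{F_{\mathcal{P}}}$, then $\frac1{\sqrt n}\lambda_{\max}(f(\hat Y))\to2\sqrt{F_{\mathcal{P}}}$ in probability as $n\to\infty$. - If $\lambda>1/\sqrt{F_{\mathcal{P}}}$, then $\frac1{\sqrt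 n}\lambda_{\max}(f(\hat Y))\to\lambda F_{\mathcal{P}}+\frac1\lambda>2\sqrt{F_{\mathcal{P}}}$ in probability as $n\to\infty$, and furthermore the top unit-norm eigenvector $v$ of $f(\hat Y)$ satisfies $$\langle v,x\rangle^2\ge\frac{(\lambda-1/\sqrt{F_{\mathcal{P}}})^2}{\lambda^2}-o(1)\quad\text{with probability }1-o(1).$$
   Context: A spike prior is a family $\mathcal{X}=\{\mathcal{X}_n\}$ with $\mathcal{X}_n$ a probability distribution on $\mathbb{R}^n$ such that $x^{(n)}\sim\mathcal{X}_n$ satisfies $\|x^{(n)}\|\to1$ in probability. $\mathrm{Wig}_n(\lambda,\mathcal{P},\mathcal{X})$ is the law of the $n\times n$ symmetric matrix $Y$ whose off-diagonal entries are those of $\lambda xx^\top+\frac1{\sqrt n}W$ and whose diagonal entries are set to $0$, where $x\sim\mathcal{X}_n$ and, independently of $x$, $W$ is a symmetric matrix whose off-diagonal entries are drawn from $\mathcal{P}$, independently except for $W_{ij}=W_{ji}$. $\lambda_{\max}(\cdot)$ denotes the largest eigenvalue of a symmetric matrix. *)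

theory Defs
  imports "HOL-Probability.Probability" "Jordan_Normal_Form.Spectral_Radius"
begin

text \<open>The sample space may depend on \<open>n\<close>. Both modes of convergence are stated through the good event,
  so a non-measurable event (which would have measure 0) can never satisfy them by accident.\<close>

definition whp :: "(nat \<Rightarrow> 'a measure) \<Rightarrow> (nat \<Rightarrow> 'a \<Rightarrow> bool) \<Rightarrow> bool" where
  "whp M Q \<longleftrightarrow> (\<lambda>n. measure (M n) {\<omega> \<in> space (M n). Q n \<omega>}) \<longlonglongrightarrow> 1"

definition tendsto_in_prob ::
    "(nat \<Rightarrow> 'a measure) \<Rightarrow> (nat \<Rightarrow> 'a \<Rightarrow> real) \<Rightarrow> real \<Rightarrow> bool" where
  "tendsto_in_prob M Z c \<longleftrightarrow> (\<forall>\<epsilon>>0. whp M (\<lambda>n \<omega>. \<bar>Z n \<omega> - c\<bar> < \<epsilon>))"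

text \<open>The space of real \<open>n\<close>-vectors is the product space over the index set \<open>{..<n}\<close>.\<close>

definition spike_prior :: "(nat \<Rightarrow> (nat \<Rightarrow> real) measure) \<Rightarrow> bool" where
  "spike_prior X \<longleftrightarrow>
     (\<forall>n. prob_space (X n) \<and> sets (X n) = sets (Pi\<^sub>M {..<n} (\<lambda>_. borel))) \<and>
     tendsto_in_prob X (\<lambda>n x. L2_set x {..<n}) 1"

text \<open>The sample space of \<open>(x, W)\<close>: the spike \<open>x\<close> is drawn from \<open>Xn\<close> and, independently, the entries
  of \<open>W\<close> strictly above the diagonal are drawn i.i.d. from \<open>P\<close>. The matrix \<open>Y\<close>, as a function on
  this space, then has the law \<open>Wig\<close> with parameters \<open>n\<close>, \<open>lam\<close>, \<open>P\<close>, \<open>Xn\<close>.\<close>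

definition wig_space ::
    "nat \<Rightarrow> real measure \<Rightarrow> (nat \<Rightarrow> real) measure \<Rightarrow> ((nat \<Rightarrow> real) \<times> (nat \<times> nat \<Rightarrow> real)) measure" where
  "wig_space n P Xn = Xn \<Otimes>\<^sub>M Pi\<^sub>M {(i, j). i < j \<and> j < n} (\<lambda>_. P)"

definition wig_matrix ::
    "nat \<Rightarrow> real \<Rightarrow> (nat \<Rightarrow> real) \<times> (nat \<times> nat \<Rightarrow> real) \<Rightarrow> real mat" where
  "wig_matrix n lam = (\<lambda>(x, W). mat n n (\<lambda>(i, j).
     if i = j then 0 else lam * (x i * x j) + 1 / sqrt (real n) * W (min i j, max i j)))"

definition offdiag_map :: "(real \<Rightarrow> real) \<Rightarrow> real mat \<Rightarrow> real mat" where
  "offdiag_map f A = mat (dim_row A) (dim_col A) (\<lambda>(i, j). if i = j then 0 else f (A $$ (i, j)))"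

text \<open>Only meaningful for symmetric matrices of positive dimension, whose real spectrum is finite
  and nonempty.\<close>

definition lambda_max :: "real mat \<Rightarrow> real" where
  "lambda_max A = Max (spectrum A)"

definition score :: "(real \<Rightarrow> real) \<Rightarrow> real \<Rightarrow> real" where
  "score p w = - deriv p w / p w"

definition fisher_info :: "real measure \<Rightarrow> (real \<Rightarrow> real) \<Rightarrow> real" where
  "fisher_info P p = (LINT w|P. (score p w)\<^sup>2)"

text \<open>The matrix \<open>f (sqrt n Y)\<close> with \<open>f = score p\<close>, diagonal kept at zero.\<close>

definition score_matrix ::
    "nat \<Rightarrow> real \<Rightarrow> (real \<Rightarrow> real) \<Rightarrow> (nat \<Rightarrow> real) \<times> (nat \<times> nat \<Rightarrow> real) \<Rightarrow> real mat" where
  "score_matrix n lam p \<omega> = offdiag_map (score p) (sqrt (real n) \<cdot>\<^sub>m wig_matrix n lam \<omega>)"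

end

theory Submission
  imports Defs "HOL-Real_Asymp.Real_Asymp"
begin

text \<open>
  Taylor expansion of \<open>f\<close> at the noise gives \<open>f(Y) / sqrt n = H + \<theta> x x\<^sup>T + E\<close> with \<open>\<theta> = \<lambda> F\<close>, because
  \<open>f'\<close> has mean \<open>F\<close> under \<open>P\<close>. Here \<open>H\<close> is a Wigner matrix with the centred entries \<open>f(W\<^sub>i\<^sub>j) / sqrt n\<close>,
  truncated at \<open>n\<^sup>9\<^sup>/\<^sup>2\<^sup>0\<close>; the delocalisation of \<open>x\<close> makes \<open>E\<close> vanish in operator norm.
  Counting closed walks with their edge multiplicities bounds the expected trace of a logarithmic
  power of \<open>H\<close>, so \<open>\<parallel>H\<parallel> \<le> 2s + o(1)\<close> for \<open>s = sqrt F\<close>.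

  The resolvent of \<open>H\<close> is never needed. The sums \<open>y\<^sub>k\<close> over self-avoiding walks of length \<open>k\<close>, with
  final weight \<open>x\<close>, satisfy \<open>H y\<^sub>k = y\<^sub>k\<^sub>+\<^sub>1 + F y\<^sub>k\<^sub>-\<^sub>1 + o(1)\<close>, \<open>y\<^sub>0 = x\<close> and \<open>\<langle>x, y\<^sub>k\<rangle> \<rightarrow> 0\<close> for \<open>k \<ge> 1\<close>. Hence
  for \<open>\<theta> > s\<close> a truncation of \<open>w = \<Sum>\<^sub>k y\<^sub>k / \<theta>\<^sup>k\<^sup>+\<^sup>1\<close> approximately solves \<open>(\<theta> + F / \<theta> - H) w = x\<close> with
  \<open>\<theta> \<langle>x, w\<rangle> \<rightarrow> 1\<close>. As \<open>\<theta> + F / \<theta> > 2s\<close>, this shows that the largest eigenvalue of \<open>H + \<theta> x x\<^sup>T\<close> tends to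
  \<open>\<theta> + F / \<theta>\<close>. For \<open>\<theta> \<le> s\<close> the upper bound follows by monotonicity, letting \<open>\<theta>\<close> decrease to \<open>s\<close>, and
  \<open>w\<close> is still a test vector for the lower bound \<open>2s\<close>. A top eigenvector \<open>v\<close> satisfies
  \<open>\<theta> + F / \<theta> - o(1) \<le> \<langle>v, H v\<rangle> + \<theta> \<langle>v, x\<rangle>\<^sup>2 \<le> 2s + \<theta> \<langle>v, x\<rangle>\<^sup>2 + o(1)\<close>, which is the claimed correlation.
\<close>

section \<open>Quadratic forms and operator norms\<close>

text \<open>The truncation level answers two opposite demands. With five moments of \<open>f\<close>
  (the reason for \<open>5 * m\<close> moments of the noise), the expected number of entries above
  \<open>T\<close> is at most of order \<open>n^2 / T^5\<close>, so with high probability no entry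
  is altered once \<open>T\<close> grows faster than \<open>n^(2/5)\<close>; a third passage through
  an edge costs a factor \<open>T / sqrt n\<close> up to powers of \<open>ln n\<close>, so
  \<open>T\<close> must stay below \<open>n^(1/2)\<close>. The exponent \<open>9/20\<close> is the
  midpoint.

  Self-avoidance makes the walk sums tractable: centred products along different edge sets are
  orthogonal, so a second moment involves few pairs, and \<open>H\<close> applied to such a walk
  extends it, steps straight back or closes a loop; only the first two survive in the limit. Above
  the bulk \<open>z - H\<close> is positive, and completing a square with \<open>w\<close> converts
  the approximate equation into a bound for every vector, which \<open>w\<close> itself nearly
  attains.

  Since \<open>whp\<close> refers to the measure of the good event itself, the statement about all
  top eigenvectors also requires that event to be measurable. This is where compactness and rational
  vectors come in.\<close>

definition ip :: "nat \<Rightarrow> (nat \<Rightarrow> real) \<Rightarrow> (nat \<Rightarrow> real) \<Rightarrow> real" where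
  "ip n u v = (\<Sum>i<n. u i * v i)"

definition mv :: "nat \<Rightarrow> (nat \<Rightarrow> nat \<Rightarrow> real) \<Rightarrow> (nat \<Rightarrow> real) \<Rightarrow> nat \<Rightarrow> real" where
  "mv n H v i = (\<Sum>j<n. H i j * v j)"

abbreviation nrm :: "nat \<Rightarrow> (nat \<Rightarrow> real) \<Rightarrow> real" where
  "nrm n v \<equiv> L2_set v {..<n}"

definition op_le :: "nat \<Rightarrow> (nat \<Rightarrow> nat \<Rightarrow> real) \<Rightarrow> real \<Rightarrow> bool" where
  "op_le n H r \<longleftrightarrow> (\<forall>v. nrm n (mv n H v) \<le> r * nrm n v)"

lemma ip_commute: "ip n u v = ip n v u"
  by (simp add: ip_def mult.commute)

lemma ip_self: "ip n v v = (nrm n v)\<^sup>2"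
  by (simp add: ip_def L2_set_def sum_nonneg power2_eq_square)

lemma nrm_square: "(nrm n v)\<^sup>2 = (\<Sum>i<n. (v i)\<^sup>2)"
  by (simp add: L2_set_def sum_nonneg)

lemma ip_self_nonneg: "ip n v v \<ge> 0"
  by (simp add: ip_self)

lemma ip_Cauchy_Schwarz: "\<bar>ip n u v\<bar> \<le> nrm n u * nrm n v"
proof -
  have "\<bar>ip n u v\<bar> \<le> (\<Sum>i<n. \<bar>u i\<bar> * \<bar>v i\<bar>)"
    unfolding ip_def using sum_abs[of "\<lambda>i. u i * v i" "{..<n}"] by (simp add: abs_mult)
  also have "\<dots> \<le> nrm n u * nrm n v" by (rule L2_set_mult_ineq)
  finally show ?thesis .
qed

lemma ip_add_left: "ip n (\<lambda>i. u i + w i) v = ip n u v + ip n w v"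
  by (simp add: ip_def sum.distrib distrib_right)
lemma ip_add_right: "ip n v (\<lambda>i. u i + w i) = ip n v u + ip n v w"
  by (simp add: ip_def sum.distrib distrib_left)
lemma ip_diff_left: "ip n (\<lambda>i. u i - w i) v = ip n u v - ip n w v"
  by (simp add: ip_def sum_subtractf left_diff_distrib)
lemma ip_diff_right: "ip n v (\<lambda>i. u i - w i) = ip n v u - ip n v w"
  by (simp add: ip_def sum_subtractf right_diff_distrib)
lemma ip_scale_left: "ip n (\<lambda>i. c * u i) v = c * ip n u v"
  by (simp add: ip_def sum_distrib_left mult.assoc)
lemma ip_scale_right: "ip n v (\<lambda>i. c * u i) = c * ip n v u"
  by (simp add: ip_def sum_distrib_left algebra_simps)
lemma ip_sum_left: "ip n (\<lambda>i. \<Sum>k\<in>S. u k i) v = (\<Sum>k\<in>S. ip n (u k) v)"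
  unfolding ip_def by (simp add: sum_distrib_right) (rule sum.swap)
lemma ip_sum_right: "ip n v (\<lambda>i. \<Sum>k\<in>S. u k i) = (\<Sum>k\<in>S. ip n v (u k))"
  by (simp add: ip_commute[of n v] ip_sum_left)

lemmas ip_linear = ip_add_left ip_add_right ip_diff_left ip_diff_right ip_scale_left ip_scale_right

lemma ip_cong: "(\<And>i. i < n \<Longrightarrow> u i = u' i) \<Longrightarrow> (\<And>i. i < n \<Longrightarrow> v i = v' i) \<Longrightarrow> ip n u v = ip n u' v'"
  by (simp add: ip_def)

lemma nrm_cong: "(\<And>i. i < n \<Longrightarrow> u i = u' i) \<Longrightarrow> nrm n u = nrm n u'"
  by (simp add: L2_set_def)

lemma nrm_scale: "nrm n (\<lambda>i. c * v i) = \<bar>c\<bar> * nrm n v"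
  by (simp add: L2_set_def power_mult_distrib flip: sum_distrib_left) (simp add: real_sqrt_mult)

lemma nrm_diff_le: "nrm n (\<lambda>i. u i - v i) \<le> nrm n u + nrm n v"
  using L2_set_triangle_ineq[of u "\<lambda>i. - v i" "{..<n}"] nrm_scale[where c = "-1" and v = v and n = n] by simp

lemma mv_cong: "(\<And>i. i < n \<Longrightarrow> u i = v i) \<Longrightarrow> mv n H u = mv n H v"
  by (simp add: mv_def fun_eq_iff)

lemma mv_diff: "mv n H (\<lambda>i. u i - v i) = (\<lambda>i. mv n H u i - mv n H v i)"
  by (simp add: mv_def fun_eq_iff sum_subtractf right_diff_distrib)
lemma mv_scale: "mv n H (\<lambda>i. c * v i) = (\<lambda>i. c * mv n H v i)"
  by (simp add: mv_def fun_eq_iff sum_distrib_left algebra_simps)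
lemma mv_sum: "mv n H (\<lambda>i. \<Sum>k\<in>S. u k i) = (\<lambda>i. \<Sum>k\<in>S. mv n H (u k) i)"
  unfolding mv_def by (simp add: sum_distrib_left fun_eq_iff) (rule allI, rule sum.swap)

lemma ip_mv_symmetric:
  assumes "\<And>i j. i < n \<Longrightarrow> j < n \<Longrightarrow> H i j = H j i"
  shows "ip n u (mv n H v) = ip n (mv n H u) v"
proof -
  have "ip n u (mv n H v) = (\<Sum>i<n. \<Sum>j<n. u i * (H i j * v j))"
    by (simp add: ip_def mv_def sum_distrib_left)
  also have "\<dots> = (\<Sum>j<n. \<Sum>i<n. u i * (H i j * v j))" by (rule sum.swap)
  also have "\<dots> = (\<Sum>j<n. \<Sum>i<n. H j i * u i * v j)"
    using assms by (intro sum.cong refl) (auto simp: algebra_simps)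
  also have "\<dots> = ip n (mv n H u) v" by (simp add: ip_def mv_def sum_distrib_right)
  finally show ?thesis .
qed

lemma op_leD: "op_le n H r \<Longrightarrow> nrm n (mv n H v) \<le> r * nrm n v"
  by (simp add: op_le_def)

lemma op_le_qf:
  assumes "op_le n H r" shows "\<bar>ip n v (mv n H v)\<bar> \<le> r * ip n v v"
proof -
  have "\<bar>ip n v (mv n H v)\<bar> \<le> nrm n v * nrm n (mv n H v)" by (rule ip_Cauchy_Schwarz)
  also have "\<dots> \<le> nrm n v * (r * nrm n v)"
    using op_leD[OF assms, of v] by (rule mult_left_mono) (simp add: L2_set_nonneg)
  also have "\<dots> = r * ip n v v" by (simp add: ip_self power2_eq_square)
  finally show ?thesis .
qed

section \<open>Matrix powers and the trace bound for the operator norm\<close>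

fun hp :: "nat \<Rightarrow> (nat \<Rightarrow> nat \<Rightarrow> real) \<Rightarrow> nat \<Rightarrow> nat \<Rightarrow> nat \<Rightarrow> real" where
  "hp n H 0 i j = (if i = j then 1 else 0)"
| "hp n H (Suc r) i j = (\<Sum>l<n. H i l * hp n H r l j)"

lemma hp_add: "i < n \<Longrightarrow> j < n \<Longrightarrow> hp n H (a + b) i j = (\<Sum>l<n. hp n H a i l * hp n H b l j)"
proof (induction a arbitrary: i)
  case 0
  have "(\<Sum>l<n. hp n H 0 i l * hp n H b l j) = (\<Sum>l<n. if l = i then hp n H b l j else 0)"
    by (intro sum.cong) auto
  then show ?case using 0 by simp
next
  case (Suc a)
  have "hp n H (Suc a + b) i j = (\<Sum>l<n. H i l * hp n H (a + b) l j)" by simp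
  also have "\<dots> = (\<Sum>l<n. H i l * (\<Sum>m<n. hp n H a l m * hp n H b m j))"
    using Suc.prems by (intro sum.cong refl) (simp only: Suc.IH lessThan_iff)
  also have "\<dots> = (\<Sum>l<n. \<Sum>m<n. H i l * hp n H a l m * hp n H b m j)"
    by (simp only: sum_distrib_left mult.assoc)
  also have "\<dots> = (\<Sum>m<n. \<Sum>l<n. H i l * hp n H a l m * hp n H b m j)" by (rule sum.swap)
  also have "\<dots> = (\<Sum>m<n. hp n H (Suc a) i m * hp n H b m j)" by (simp add: sum_distrib_right)
  finally show ?case .
qed

lemma hp_symmetric:
  assumes H: "\<And>i j. i < n \<Longrightarrow> j < n \<Longrightarrow> H i j = H j i"
  shows "i < n \<Longrightarrow> j < n \<Longrightarrow> hp n H k i j = hp n H k j i"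
proof (induction k arbitrary: i j)
  case (Suc k)
  have one: "hp n H 1 l j = H l j" if "l < n" for l
  proof -
    have "hp n H 1 l j = (\<Sum>m<n. if m = j then H l j else 0)"
      unfolding One_nat_def hp.simps by (rule sum.cong) auto
    also have "\<dots> = H l j" using Suc.prems by (subst sum.delta) auto
    finally show ?thesis .
  qed
  have "hp n H (k + 1) i j = (\<Sum>l<n. hp n H k i l * hp n H 1 l j)"
    using Suc.prems by (intro hp_add) auto
  also have "\<dots> = (\<Sum>l<n. hp n H k l i * H j l)"
  proof (rule sum.cong)
    fix l assume "l \<in> {..<n}"
    hence l: "l < n" by simp
    show "hp n H k i l * hp n H 1 l j = hp n H k l i * H j l"
      unfolding one[OF l] Suc.IH[OF Suc.prems(1) l] H[OF l Suc.prems(2)] ..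
  qed simp
  also have "\<dots> = hp n H (Suc k) j i" by (simp add: mult.commute)
  finally show ?case by simp
qed auto

lemma mv_iterate: "i < n \<Longrightarrow> (mv n H ^^ k) v i = (\<Sum>j<n. hp n H k i j * v j)"
proof (induction k arbitrary: i)
  case 0
  have "(\<Sum>j<n. hp n H 0 i j * v j) = (\<Sum>j<n. if j = i then v j else 0)" by (intro sum.cong) auto
  then show ?case using 0 by simp
next
  case (Suc k)
  have "(mv n H ^^ Suc k) v i = (\<Sum>l<n. H i l * (mv n H ^^ k) v l)"
    by (simp add: mv_def[of n H "(mv n H ^^ k) v"])
  also have "\<dots> = (\<Sum>l<n. H i l * (\<Sum>j<n. hp n H k l j * v j))"
    using Suc.IH by simp
  also have "\<dots> = (\<Sum>l<n. \<Sum>j<n. H i l * hp n H k l j * v j)"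
    by (simp only: sum_distrib_left mult.assoc)
  also have "\<dots> = (\<Sum>j<n. \<Sum>l<n. H i l * hp n H k l j * v j)" by (rule sum.swap)
  also have "\<dots> = (\<Sum>j<n. hp n H (Suc k) i j * v j)" by (simp add: sum_distrib_right)
  finally show ?case .
qed

text \<open>By Cauchy--Schwarz \<open>k \<mapsto> \<parallel>H\<^sup>k v\<parallel>\<close> is log-convex, so its first ratio is the smallest one.\<close>

lemma nrm_mv_power_le:
  assumes H: "\<And>i j. i < n \<Longrightarrow> j < n \<Longrightarrow> H i j = H j i"
  shows "nrm n (mv n H v) ^ Suc k \<le> nrm n ((mv n H ^^ Suc k) v) * nrm n v ^ k"
proof (induction k arbitrary: v)
  case 0
  show ?case by simp
next
  case (Suc k)
  define a b c where "a = nrm n v" and "b = nrm n (mv n H v)" and "c = nrm n ((mv n H ^^ Suc (Suc k)) v)"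
  have nn: "a \<ge> 0" "b \<ge> 0" "c \<ge> 0" by (auto simp: a_def b_def c_def L2_set_nonneg)
  define d where "d = nrm n (mv n H (mv n H v))"
  have d: "d \<ge> 0" by (simp add: d_def L2_set_nonneg)
  have "b\<^sup>2 = ip n v (mv n H (mv n H v))"
    unfolding b_def ip_self[symmetric] by (rule ip_mv_symmetric[symmetric]) (rule H)
  hence bd: "b\<^sup>2 \<le> a * d"
    using ip_Cauchy_Schwarz[of n v "mv n H (mv n H v)"] unfolding a_def d_def by linarith
  have ih: "d ^ Suc k \<le> c * b ^ k"
    using Suc.IH[of "mv n H v"] unfolding d_def c_def b_def funpow_Suc_right o_apply .
  show ?case
  proof (cases "b = 0")
    case True
    then show ?thesis using nn unfolding a_def[symmetric] b_def[symmetric] c_def[symmetric] by simp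
  next
    case False
    hence b: "b > 0" using nn by simp
    \<comment> \<open>The induction hypothesis at \<open>H v\<close> carries a factor
      \<open>b ^ k\<close> on its right side. It is multiplied in here and cancelled at the end,
      which is why \<open>b = 0\<close> is split off.\<close>
    have "b ^ k * b ^ Suc (Suc k) = (b\<^sup>2) ^ Suc k" by (simp add: power2_eq_square power_mult_distrib)
    also have "\<dots> \<le> (a * d) ^ Suc k" using bd by (intro power_mono) auto
    also have "\<dots> = a ^ Suc k * d ^ Suc k" by (rule power_mult_distrib)
    also have "\<dots> \<le> a ^ Suc k * (c * b ^ k)" using ih nn by (intro mult_left_mono) auto
    finally have "b ^ k * b ^ Suc (Suc k) \<le> b ^ k * (c * a ^ Suc k)" by (simp only: mult_ac)
    moreover have "b ^ k > 0" using b by simp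
    ultimately have "b ^ Suc (Suc k) \<le> c * a ^ Suc k"
      by (rule mult_left_le_imp_le)
    then show ?thesis unfolding a_def b_def c_def .
  qed
qed

lemma nrm_square_le_frobenius:
  "(\<Sum>i<n. (\<Sum>j<n. M i j * v j)\<^sup>2) \<le> (\<Sum>i<n. \<Sum>j<n. (M i j)\<^sup>2) * (nrm n v)\<^sup>2"
proof -
  have "(\<Sum>j<n. M i j * v j)\<^sup>2 \<le> (\<Sum>j<n. (M i j)\<^sup>2) * (nrm n v)\<^sup>2" for i
    unfolding nrm_square by (rule Cauchy_Schwarz_ineq_sum)
  hence "(\<Sum>i<n. (\<Sum>j<n. M i j * v j)\<^sup>2) \<le> (\<Sum>i<n. (\<Sum>j<n. (M i j)\<^sup>2) * (nrm n v)\<^sup>2)"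
    by (intro sum_mono)
  thus ?thesis by (simp add: sum_distrib_right)
qed

lemma op_le_frobenius:
  assumes "(\<Sum>i<n. \<Sum>j<n. (M i j)\<^sup>2) \<le> r\<^sup>2" "r \<ge> 0"
  shows "op_le n M r"
  unfolding op_le_def
proof
  fix v
  have "(nrm n (mv n M v))\<^sup>2 \<le> (\<Sum>i<n. \<Sum>j<n. (M i j)\<^sup>2) * (nrm n v)\<^sup>2"
    unfolding nrm_square[of "mv n M v"] mv_def by (rule nrm_square_le_frobenius)
  also have "\<dots> \<le> r\<^sup>2 * (nrm n v)\<^sup>2" by (rule mult_right_mono) (use assms(1) in simp_all)
  finally have "(nrm n (mv n M v))\<^sup>2 \<le> (r * nrm n v)\<^sup>2" unfolding power_mult_distrib .
  thus "nrm n (mv n M v) \<le> r * nrm n v"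
    by (rule power2_le_imp_le) (simp add: assms(2) L2_set_nonneg)
qed

text \<open>For symmetric \<open>H\<close> the trace of \<open>H^(2N)\<close> is the squared
  Frobenius norm of \<open>H^N\<close>, which dominates its operator norm; log-convexity of the
  iterates then passes from \<open>H^N\<close> back to \<open>H\<close>. The exponent is written
  \<open>2 * Suc k\<close> so that \<open>N\<close> is positive.\<close>

lemma op_le_trace_power:
  assumes H: "\<And>i j. i < n \<Longrightarrow> j < n \<Longrightarrow> H i j = H j i"
    and tr: "(\<Sum>i<n. hp n H (2 * Suc k) i i) \<le> r ^ (2 * Suc k)" and r: "r \<ge> 0"
  shows "op_le n H r"
  unfolding op_le_def
proof
  fix v
  let ?N = "Suc k"
  have "hp n H ?N i j = hp n H ?N j i" if "i < n" "j < n" for i j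
    by (rule hp_symmetric[where H = H and n = n and k = ?N]) (use H that in auto)
  hence "(\<Sum>i<n. \<Sum>j<n. (hp n H ?N i j)\<^sup>2) = (\<Sum>i<n. \<Sum>j<n. hp n H ?N i j * hp n H ?N j i)"
    by (intro sum.cong refl) (simp add: power2_eq_square del: hp.simps)
  also have "\<dots> = (\<Sum>i<n. hp n H (2 * ?N) i i)"
    using hp_add[where n = n and H = H and a = ?N and b = ?N] by (intro sum.cong refl) (simp add: mult_2)
  also have "\<dots> \<le> (r ^ ?N)\<^sup>2" using tr unfolding power_even_eq .
  finally have fr: "op_le n (hp n H ?N) (r ^ ?N)" by (intro op_le_frobenius) (simp_all add: r del: hp.simps)
  have "nrm n ((mv n H ^^ ?N) v) = nrm n (mv n (hp n H ?N) v)"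
    unfolding mv_def[where H = "hp n H ?N"] by (rule nrm_cong) (rule mv_iterate)
  also have "\<dots> \<le> r ^ ?N * nrm n v" using fr by (rule op_leD)
  finally have le: "nrm n ((mv n H ^^ ?N) v) * nrm n v ^ k \<le> r ^ ?N * nrm n v * nrm n v ^ k"
    by (rule mult_right_mono) (simp add: L2_set_nonneg)
  have "nrm n (mv n H v) ^ ?N \<le> nrm n ((mv n H ^^ ?N) v) * nrm n v ^ k"
    by (rule nrm_mv_power_le) (rule H)
  also note le
  finally have "nrm n (mv n H v) ^ ?N \<le> r ^ ?N * nrm n v * nrm n v ^ k" .
  hence "nrm n (mv n H v) ^ ?N \<le> (r * nrm n v) ^ ?N" by (simp add: power_mult_distrib mult_ac)
  thus "nrm n (mv n H v) \<le> r * nrm n v"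
    by (rule power_le_imp_le_base) (simp add: r L2_set_nonneg)
qed

section \<open>The expected trace of powers of a Wigner matrix\<close>

definition edge :: "nat \<Rightarrow> nat \<Rightarrow> nat \<times> nat" where
  "edge i j = (min i j, max i j)"

definition edges :: "nat \<Rightarrow> (nat \<times> nat) set" where
  "edges n = {(i, j). i < j \<and> j < n}"

lemma edge_commute: "edge i j = edge j i"
  by (simp add: edge_def min.commute max.commute)

lemma edge_eq_iff: "edge a b = edge c d \<longleftrightarrow> (a = c \<and> b = d) \<or> (a = d \<and> b = c)"
  by (auto simp: edge_def min_def max_def)

lemma edge_in_edges: "i \<noteq> j \<Longrightarrow> i < n \<Longrightarrow> j < n \<Longrightarrow> edge i j \<in> edges n"
  by (auto simp: edge_def edges_def)

lemma finite_edges [simp]: "finite (edges n)"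
  by (rule finite_subset[of _ "{..<n} \<times> {..<n}"]) (auto simp: edges_def)

text \<open>Walks grow at the head, so \<open>hd w\<close> is the current vertex and \<open>last w\<close> the starting point.\<close>

fun cnt :: "nat list \<Rightarrow> nat \<times> nat \<Rightarrow> nat" where
  "cnt (x # y # zs) e = (if e = edge x y then 1 else 0) + cnt (y # zs) e"
| "cnt _ e = 0"

fun wprod :: "(nat \<Rightarrow> nat \<Rightarrow> real) \<Rightarrow> nat list \<Rightarrow> real" where
  "wprod H (x # y # zs) = H x y * wprod H (y # zs)"
| "wprod H _ = 1"

text \<open>A step costs \<open>sw m\<close> when its edge was crossed \<open>m\<close> times
  before, so the factors regroup edge by edge into \<open>\<Prod>i<cnt w e. sw i\<close>, to be read
  as a bound for the moment of order \<open>cnt w e\<close>. Loops weigh 0 because the diagonal of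
  \<open>entry\<close> is 0.\<close>

fun wt :: "(nat \<Rightarrow> real) \<Rightarrow> nat list \<Rightarrow> real" where
  "wt sw (x # y # zs) = (if x = y then 0 else sw (cnt (y # zs) (edge x y))) * wt sw (y # zs)"
| "wt sw _ = 1"

definition entry :: "(real \<Rightarrow> real) \<Rightarrow> (nat \<times> nat \<Rightarrow> real) \<Rightarrow> nat \<Rightarrow> nat \<Rightarrow> real" where
  "entry \<xi> W i j = (if i = j then 0 else \<xi> (W (edge i j)))"

lemma entry_symmetric: "entry \<xi> W i j = entry \<xi> W j i"
  by (simp add: entry_def edge_commute)

lemma cnt_le_length: "cnt w e \<le> length w - 1"
  by (induction w e rule: cnt.induct) auto

lemma cnt_pos_in_set: "cnt w e > 0 \<Longrightarrow> fst e \<in> set w \<and> snd e \<in> set w"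
  by (induction w e rule: cnt.induct) (auto simp: edge_def min_def max_def split: if_splits)

lemma cnt_edge_pos_in_set: "cnt w (edge i j) > 0 \<Longrightarrow> i \<in> set w \<and> j \<in> set w"
  using cnt_pos_in_set[of w "edge i j"] by (auto simp: edge_def min_def max_def split: if_splits)

lemma cnt_Cons: "w \<noteq> [] \<Longrightarrow> cnt (j # w) e = (if e = edge j (hd w) then 1 else 0) + cnt w e"
  by (cases w) auto

lemma wprod_Cons: "w \<noteq> [] \<Longrightarrow> wprod H (j # w) = H j (hd w) * wprod H w"
  by (cases w) auto

lemma wt_Cons: "w \<noteq> [] \<Longrightarrow> wt sw (j # w) = (if j = hd w then 0 else sw (cnt w (edge j (hd w)))) * wt sw w"
  by (cases w) auto

lemma wt_nonneg: "(\<And>m. sw m \<ge> 0) \<Longrightarrow> wt sw w \<ge> 0"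
  by (induction sw w rule: wt.induct) auto

text \<open>Prepending a step changes the count of a single edge, so a product over all edges gains
  one factor. Both \<open>wprod\<close> and \<open>wt\<close> acquire their edge-by-edge form
  through this fact.\<close>

lemma prod_cnt_Cons:
  fixes \<phi> :: "nat \<times> nat \<Rightarrow> nat \<Rightarrow> real"
  assumes \<phi>: "\<And>e m. \<phi> e (Suc m) = sw e m * \<phi> e m" and e: "edge x y \<in> edges n"
  shows "(\<Prod>e\<in>edges n. \<phi> e (cnt (x # y # zs) e)) =
    sw (edge x y) (cnt (y # zs) (edge x y)) * (\<Prod>e\<in>edges n. \<phi> e (cnt (y # zs) e))"
proof -
  have "(\<Prod>e\<in>edges n - {edge x y}. \<phi> e (cnt (x # y # zs) e)) =
        (\<Prod>e\<in>edges n - {edge x y}. \<phi> e (cnt (y # zs) e))"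
    by (intro prod.cong refl) auto
  thus ?thesis
    using e by (simp add: prod.remove[OF finite_edges e] \<phi>)
qed

lemma wprod_entry:
  assumes "distinct_adj w" "set w \<subseteq> {..<n}"
  shows "wprod (entry \<xi> W) w = (\<Prod>e\<in>edges n. \<xi> (W e) ^ cnt w e)"
  using assms
proof (induction w rule: induct_list012)
  case (3 x y zs)
  hence e: "edge x y \<in> edges n" by (auto intro!: edge_in_edges)
  show ?case
    unfolding prod_cnt_Cons[where \<phi> = "\<lambda>e m. \<xi> (W e) ^ m" and sw = "\<lambda>e m. \<xi> (W e)", OF power_Suc e]
    using 3 by (simp add: entry_def)
qed auto

lemma wprod_entry_0: "\<not> distinct_adj w \<Longrightarrow> wprod (entry \<xi> W) w = 0"
  by (induction w rule: induct_list012) (auto simp: entry_def)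

lemma wt_0: "\<not> distinct_adj w \<Longrightarrow> wt sw w = 0"
  by (induction w rule: induct_list012) auto

lemma wt_eq_prod:
  assumes "distinct_adj w" "set w \<subseteq> {..<n}"
  shows "wt sw w = (\<Prod>e\<in>edges n. \<Prod>i<cnt w e. sw i)"
  using assms
proof (induction w rule: induct_list012)
  case (3 x y zs)
  hence e: "edge x y \<in> edges n" by (auto intro!: edge_in_edges)
  have "(\<Prod>e\<in>edges n. \<Prod>i<cnt (x # y # zs) e. sw i) =
      sw (cnt (y # zs) (edge x y)) * (\<Prod>e\<in>edges n. \<Prod>i<cnt (y # zs) e. sw i)"
    by (rule prod_cnt_Cons[where \<phi> = "\<lambda>e m. \<Prod>i<m. sw i" and sw = "\<lambda>e m. sw m", OF _ e])
       (simp add: lessThan_Suc)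
  thus ?case using 3 by simp
qed auto

abbreviation noise :: "nat \<Rightarrow> real measure \<Rightarrow> (nat \<times> nat \<Rightarrow> real) measure" where
  "noise n P \<equiv> Pi\<^sub>M (edges n) (\<lambda>_. P)"

lemma noise_prod:
  fixes u :: "nat \<times> nat \<Rightarrow> real \<Rightarrow> real"
  assumes "prob_space P" "\<And>e. e \<in> edges n \<Longrightarrow> integrable P (u e)"
  shows "integrable (noise n P) (\<lambda>W. \<Prod>e\<in>edges n. u e (W e))"
    and "(LINT W|(noise n P). (\<Prod>e\<in>edges n. u e (W e))) = (\<Prod>e\<in>edges n. LINT w|P. u e w)"
proof -
  interpret prob_space P by fact
  interpret product_sigma_finite "\<lambda>_. P" ..
  show "integrable (noise n P) (\<lambda>W. \<Prod>e\<in>edges n. u e (W e))"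
    using assms(2) by (intro product_integrable_prod) auto
  show "(LINT W|(noise n P). (\<Prod>e\<in>edges n. u e (W e))) = (\<Prod>e\<in>edges n. LINT w|P. u e w)"
    using assms(2) by (intro product_integral_prod) auto
qed

text \<open>Independence factorises the expectation over the edges into moments of
  \<open>\<xi>\<close>, and each moment is bounded by the step weights of the crossings of its
  edge.\<close>

lemma noise_wprod:
  assumes P: "prob_space P" and int: "\<And>m. m \<le> N \<Longrightarrow> integrable P (\<lambda>w. \<xi> w ^ m)"
    and bound: "\<And>m. m \<le> N \<Longrightarrow> \<bar>LINT w|P. \<xi> w ^ m\<bar> \<le> (\<Prod>i<m. sw i)"
    and w: "set w \<subseteq> {..<n}" "length w \<le> Suc N" and sw: "\<And>m. sw m \<ge> 0"
  shows "integrable (noise n P) (\<lambda>W. wprod (entry \<xi> W) w)"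
    and "\<bar>LINT W|(noise n P). wprod (entry \<xi> W) w\<bar> \<le> wt sw w"
proof -
  have "integrable (noise n P) (\<lambda>W. wprod (entry \<xi> W) w) \<and>
      \<bar>LINT W|(noise n P). wprod (entry \<xi> W) w\<bar> \<le> wt sw w"
  proof (cases "distinct_adj w")
    case True
    have c: "cnt w e \<le> N" for e using cnt_le_length[of w e] w by simp
    note * = noise_prod[OF P, where n = n and u = "\<lambda>e w'. \<xi> w' ^ cnt w e"]
    have "\<bar>LINT W|(noise n P). wprod (entry \<xi> W) w\<bar> = (\<Prod>e\<in>edges n. \<bar>LINT w'|P. \<xi> w' ^ cnt w e\<bar>)"
      unfolding wprod_entry[OF True w(1)] using c int by (subst *(2)) (auto simp: abs_prod)
    also have "\<dots> \<le> (\<Prod>e\<in>edges n. \<Prod>i<cnt w e. sw i)"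
      using c bound by (intro prod_mono) auto
    finally have "\<bar>LINT W|(noise n P). wprod (entry \<xi> W) w\<bar> \<le> wt sw w"
      unfolding wt_eq_prod[OF True w(1)] .
    moreover have "integrable (noise n P) (\<lambda>W. wprod (entry \<xi> W) w)"
      unfolding wprod_entry[OF True w(1)] using c int by (intro *(1)) auto
    ultimately show ?thesis by simp
  qed (simp add: wprod_entry_0 wt_0)
  thus "integrable (noise n P) (\<lambda>W. wprod (entry \<xi> W) w)"
    and "\<bar>LINT W|(noise n P). wprod (entry \<xi> W) w\<bar> \<le> wt sw w" by auto
qed

section \<open>The exploration potential of a walk\<close>

definition deg :: "nat \<Rightarrow> (nat \<times> nat \<Rightarrow> nat) \<Rightarrow> nat \<Rightarrow> nat" where
  "deg n c v = card {w. w < n \<and> w \<noteq> v \<and> c (edge v w) = 1}"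

text \<open>The potential vanishes along the walks that explore a tree depth first. Every step through an
  edge for its second time at a moment of ambiguity lowers it, and only the rare steps raise it.\<close>

definition potential :: "nat \<Rightarrow> nat list \<Rightarrow> nat" where
  "potential n w = (deg n (cnt w) (hd w) - 1) + (\<Sum>v\<in>{..<n} - {hd w}. deg n (cnt w) v - 2)"

lemma deg_update:
  assumes "a \<noteq> b" "b < n"
  shows "deg n (\<lambda>e. (if e = edge a b then 1 else 0) + c e) a =
     (if c (edge a b) = 0 then deg n c a + 1 else if c (edge a b) = 1 then deg n c a - 1 else deg n c a)"
    and "c (edge a b) = 1 \<Longrightarrow> deg n c a \<ge> 1"
proof -
  let ?c' = "\<lambda>e. (if e = edge a b then 1 else 0) + c e"
  define S where "S = {w. w < n \<and> w \<noteq> a \<and> c (edge a w) = 1}"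
  have fin: "finite S" by (simp add: S_def)
  have ne: "edge a w = edge a b \<longleftrightarrow> w = b" if "w \<noteq> a" for w using that by (auto simp: edge_eq_iff)
  have "{w. w < n \<and> w \<noteq> a \<and> ?c' (edge a w) = 1} =
     (if c (edge a b) = 0 then insert b S else if c (edge a b) = 1 then S - {b} else S)"
    using assms by (auto simp: S_def ne split: if_splits)
  moreover have "b \<in> S \<longleftrightarrow> c (edge a b) = 1" using assms by (auto simp: S_def)
  ultimately show "deg n ?c' a = (if c (edge a b) = 0 then deg n c a + 1
      else if c (edge a b) = 1 then deg n c a - 1 else deg n c a)"
    unfolding deg_def S_def[symmetric] using fin by auto
  show "c (edge a b) = 1 \<Longrightarrow> deg n c a \<ge> 1"
    using \<open>b \<in> S \<longleftrightarrow> c (edge a b) = 1\<close> fin unfolding deg_def S_def[symmetric]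
    by (metis One_nat_def Suc_leI card_gt_0_iff empty_iff)
qed

lemma deg_update_other:
  "v \<noteq> a \<Longrightarrow> v \<noteq> b \<Longrightarrow> deg n (\<lambda>e. (if e = edge a b then 1 else 0) + c e) v = deg n c v"
  unfolding deg_def by (rule arg_cong[where f = card]) (auto simp: edge_eq_iff)

text \<open>\<open>deg\<close> counts the open edges, those crossed exactly once so far. In a
  depth-first tour of a tree the current vertex has at most one open edge, the one leading back, and
  every other vertex at most two; hence the offsets 1 and 2 in \<open>potential\<close>. The cases
  are: a new edge, a new edge to a vertex without open edges, retracing an open edge, retracing with
  a choice among several, and a third or later crossing.\<close>

lemma potential_step:
  assumes w: "w \<noteq> []" "hd w < n" and j: "j < n" "j \<noteq> hd w"
  defines "c \<equiv> cnt w (edge j (hd w))" and "d \<equiv> deg n (cnt w)"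
  shows "c = 0 \<Longrightarrow> potential n (j # w) \<le> potential n w + 2"
    and "c = 0 \<Longrightarrow> d j = 0 \<Longrightarrow> potential n (j # w) \<le> potential n w"
    and "c = 1 \<Longrightarrow> potential n (j # w) \<le> potential n w"
    and "c = 1 \<Longrightarrow> d (hd w) \<ge> 2 \<Longrightarrow> potential n (j # w) + 1 \<le> potential n w"
    and "c \<ge> 2 \<Longrightarrow> potential n (j # w) \<le> potential n w + 1"
proof -
  let ?u = "hd w"
  define d' where "d' = deg n (cnt (j # w))"
  have c': "cnt (j # w) = (\<lambda>e. (if e = edge j ?u then 1 else 0) + cnt w e)"
    using w by (auto simp: cnt_Cons)
  have c'': "cnt (j # w) = (\<lambda>e. (if e = edge ?u j then 1 else 0) + cnt w e)"
    using c' by (simp add: edge_commute)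
  have dj: "d' j = (if c = 0 then d j + 1 else if c = 1 then d j - 1 else d j)" "c = 1 \<Longrightarrow> d j \<ge> 1"
    unfolding d'_def c' d_def c_def using deg_update[of j ?u n "cnt w"] j w by simp_all
  have du: "d' ?u = (if c = 0 then d ?u + 1 else if c = 1 then d ?u - 1 else d ?u)" "c = 1 \<Longrightarrow> d ?u \<ge> 1"
    unfolding d'_def c'' d_def c_def using deg_update[of ?u j n "cnt w"] j w by (simp_all add: edge_commute)
  define R where "R = (\<Sum>v\<in>{..<n} - {?u} - {j}. d v - 2)"
  have "(\<Sum>v\<in>{..<n} - {j} - {?u}. d' v - 2) = (\<Sum>v\<in>{..<n} - {?u} - {j}. d v - 2)"
    unfolding d'_def c' d_def by (rule sum.cong) (auto simp: deg_update_other)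
  moreover have "potential n (j # w) = (d' j - 1) + (d' ?u - 2) + (\<Sum>v\<in>{..<n} - {j} - {?u}. d' v - 2)"
    using w j by (simp add: potential_def d'_def sum.remove[of "{..<n} - {j}" ?u])
  ultimately have p': "potential n (j # w) = (d' j - 1) + (d' ?u - 2) + R" by (simp add: R_def)
  have p: "potential n w = (d ?u - 1) + (d j - 2) + R"
    using w j by (simp add: potential_def d_def R_def sum.remove[of "{..<n} - {?u}" j])
  show "c = 0 \<Longrightarrow> potential n (j # w) \<le> potential n w + 2"
    "c = 0 \<Longrightarrow> d j = 0 \<Longrightarrow> potential n (j # w) \<le> potential n w"
    "c = 1 \<Longrightarrow> potential n (j # w) \<le> potential n w"
    "c = 1 \<Longrightarrow> d ?u \<ge> 2 \<Longrightarrow> potential n (j # w) + 1 \<le> potential n w"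
    "c \<ge> 2 \<Longrightarrow> potential n (j # w) \<le> potential n w + 1"
    unfolding p p' using dj du by auto
qed

text \<open>For \<open>m >= 2\<close> crossings the weights multiply to
  \<open>s^2 / n * B^(m-2)\<close>, which bounds the moment of order \<open>m\<close> of an entry
  with variance at most \<open>s^2 / n\<close> and absolute value at most \<open>B\<close>. A single
  crossing has mean 0, so any weight bounds it; \<open>s / n\<close> makes the sum over all new
  neighbours equal to \<open>s\<close>.\<close>

fun step_wt :: "real \<Rightarrow> real \<Rightarrow> nat \<Rightarrow> nat \<Rightarrow> real" where
  "step_wt s B n 0 = s / real n"
| "step_wt s B n (Suc 0) = s"
| "step_wt s B n (Suc (Suc _)) = B"

lemma step_wt_nonneg: "s \<ge> 0 \<Longrightarrow> B \<ge> 0 \<Longrightarrow> step_wt s B n m \<ge> 0"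
  by (induction s B n m rule: step_wt.induct) auto

text \<open>The factor \<open>2 * s\<close> comes from the two cheap moves: up to \<open>n\<close>
  fresh vertices at \<open>s / n\<close> each, or retracing the unique open edge at
  \<open>s\<close>. If several edges are open, the at most \<open>M\<close> ways of retracing are
  paid for by the drop of the potential, a unit of which is worth \<open>1 / M\<close>. The rare
  moves give the other terms: each has at most \<open>M\<close> targets, a new edge to a visited
  vertex gains up to \<open>M^2\<close> through the potential and a third crossing up to
  \<open>M\<close>.\<close>

lemma sum_step_le:
  assumes w: "w \<noteq> []" "set w \<subseteq> {..<n}" "length w \<le> M" and s: "s \<ge> 0" "B \<ge> 0"
  defines "sw \<equiv> step_wt s B n"
  shows "(\<Sum>j<n. wt sw (j # w) * real M ^ potential n (j # w)) \<le>
    (2 * s + s * real M ^ 3 / real n + B * (real M)\<^sup>2) * (wt sw w * real M ^ potential n w)"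
proof -
  let ?u = "hd w"
  have u: "?u < n" using w by (cases w) auto
  hence n: "n > 0" by simp
  have M: "M \<ge> 1" using w by (cases w) auto
  define c where "c j = cnt w (edge j ?u)" for j
  define d where "d = deg n (cnt w)"
  define p where "p = potential n w"
  define T where "T = {j. j < n \<and> j \<noteq> ?u \<and> c j = 1}"
  have "T \<subseteq> set w"
  proof
    fix j assume "j \<in> T"
    thus "j \<in> set w" using cnt_edge_pos_in_set[of w j ?u] by (simp add: T_def c_def)
  qed
  hence T: "card T = d ?u" "finite T" "T \<subseteq> set w"
    by (auto simp: T_def d_def deg_def c_def edge_commute)
  have cs: "card (set w) \<le> M" using card_length[of w] w(3) by simp
  have dM: "d ?u \<le> M" using card_mono[OF _ T(3)] T(1) cs by simp
  \<comment> \<open>The change of the potential factor in a retracing step: 1 when there is no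
    choice, otherwise at least one unit is lost. Either way the sum over the \<open>d ?u\<close>
    open edges is at most 1.\<close>
  define q where "q = (if d ?u = 1 then 1 else 1 / real M)"
  have q: "q \<ge> 0" "real (d ?u) * q \<le> 1"
    using dM M by (auto simp: q_def field_simps)
  define U where "U = (s / real n) * (real M)\<^sup>2 + B * real M"
  have U: "U \<ge> 0" using s by (simp add: U_def)
  have step: "(if j = ?u then 0 else sw (c j)) * real M ^ potential n (j # w) \<le>
     real M ^ p * (s / real n + (if j \<in> set w then U else 0) + (if j \<in> T then s * q else 0))"
    if j: "j < n" for j
  proof (cases "j = ?u")
    case True
    then show ?thesis using s U q by auto
  next
    case ju: False
    note ps = potential_step[OF w(1) u j ju, folded p_def d_def, folded c_def]
    have inset: "j \<in> set w" if "c j > 0" using cnt_edge_pos_in_set[of w j ?u] that by (simp add: c_def)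
    have Mp: "real M ^ a \<le> real M ^ b" if "a \<le> b" for a b using that M by (intro power_increasing) auto
    have nn: "s / real n \<ge> 0" "s * q \<ge> 0" using s q by auto
    consider "c j = 0" "j \<notin> set w" | "c j = 0" "j \<in> set w" | "c j = 1" | "c j \<ge> 2" by linarith
    thus ?thesis
    proof cases
      case 1
      have "cnt w (edge j v) = 0" for v
        using 1(2) cnt_edge_pos_in_set[of w j v] by (cases "cnt w (edge j v)") auto
      hence "deg n (cnt w) j = 0" by (simp add: deg_def)
      hence "real M ^ potential n (j # w) \<le> real M ^ p" using ps(2) 1 by (intro Mp) (simp add: d_def)
      hence "s / real n * real M ^ potential n (j # w) \<le> s / real n * real M ^ p"
        using nn by (intro mult_left_mono)
      then show ?thesis using 1 ju nn by (auto simp: sw_def T_def mult.commute)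
    next
      case 2
      have "real M ^ potential n (j # w) \<le> real M ^ (p + 2)" using ps(1) 2 by (intro Mp) simp
      hence "s / real n * real M ^ potential n (j # w) \<le> s / real n * real M ^ (p + 2)"
        using nn by (intro mult_left_mono)
      also have "\<dots> \<le> real M ^ p * U"
        using s by (simp add: U_def power_add power2_eq_square algebra_simps)
      also have "\<dots> \<le> real M ^ p * (s / real n + U)" using nn by (intro mult_left_mono) auto
      finally show ?thesis using 2 ju by (auto simp: sw_def T_def)
    next
      case 3
      have jT: "j \<in> T" using 3 j ju by (simp add: T_def)
      have d1: "d ?u \<ge> 1" using jT T by (metis One_nat_def Suc_leI card_gt_0_iff empty_iff)
      have "real M ^ potential n (j # w) \<le> real M ^ p * q"
      proof (cases "d ?u = 1")
        case True
        then show ?thesis using ps(3) 3 by (simp add: q_def Mp)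
      next
        case False
        hence "real M ^ (potential n (j # w) + 1) \<le> real M ^ p" using ps(4) 3 d1 by (intro Mp) simp
        then show ?thesis using False M by (simp add: q_def field_simps)
      qed
      hence "s * real M ^ potential n (j # w) \<le> s * (real M ^ p * q)" using s by (intro mult_left_mono)
      also have "\<dots> = real M ^ p * (s * q)" by simp
      also have "\<dots> \<le> real M ^ p * (s / real n + (if j \<in> set w then U else 0) + s * q)"
        using nn U by (intro mult_left_mono) auto
      finally show ?thesis using 3 ju jT by (auto simp: sw_def)
    next
      case 4
      hence js: "j \<in> set w" using inset by simp
      obtain k where "c j = Suc (Suc k)" using 4 by (metis add_2_eq_Suc le_Suc_ex)
      hence sB: "sw (c j) = B" by (simp add: sw_def)
      have "B * real M ^ potential n (j # w) \<le> B * real M ^ (p + 1)"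
        using ps(5) 4 s by (intro mult_left_mono Mp) auto
      also have "\<dots> \<le> real M ^ p * U" using s by (simp add: U_def algebra_simps)
      also have "\<dots> \<le> real M ^ p * (s / real n + U)" using nn by (intro mult_left_mono) auto
      finally show ?thesis using 4 ju js sB by (auto simp: T_def)
    qed
  qed
  have W: "wt sw w \<ge> 0" using s by (intro wt_nonneg) (simp add: sw_def step_wt_nonneg)
  have "(\<Sum>j<n. (if j = ?u then 0 else sw (c j)) * real M ^ potential n (j # w)) \<le>
     (\<Sum>j<n. real M ^ p * (s / real n + (if j \<in> set w then U else 0) + (if j \<in> T then s * q else 0)))"
    using step by (intro sum_mono) simp
  also have "\<dots> = real M ^ p * (s + real (card (set w)) * U + real (d ?u) * (s * q))"
  proof -
    have "(\<Sum>j<n. if j \<in> set w then U else 0) = real (card (set w)) * U"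
      using w(2) by (simp add: sum.If_cases Int_absorb1 inf_commute[of "{..<n}"] Int_absorb2)
    moreover have "(\<Sum>j<n. if j \<in> T then s * q else 0) = real (d ?u) * (s * q)"
    proof -
      have "{..<n} \<inter> T = T" by (auto simp: T_def)
      thus ?thesis using T by (simp add: sum.If_cases)
    qed
    ultimately show ?thesis using n by (simp add: sum_distrib_left[symmetric] sum.distrib)
  qed
  also have "\<dots> \<le> real M ^ p * (s + real M * U + s)"
  proof -
    have "real (card (set w)) * U \<le> real M * U" using cs U by (intro mult_right_mono) auto
    moreover have "real (d ?u) * (s * q) \<le> s" using mult_left_mono[OF q(2) s(1)] by (simp add: mult_ac)
    ultimately show ?thesis by (intro mult_left_mono) auto
  qed
  also have "\<dots> = (2 * s + s * real M ^ 3 / real n + B * (real M)\<^sup>2) * real M ^ p"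
    by (simp add: U_def power3_eq_cube power2_eq_square algebra_simps)
  finally have le: "(\<Sum>j<n. (if j = ?u then 0 else sw (c j)) * real M ^ potential n (j # w)) \<le>
    (2 * s + s * real M ^ 3 / real n + B * (real M)\<^sup>2) * real M ^ p" .
  have "(\<Sum>j<n. wt sw (j # w) * real M ^ potential n (j # w)) =
     wt sw w * (\<Sum>j<n. (if j = ?u then 0 else sw (c j)) * real M ^ potential n (j # w))"
    unfolding sum_distrib_left by (intro sum.cong refl) (simp add: wt_Cons[OF w(1)] c_def)
  also have "\<dots> \<le> wt sw w * ((2 * s + s * real M ^ 3 / real n + B * (real M)\<^sup>2) * real M ^ p)"
    using le W by (rule mult_left_mono)
  finally show ?thesis by (simp add: p_def mult_ac)
qed

section \<open>Traces of matrix powers as sums over walks\<close>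

definition walks :: "nat \<Rightarrow> nat \<Rightarrow> nat \<Rightarrow> nat list set" where
  "walks n r a = {w. length w = Suc r \<and> set w \<subseteq> {..<n} \<and> last w = a}"

lemma walks_0: "a < n \<Longrightarrow> walks n 0 a = {[a]}"
  by (auto simp: walks_def length_Suc_conv)

lemma walksD: "w \<in> walks n r a \<Longrightarrow> w \<noteq> [] \<and> hd w < n \<and> set w \<subseteq> {..<n} \<and> length w = Suc r"
  by (cases w) (auto simp: walks_def)

lemma sum_walks_Suc:
  "(\<Sum>w\<in>walks n (Suc r) a. f w) = (\<Sum>w\<in>walks n r a. \<Sum>j<n. f (j # w))"
proof -
  have "walks n (Suc r) a = (\<lambda>(w, j). j # w) ` (walks n r a \<times> {..<n})"
  proof (intro equalityI subsetI)
    fix w assume "w \<in> walks n (Suc r) a"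
    then obtain j w' where "w = j # w'" "w' \<in> walks n r a" "j < n"
      by (cases w) (auto simp: walks_def split: if_splits)
    thus "w \<in> (\<lambda>(w, j). j # w) ` (walks n r a \<times> {..<n})" by auto
  qed (auto simp: walks_def)
  moreover have inj: "inj_on (\<lambda>(w, j). j # w) (walks n r a \<times> {..<n})" by (auto simp: inj_on_def)
  ultimately show ?thesis
    by (simp only: sum.reindex[OF inj] sum.cartesian_product) (simp add: case_prod_beta)
qed

lemma hp_eq_sum_walks:
  assumes a: "a < n" shows "i < n \<Longrightarrow> hp n H r i a = (\<Sum>w\<in>walks n r a. if hd w = i then wprod H w else 0)"
proof (induction r arbitrary: i)
  case 0
  then show ?case using a by (auto simp: walks_0)
next
  case (Suc r)
  have "hp n H (Suc r) i a = (\<Sum>l<n. \<Sum>w\<in>walks n r a. H i l * (if hd w = l then wprod H w else 0))"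
    using Suc.IH by (simp add: sum_distrib_left)
  also have "\<dots> = (\<Sum>w\<in>walks n r a. \<Sum>l<n. H i l * (if hd w = l then wprod H w else 0))"
    by (rule sum.swap)
  also have "\<dots> = (\<Sum>w\<in>walks n r a. wprod H (i # w))"
  proof (rule sum.cong)
    fix w assume w: "w \<in> walks n r a"
    have "(\<Sum>l<n. H i l * (if hd w = l then wprod H w else 0)) =
        (\<Sum>l<n. if l = hd w then H i l * wprod H w else 0)"
      by (rule sum.cong) auto
    thus "(\<Sum>l<n. H i l * (if hd w = l then wprod H w else 0)) = wprod H (i # w)"
      using walksD[OF w] by (simp add: wprod_Cons)
  qed simp
  also have "\<dots> = (\<Sum>w\<in>walks n r a. \<Sum>j<n. if j = i then wprod H (j # w) else 0)"
    using Suc.prems by simp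
  finally show ?case unfolding sum_walks_Suc by simp
qed

lemma sum_wt_potential_le:
  assumes a: "a < n" and s: "s \<ge> 0" "B \<ge> 0" and r: "r < M"
  defines "A \<equiv> 2 * s + s * real M ^ 3 / real n + B * (real M)\<^sup>2"
  shows "(\<Sum>w\<in>walks n r a. wt (step_wt s B n) w * real M ^ potential n w) \<le> A ^ r"
  using r
proof (induction r)
  case 0
  show ?case using a by (simp add: walks_0 potential_def deg_def)
next
  case (Suc r)
  have A: "A \<ge> 0" using s by (simp add: A_def)
  have "(\<Sum>w\<in>walks n (Suc r) a. wt (step_wt s B n) w * real M ^ potential n w) \<le>
     (\<Sum>w\<in>walks n r a. A * (wt (step_wt s B n) w * real M ^ potential n w))"
    unfolding sum_walks_Suc A_def
    by (intro sum_mono sum_step_le) (use walksD Suc.prems s in \<open>auto simp: less_eq_Suc_le\<close>)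
  also have "\<dots> \<le> A * A ^ r"
    unfolding sum_distrib_left[symmetric] using Suc A by (intro mult_left_mono) auto
  finally show ?case by simp
qed

text \<open>The expected product along each walk is at most its weight; then the condition
  \<open>hd w = i\<close> is dropped and the \<open>n\<close> starting points are summed. The
  potential factor may be inserted because its base \<open>Suc N\<close>, the number of positions of
  a walk of \<open>N\<close> steps, is at least 1.\<close>

lemma expected_trace_power:
  assumes P: "prob_space P" and int: "\<And>m. m \<le> N \<Longrightarrow> integrable P (\<lambda>w. \<xi> w ^ m)"
    and bound: "\<And>m. m \<le> N \<Longrightarrow> \<bar>LINT w|P. \<xi> w ^ m\<bar> \<le> (\<Prod>i<m. step_wt s B n i)"
    and s: "s \<ge> 0" "B \<ge> 0"
  shows "integrable (noise n P) (\<lambda>W. \<Sum>i<n. hp n (entry \<xi> W) N i i)"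
    and "(LINT W|(noise n P). (\<Sum>i<n. hp n (entry \<xi> W) N i i)) \<le>
      real n * (2 * s + s * real (Suc N) ^ 3 / real n + B * (real (Suc N))\<^sup>2) ^ N"
proof -
  let ?sw = "step_wt s B n"
  have sw: "?sw m \<ge> 0" for m using s by (rule step_wt_nonneg)
  have nw1: "integrable (noise n P) (\<lambda>W. wprod (entry \<xi> W) w)"
    if "set w \<subseteq> {..<n}" "length w = Suc N" for w
    by (rule noise_wprod(1)[where N = N and sw = ?sw]) (use P int bound sw that in auto)
  have nw2: "\<bar>LINT W|(noise n P). wprod (entry \<xi> W) w\<bar> \<le> wt ?sw w"
    if "set w \<subseteq> {..<n}" "length w = Suc N" for w
    by (rule noise_wprod(2)[where N = N]) (use P int bound sw that in auto)
  have eq: "(\<Sum>i<n. hp n (entry \<xi> W) N i i) =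
      (\<Sum>i<n. \<Sum>w\<in>walks n N i. if hd w = i then wprod (entry \<xi> W) w else 0)" for W
    by (intro sum.cong refl hp_eq_sum_walks) auto
  have int': "integrable (noise n P) (\<lambda>W. if hd w = i then wprod (entry \<xi> W) w else 0)"
    if "w \<in> walks n N i" for w i
    using nw1[of w] walksD[OF that] by (cases "hd w = i") auto
  show "integrable (noise n P) (\<lambda>W. \<Sum>i<n. hp n (entry \<xi> W) N i i)"
    unfolding eq by (intro Bochner_Integration.integrable_sum int')
  have "(LINT W|(noise n P). (\<Sum>i<n. hp n (entry \<xi> W) N i i)) =
      (\<Sum>i<n. \<Sum>w\<in>walks n N i. LINT W|(noise n P). (if hd w = i then wprod (entry \<xi> W) w else 0))"
    unfolding eq using int' by (simp add: Bochner_Integration.integral_sum)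
  also have "\<dots> \<le> (\<Sum>i<n. \<Sum>w\<in>walks n N i. wt ?sw w * real (Suc N) ^ potential n w)"
  proof (intro sum_mono)
    fix i w assume "w \<in> walks n N i"
    note w = walksD[OF this]
    have "(LINT W|(noise n P). (if hd w = i then wprod (entry \<xi> W) w else 0)) \<le> wt ?sw w"
      using nw2[of w] w wt_nonneg[where sw = ?sw and w = w, OF sw]
      by (cases "hd w = i") (auto simp: abs_le_iff)
    also have "\<dots> = wt ?sw w * 1" by simp
    also have "\<dots> \<le> wt ?sw w * real (Suc N) ^ potential n w"
      using wt_nonneg[where sw = ?sw and w = w, OF sw] by (intro mult_left_mono one_le_power) auto
    finally show "(LINT W|(noise n P). (if hd w = i then wprod (entry \<xi> W) w else 0)) \<le>
      wt ?sw w * real (Suc N) ^ potential n w" .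
  qed
  also have "\<dots> \<le> (\<Sum>i<n. (2 * s + s * real (Suc N) ^ 3 / real n + B * (real (Suc N))\<^sup>2) ^ N)"
    using s by (intro sum_mono sum_wt_potential_le) auto
  finally show "(LINT W|(noise n P). (\<Sum>i<n. hp n (entry \<xi> W) N i i)) \<le>
      real n * (2 * s + s * real (Suc N) ^ 3 / real n + B * (real (Suc N))\<^sup>2) ^ N"
    by simp
qed

section \<open>Second moments along self-avoiding walks\<close>

text \<open>The factors for an edge used not at all, once, and twice. The last two are centred, so
  that an edge used by only one of two walks kills the expectation of their product.\<close>

fun psi :: "(real \<Rightarrow> real) \<Rightarrow> real \<Rightarrow> nat \<Rightarrow> real \<Rightarrow> real" where
  "psi \<xi> v 0 w = 1"
| "psi \<xi> v (Suc 0) w = \<xi> w"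
| "psi \<xi> v (Suc (Suc _)) w = \<xi> w ^ 2 - v"

definition Psi :: "nat \<Rightarrow> (real \<Rightarrow> real) \<Rightarrow> real \<Rightarrow> nat list \<Rightarrow> (nat \<times> nat \<Rightarrow> real) \<Rightarrow> real" where
  "Psi n \<xi> v w W = (\<Prod>e\<in>edges n. psi \<xi> v (cnt w e) (W e))"

text \<open>The weights multiply to bounds for the \<open>L2\<close> norms of \<open>psi\<close>:
  \<open>q\<close> for one use and \<open>q * B\<close> for two, as \<open>\<xi>^2 - v\<close> has
  second moment at most \<open>q^2 * B^2\<close>.\<close>

fun psi_wt :: "real \<Rightarrow> real \<Rightarrow> nat \<Rightarrow> real" where
  "psi_wt q B 0 = q"
| "psi_wt q B (Suc 0) = B"
| "psi_wt q B (Suc (Suc _)) = 1"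

lemma psi_wt_nonneg: "q \<ge> 0 \<Longrightarrow> B \<ge> 0 \<Longrightarrow> psi_wt q B m \<ge> 0"
  by (induction q B m rule: psi_wt.induct) auto

lemma prod_psi_wt_ge_2: "(\<Prod>i<Suc (Suc m). psi_wt q B i) = q * B"
proof (induction m)
  case (Suc m)
  then show ?case by (subst prod.lessThan_Suc) simp
qed (simp add: lessThan_Suc)

text \<open>The third and fourth moments are bounded in the form valid for variables of variance at
  most \<open>q^2\<close> and absolute value at most \<open>B\<close>. Order four is the highest one
  that arises, from the square of \<open>\<xi>^2 - v\<close>.\<close>

locale centred_entry = prob_space P for P :: "real measure" +
  fixes \<xi> :: "real \<Rightarrow> real" and v q B :: real
  assumes int: "\<And>m. m \<le> 4 \<Longrightarrow> integrable P (\<lambda>w. \<xi> w ^ m)"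
    and mean0: "(LINT w|P. \<xi> w) = 0" and var: "(LINT w|P. \<xi> w ^ 2) = v" "v \<le> q\<^sup>2"
    and third: "\<bar>LINT w|P. \<xi> w ^ 3\<bar> \<le> q\<^sup>2 * B" and fourth: "(LINT w|P. \<xi> w ^ 4) \<le> q\<^sup>2 * B\<^sup>2"
    and nonneg: "q \<ge> 0" "B \<ge> 0"
begin

lemma v_nonneg: "v \<ge> 0"
  unfolding var(1)[symmetric] by (rule integral_nonneg_AE) auto

lemma psi_pair:
  shows "integrable P (\<lambda>w. psi \<xi> v a w * psi \<xi> v b w)"
    and "\<bar>LINT w|P. psi \<xi> v a w * psi \<xi> v b w\<bar> \<le>
      (if (a = 0) = (b = 0) then (\<Prod>i<a. psi_wt q B i) * (\<Prod>i<b. psi_wt q B i) else 0)"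
proof -
  have i: "integrable P \<xi>" "integrable P (\<lambda>w. \<xi> w ^ 2)" "integrable P (\<lambda>w. \<xi> w ^ 3)" "integrable P (\<lambda>w. \<xi> w ^ 4)"
    using int[of 1] int[of 2] int[of 3] int[of 4] by simp_all
  have e: "\<xi> w * (\<xi> w ^ 2 - v) = \<xi> w ^ 3 - v * \<xi> w" "(\<xi> w ^ 2 - v) * \<xi> w = \<xi> w ^ 3 - v * \<xi> w"
    "(\<xi> w ^ 2 - v) * (\<xi> w ^ 2 - v) = \<xi> w ^ 4 - 2 * v * \<xi> w ^ 2 + v\<^sup>2" "\<xi> w * \<xi> w = \<xi> w ^ 2" for w
    by (simp_all add: algebra_simps power2_eq_square power3_eq_cube power4_eq_xxxx)
  have l2: "(LINT w|P. \<xi> w ^ 2 - v) = 0" using i var by (simp add: prob_space)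
  have l3: "(LINT w|P. \<xi> w ^ 3 - v * \<xi> w) = (LINT w|P. \<xi> w ^ 3)" using i mean0 by simp
  have l4: "(LINT w|P. \<xi> w ^ 4 - 2 * v * \<xi> w ^ 2 + v\<^sup>2) = (LINT w|P. \<xi> w ^ 4) - v\<^sup>2"
    using i var by (simp add: prob_space power2_eq_square)
  have "(LINT w|P. \<xi> w ^ 4 - 2 * v * \<xi> w ^ 2 + v\<^sup>2) \<ge> 0"
    unfolding e(3)[symmetric] by (rule integral_nonneg_AE) auto
  hence l4': "\<bar>(LINT w|P. \<xi> w ^ 4) - v\<^sup>2\<bar> \<le> q\<^sup>2 * B\<^sup>2"
    using l4 fourth zero_le_power2[of v] by linarith
  consider "a = 0" | "a = 1" | a' where "a = Suc (Suc a')" by (cases a; cases "a - 1") auto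
  note ca = this
  consider "b = 0" | "b = 1" | b' where "b = Suc (Suc b')" by (cases b; cases "b - 1") auto
  note cb = this
  have p1: "(\<Prod>i<Suc 0. psi_wt q B i) = q" by simp
  show "integrable P (\<lambda>w. psi \<xi> v a w * psi \<xi> v b w)"
    by (rule ca; rule cb) (simp_all add: e i)
  show "\<bar>LINT w|P. psi \<xi> v a w * psi \<xi> v b w\<bar> \<le>
      (if (a = 0) = (b = 0) then (\<Prod>i<a. psi_wt q B i) * (\<Prod>i<b. psi_wt q B i) else 0)"
  proof (rule ca)
    assume a: "a = 0"
    show ?thesis
      by (rule cb) (simp_all add: a l2 mean0 prob_space del: prod.lessThan_Suc)
  next
    assume a: "a = 1"
    show ?thesis
    proof (rule cb)
      assume b: "b = 1"
      have "\<bar>v\<bar> \<le> q * q" using var(2) v_nonneg by (simp add: power2_eq_square)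
      thus ?thesis by (simp add: a b e(4) var(1))
    next
      fix b' assume b: "b = Suc (Suc b')"
      show ?thesis
        unfolding a b One_nat_def prod_psi_wt_ge_2 p1 psi.simps e(1) l3
        using third by (simp add: power2_eq_square mult_ac)
    qed (simp add: a mean0)
  next
    fix a' assume a: "a = Suc (Suc a')"
    show ?thesis
    proof (rule cb)
      assume b: "b = 1"
      show ?thesis
        unfolding a b One_nat_def prod_psi_wt_ge_2 p1 psi.simps e(2) l3
        using third by (simp add: power2_eq_square mult_ac)
    next
      fix b' assume b: "b = Suc (Suc b')"
      have "q\<^sup>2 * B\<^sup>2 = q * B * (q * B)" by (simp add: power2_eq_square)
      thus ?thesis unfolding a b prod_psi_wt_ge_2 psi.simps e(3) l4 using l4' by simp
    qed (simp add: a l2 del: prod.lessThan_Suc)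
  qed
qed

text \<open>By independence the expectation is a product over edges, and an edge present in only one
  of the two walks contributes the factor 0 by centring.\<close>

lemma Psi_pair:
  assumes w: "distinct_adj w" "set w \<subseteq> {..<n}" and w': "distinct_adj w'" "set w' \<subseteq> {..<n}"
  shows "integrable (noise n P) (\<lambda>W. Psi n \<xi> v w W * Psi n \<xi> v w' W)"
    and "\<bar>LINT W|(noise n P). Psi n \<xi> v w W * Psi n \<xi> v w' W\<bar> \<le>
      (if \<forall>e\<in>edges n. (cnt w e = 0) = (cnt w' e = 0) then wt (psi_wt q B) w * wt (psi_wt q B) w' else 0)"
proof -
  note P = prob_space_axioms
  note * = noise_prod[OF P, where n = n and u = "\<lambda>e u. psi \<xi> v (cnt w e) u * psi \<xi> v (cnt w' e) u"]
  have eq: "Psi n \<xi> v w W * Psi n \<xi> v w' W = (\<Prod>e\<in>edges n. psi \<xi> v (cnt w e) (W e) * psi \<xi> v (cnt w' e) (W e))" for W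
    by (simp add: Psi_def prod.distrib)
  show "integrable (noise n P) (\<lambda>W. Psi n \<xi> v w W * Psi n \<xi> v w' W)"
    unfolding eq by (rule *(1)) (rule psi_pair)
  let ?b = "\<lambda>a b. if (a = 0) = (b = 0) then (\<Prod>i<a. psi_wt q B i) * (\<Prod>i<b. psi_wt q B i) else 0"
  have "\<bar>LINT W|(noise n P). Psi n \<xi> v w W * Psi n \<xi> v w' W\<bar> =
      (\<Prod>e\<in>edges n. \<bar>LINT u|P. psi \<xi> v (cnt w e) u * psi \<xi> v (cnt w' e) u\<bar>)"
    unfolding eq using *(2)[OF psi_pair(1)] by (simp only: abs_prod)
  also have "\<dots> \<le> (\<Prod>e\<in>edges n. ?b (cnt w e) (cnt w' e))"
    by (intro prod_mono conjI psi_pair(2) abs_ge_zero)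
  also have "\<dots> = (if \<forall>e\<in>edges n. (cnt w e = 0) = (cnt w' e = 0) then wt (psi_wt q B) w * wt (psi_wt q B) w' else 0)"
  proof (cases "\<forall>e\<in>edges n. (cnt w e = 0) = (cnt w' e = 0)")
    case True
    have "(\<Prod>e\<in>edges n. ?b (cnt w e) (cnt w' e)) =
        (\<Prod>e\<in>edges n. (\<Prod>i<cnt w e. psi_wt q B i) * (\<Prod>i<cnt w' e. psi_wt q B i))"
      by (intro prod.cong refl if_P) (use True in blast)
    then show ?thesis
      unfolding if_P[OF True] wt_eq_prod[OF w] wt_eq_prod[OF w'] prod.distrib .
  next
    case False
    then obtain e where e: "e \<in> edges n" "(cnt w e = 0) \<noteq> (cnt w' e = 0)" by blast
    have "(\<Prod>e\<in>edges n. ?b (cnt w e) (cnt w' e)) = 0"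
      by (rule prod_zero[OF finite_edges bexI[OF _ e(1)]]) (simp only: e(2) if_False)
    then show ?thesis unfolding if_not_P[OF False] .
  qed
  finally show "\<bar>LINT W|(noise n P). Psi n \<xi> v w W * Psi n \<xi> v w' W\<bar> \<le>
      (if \<forall>e\<in>edges n. (cnt w e = 0) = (cnt w' e = 0) then wt (psi_wt q B) w * wt (psi_wt q B) w' else 0)" .
qed

end

lemma ex_cnt_pos:
  "distinct_adj w \<Longrightarrow> length w \<ge> 2 \<Longrightarrow> u \<in> set w \<Longrightarrow> \<exists>u'. u' \<in> set w \<and> u' \<noteq> u \<and> cnt w (edge u u') > 0"
proof (induction w rule: induct_list012)
  case (3 x y zs)
  show ?case
  proof (cases "u = x")
    case True
    then show ?thesis using 3 by (intro exI[of _ y]) auto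
  next
    case ux: False
    show ?thesis
    proof (cases zs)
      case Nil
      then show ?thesis using 3 ux by (intro exI[of _ x]) (auto simp: edge_commute)
    next
      case (Cons z zs')
      then obtain u' where "u' \<in> set (y # zs)" "u' \<noteq> u" "cnt (y # zs) (edge u u') > 0"
        using 3 ux by auto
      then show ?thesis by (intro exI[of _ u']) auto
    qed
  qed
qed auto

text \<open>Every vertex of a walk with at least one step lies on a crossed edge, so the edge
  support determines the vertex set.\<close>

lemma same_support_subset:
  assumes w': "distinct_adj w'" "length w' \<ge> 2" "set w' \<subseteq> {..<n}"
    and e: "\<forall>e\<in>edges n. (cnt w e = 0) = (cnt w' e = 0)"
  shows "set w' \<subseteq> set w"
proof
  fix u assume u: "u \<in> set w'"
  then obtain u' where u': "u' \<in> set w'" "u' \<noteq> u" "cnt w' (edge u u') > 0" using ex_cnt_pos[OF w'(1,2)] by blast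
  hence "edge u u' \<in> edges n" using u w'(3) by (intro edge_in_edges) auto
  hence "cnt w (edge u u') > 0" using e u'(3) by auto
  thus "u \<in> set w" using cnt_edge_pos_in_set by blast
qed

context centred_entry
begin

text \<open>Only walks with equal edge support correlate. A partner of \<open>w\<close> is then a
  list of length \<open>L\<close> over the at most \<open>L\<close> vertices of \<open>w\<close>, so
  there are at most \<open>L^L\<close> partners, uniformly in \<open>n\<close>; bounding each cross
  term by the arithmetic-geometric inequality leaves only the sum of squares.\<close>

lemma second_moment:
  assumes fin: "finite S" and S: "\<And>w. w \<in> S \<Longrightarrow> distinct_adj w \<and> set w \<subseteq> {..<n} \<and> length w = L"
    and L: "L \<ge> 2" and R: "\<And>w. w \<in> S \<Longrightarrow> wt (psi_wt q B) w \<le> R"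
  shows "integrable (noise n P) (\<lambda>W. (\<Sum>w\<in>S. c w * Psi n \<xi> v w W)\<^sup>2)"
    and "(LINT W|(noise n P). (\<Sum>w\<in>S. c w * Psi n \<xi> v w W)\<^sup>2) \<le> R\<^sup>2 * real L ^ L * (\<Sum>w\<in>S. (c w)\<^sup>2)"
proof -
  define ss where "ss w w' \<longleftrightarrow> (\<forall>e\<in>edges n. (cnt w e = 0) = (cnt w' e = 0))" for w w'
  have ss_sym: "ss w w' = ss w' w" for w w' unfolding ss_def by blast
  have eq: "(\<Sum>w\<in>S. c w * Psi n \<xi> v w W)\<^sup>2 =
      (\<Sum>w\<in>S. \<Sum>w'\<in>S. c w * c w' * (Psi n \<xi> v w W * Psi n \<xi> v w' W))" for W
    unfolding power2_eq_square sum_product by (intro sum.cong refl) (simp only: mult_ac)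
  have I: "integrable (noise n P) (\<lambda>W. c w * c w' * (Psi n \<xi> v w W * Psi n \<xi> v w' W))"
    if "w \<in> S" "w' \<in> S" for w w'
    using S that by (intro integrable_mult_right Psi_pair(1)) auto
  show "integrable (noise n P) (\<lambda>W. (\<Sum>w\<in>S. c w * Psi n \<xi> v w W)\<^sup>2)"
    unfolding eq by (intro Bochner_Integration.integrable_sum I)
  have wt0: "wt (psi_wt q B) w \<ge> 0" for w using nonneg by (intro wt_nonneg psi_wt_nonneg)
  have card: "card {w' \<in> S. ss w w'} \<le> L ^ L" if w: "w \<in> S" for w
  proof -
    have "{w' \<in> S. ss w w'} \<subseteq> {w'. set w' \<subseteq> set w \<and> length w' = L}"
    proof
      fix w' assume w': "w' \<in> {w' \<in> S. ss w w'}"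
      hence w'': "w' \<in> S" "ss w w'" by auto
      have "set w' \<subseteq> set w"
      proof (rule same_support_subset[where n = n])
        show "distinct_adj w'" "length w' \<ge> 2" "set w' \<subseteq> {..<n}" using S[OF w''(1)] L by auto
        show "\<forall>e\<in>edges n. (cnt w e = 0) = (cnt w' e = 0)" using w''(2) unfolding ss_def .
      qed
      thus "w' \<in> {w'. set w' \<subseteq> set w \<and> length w' = L}" using w' S by auto
    qed
    hence "card {w' \<in> S. ss w w'} \<le> card (set w) ^ L"
      unfolding card_lists_length_eq[OF finite_set, symmetric] by (rule card_mono[OF finite_lists_length_eq[OF finite_set]])
    also have "card (set w) \<le> L" using card_length[of w] S[OF w] by metis
    hence "card (set w) ^ L \<le> L ^ L" by (rule power_mono) simp
    finally show ?thesis .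
  qed
  \<comment> \<open>Each of \<open>w\<close> and \<open>w'\<close> takes half of its own square. As
    \<open>ss\<close> is symmetric, the two halves have the same double sum, and only the number of
    partners of a single walk enters.\<close>
  define g where "g w w' = (if ss w w' then R\<^sup>2 * (c w)\<^sup>2 / 2 else 0)" for w w'
  have "(LINT W|(noise n P). (\<Sum>w\<in>S. c w * Psi n \<xi> v w W)\<^sup>2) =
      (\<Sum>w\<in>S. \<Sum>w'\<in>S. c w * c w' * (LINT W|(noise n P). Psi n \<xi> v w W * Psi n \<xi> v w' W))"
  proof -
    have "(LINT W|(noise n P). (\<Sum>w\<in>S. \<Sum>w'\<in>S. c w * c w' * (Psi n \<xi> v w W * Psi n \<xi> v w' W))) =
      (\<Sum>w\<in>S. LINT W|(noise n P). (\<Sum>w'\<in>S. c w * c w' * (Psi n \<xi> v w W * Psi n \<xi> v w' W)))"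
      by (intro Bochner_Integration.integral_sum Bochner_Integration.integrable_sum I)
    also have "\<dots> = (\<Sum>w\<in>S. \<Sum>w'\<in>S. LINT W|(noise n P). c w * c w' * (Psi n \<xi> v w W * Psi n \<xi> v w' W))"
      by (intro sum.cong refl Bochner_Integration.integral_sum I)
    finally show ?thesis unfolding eq integral_mult_right_zero .
  qed
  also have "\<dots> \<le> (\<Sum>w\<in>S. \<Sum>w'\<in>S. g w w' + g w' w)"
  proof (intro sum_mono)
    fix w w' assume w: "w \<in> S" "w' \<in> S"
    let ?E = "LINT W|(noise n P). Psi n \<xi> v w W * Psi n \<xi> v w' W"
    have "c w * c w' * ?E \<le> \<bar>c w * c w'\<bar> * \<bar>?E\<bar>"
      unfolding abs_mult[of "c w * c w'" ?E, symmetric] by (rule abs_ge_self)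
    also have "\<dots> \<le> \<bar>c w * c w'\<bar> * (if ss w w' then R\<^sup>2 else 0)"
    proof (intro mult_left_mono)
      have "wt (psi_wt q B) w * wt (psi_wt q B) w' \<le> R * R"
        using R[OF w(1)] R[OF w(2)] wt0[of w] wt0[of w'] by (intro mult_mono) auto
      moreover have "\<bar>?E\<bar> \<le> (if ss w w' then wt (psi_wt q B) w * wt (psi_wt q B) w' else 0)"
        unfolding ss_def using S[OF w(1)] S[OF w(2)] by (intro Psi_pair(2)) blast+
      moreover have "(if ss w w' then wt (psi_wt q B) w * wt (psi_wt q B) w' else 0) \<le> (if ss w w' then R * R else 0)"
        if "wt (psi_wt q B) w * wt (psi_wt q B) w' \<le> R * R" using that by (cases "ss w w'") simp_all
      ultimately show "\<bar>?E\<bar> \<le> (if ss w w' then R\<^sup>2 else 0)"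
        unfolding power2_eq_square by linarith
    qed auto
    also have "\<dots> \<le> g w w' + g w' w"
    proof -
      have "\<bar>c w * c w'\<bar> \<le> ((c w)\<^sup>2 + (c w')\<^sup>2) / 2"
        using sum_squares_bound[of "\<bar>c w\<bar>" "\<bar>c w'\<bar>"] by (simp add: abs_mult)
      hence "R\<^sup>2 * \<bar>c w * c w'\<bar> \<le> R\<^sup>2 * (((c w)\<^sup>2 + (c w')\<^sup>2) / 2)" by (intro mult_left_mono) auto
      thus ?thesis
        unfolding g_def ss_sym[of w' w] by (cases "ss w w'") (simp_all add: distrib_left add_divide_distrib mult.commute)
    qed
    finally show "c w * c w' * ?E \<le> g w w' + g w' w" .
  qed
  also have "\<dots> = 2 * (\<Sum>w\<in>S. \<Sum>w'\<in>S. g w w')"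
    unfolding sum.distrib mult_2 by (rule arg_cong2[where f = "(+)", OF refl]) (rule sum.swap)
  also have "(\<Sum>w\<in>S. \<Sum>w'\<in>S. g w w') \<le> (\<Sum>w\<in>S. real L ^ L * (R\<^sup>2 * (c w)\<^sup>2 / 2))"
  proof (rule sum_mono)
    fix w assume w: "w \<in> S"
    have "(\<Sum>w'\<in>S. g w w') = real (card {w' \<in> S. ss w w'}) * (R\<^sup>2 * (c w)\<^sup>2 / 2)"
      unfolding g_def sum.If_cases[OF fin] by (simp add: Collect_conj_eq)
    also have "\<dots> \<le> real (L ^ L) * (R\<^sup>2 * (c w)\<^sup>2 / 2)"
      by (intro mult_right_mono of_nat_mono card[OF w]) simp
    finally show "(\<Sum>w'\<in>S. g w w') \<le> real L ^ L * (R\<^sup>2 * (c w)\<^sup>2 / 2)" by simp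
  qed
  finally show "(LINT W|(noise n P). (\<Sum>w\<in>S. c w * Psi n \<xi> v w W)\<^sup>2) \<le> R\<^sup>2 * real L ^ L * (\<Sum>w\<in>S. (c w)\<^sup>2)"
    by (simp add: sum_distrib_left mult_ac)
qed

end

section \<open>Self-avoiding walks and the lassos obtained by closing them\<close>

definition paths :: "nat \<Rightarrow> nat \<Rightarrow> nat list set" where
  "paths n k = {w. length w = Suc k \<and> distinct w \<and> set w \<subseteq> {..<n}}"

lemma finite_paths [simp]: "finite (paths n k)"
  by (rule finite_subset[OF _ finite_lists_length_eq[of "{..<n}" "Suc k"]]) (auto simp: paths_def)

lemma pathsD:
  assumes "w \<in> paths n k"
  shows "w \<noteq> [] \<and> hd w < n \<and> last w < n \<and> set w \<subseteq> {..<n} \<and> length w = Suc k \<and> distinct w"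
proof -
  have w: "w \<noteq> []" "set w \<subseteq> {..<n}" "length w = Suc k" "distinct w" using assms by (auto simp: paths_def)
  hence "hd w \<in> {..<n}" "last w \<in> {..<n}" using hd_in_set[of w] last_in_set[of w] by blast+
  with w show ?thesis by simp
qed

lemma paths_0: "paths n 0 = (\<lambda>a. [a]) ` {..<n}"
  by (auto simp: paths_def length_Suc_conv)

lemma sum_paths_0: "(\<Sum>w\<in>paths n 0. f w) = (\<Sum>a<n. f [a])"
  unfolding paths_0 by (subst sum.reindex) (auto simp: inj_on_def)

lemma sum_paths_Suc:
  "(\<Sum>w\<in>paths n (Suc k). f w) = (\<Sum>w\<in>paths n k. \<Sum>j\<in>{..<n} - set w. f (j # w))"
proof -
  have eq: "paths n (Suc k) = (\<lambda>(w, j). j # w) ` Sigma (paths n k) (\<lambda>w. {..<n} - set w)"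
  proof (intro equalityI subsetI)
    fix w assume "w \<in> paths n (Suc k)"
    then obtain j w' where "w = j # w'" "w' \<in> paths n k" "j < n" "j \<notin> set w'"
      by (cases w) (auto simp: paths_def)
    thus "w \<in> (\<lambda>(w, j). j # w) ` Sigma (paths n k) (\<lambda>w. {..<n} - set w)" by auto
  qed (auto simp: paths_def)
  have inj: "inj_on (\<lambda>(w, j). j # w) (Sigma (paths n k) (\<lambda>w. {..<n} - set w))" by (auto simp: inj_on_def)
  show ?thesis
    unfolding eq by (simp add: sum.reindex[OF inj] sum.Sigma) (simp add: case_prod_beta)
qed

lemma distinct_cnt_le_1: "distinct w \<Longrightarrow> cnt w e \<le> 1"
proof (induction w rule: induct_list012)
  case (3 x y zs)
  have "cnt (y # zs) (edge x y) = 0"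
    using 3(3) cnt_edge_pos_in_set[of "y # zs" x y] by (cases "cnt (y # zs) (edge x y)") auto
  then show ?case using 3 by auto
qed auto

lemma distinct_imp_distinct_adj': "distinct w \<Longrightarrow> distinct_adj w"
  by (induction w rule: induct_list012) auto

lemma wt_psi_distinct: "distinct w \<Longrightarrow> wt (psi_wt q B) w = q ^ (length w - 1)"
proof (induction w rule: induct_list012)
  case (3 x y zs)
  have "cnt (y # zs) (edge x y) = 0"
    using 3(3) cnt_edge_pos_in_set[of "y # zs" x y] by (cases "cnt (y # zs) (edge x y)") auto
  then show ?case using 3 by auto
qed auto

lemma cnt_distinct_edge:
  assumes "distinct w" "w \<noteq> []" "i \<in> set (tl w)"
  shows "cnt w (edge i (hd w)) = (if hd (tl w) = i then 1 else 0)"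
proof -
  obtain a b zs where w: "w = a # b # zs" using assms by (cases w; cases "tl w") auto
  have "cnt (b # zs) (edge i a) = 0"
    using assms w cnt_edge_pos_in_set[of "b # zs" i a] by (cases "cnt (b # zs) (edge i a)") auto
  then show ?thesis using assms w by (auto simp: edge_eq_iff)
qed

lemma wprod_eq_Psi:
  assumes "distinct_adj w" "set w \<subseteq> {..<n}" "\<And>e. cnt w e \<le> 1"
  shows "wprod (entry \<xi> W) w = Psi n \<xi> v w W"
  unfolding wprod_entry[OF assms(1,2)] Psi_def
proof (rule prod.cong)
  fix e show "\<xi> (W e) ^ cnt w e = psi \<xi> v (cnt w e) (W e)"
    using assms(3)[of e] by (cases "cnt w e") auto
qed simp

text \<open>A self-avoiding walk extended to one of its own vertices repeats an edge only when it
  steps straight back. The doubled edge then contributes \<open>\<xi>^2 = (\<xi>^2 - v) + v\<close>,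
  and the deterministic part \<open>v\<close> leaves the walk with these two steps erased.\<close>

lemma wprod_lasso:
  assumes w: "distinct w" "w \<noteq> []" "set w \<subseteq> {..<n}" and i: "i \<in> set (tl w)"
  shows "wprod (entry \<xi> W) (i # w) = Psi n \<xi> v (i # w) W + (if hd (tl w) = i then v * wprod (entry \<xi> W) (tl w) else 0)"
proof -
  obtain a b zs where ab: "w = a # b # zs" using w i by (cases w; cases "tl w") auto
  have adj: "distinct_adj w" using w by (simp add: distinct_imp_distinct_adj')
  hence adj': "distinct_adj (i # w)" "set (i # w) \<subseteq> {..<n}" using i w ab by auto
  have c1: "cnt w e \<le> 1" for e using w(1) by (rule distinct_cnt_le_1)
  have ci: "cnt (i # w) e = (if e = edge i (hd w) then 1 else 0) + cnt w e" for e
    using w by (simp add: cnt_Cons)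
  show ?thesis
  proof (cases "hd (tl w) = i")
    case False
    have "cnt w (edge i (hd w)) = 0" using cnt_distinct_edge[OF w(1,2) i] False by simp
    hence "cnt (i # w) e \<le> 1" for e using c1[of e] by (auto simp: ci)
    thus ?thesis using wprod_eq_Psi[OF adj'] False by simp
  next
    case True
    hence b: "b = i" using ab by simp
    let ?e = "edge i a"
    have e: "?e \<in> edges n" using w ab b by (intro edge_in_edges) auto
    have "cnt (b # zs) ?e = 0"
      using w ab cnt_edge_pos_in_set[of "b # zs" i a] by (cases "cnt (b # zs) ?e") auto
    hence z: "cnt (b # zs) ?e = 0" "cnt (i # w) ?e = 2" using ab b by (auto simp: edge_commute)
    have z': "cnt (i # w) e = cnt (b # zs) e" if "e \<noteq> ?e" for e using that ab b by (auto simp: edge_commute)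
    have z1: "cnt (b # zs) e \<le> 1" for e using distinct_cnt_le_1[of "b # zs" e] w ab by simp
    define R where "R = (\<Prod>e\<in>edges n - {?e}. \<xi> (W e) ^ cnt (b # zs) e)"
    have "wprod (entry \<xi> W) (i # w) = \<xi> (W ?e) ^ 2 * R"
      unfolding wprod_entry[OF adj'] by (simp add: prod.remove[OF finite_edges e] z R_def z' del: cnt.simps)
    moreover have "wprod (entry \<xi> W) (tl w) = R"
    proof -
      have "wprod (entry \<xi> W) (b # zs) = (\<Prod>e\<in>edges n. \<xi> (W e) ^ cnt (b # zs) e)"
        using adj w ab by (intro wprod_entry) auto
      thus ?thesis using ab by (simp add: prod.remove[OF finite_edges e] z R_def)
    qed
    moreover have "Psi n \<xi> v (i # w) W = (\<xi> (W ?e) ^ 2 - v) * R"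
    proof -
      have "psi \<xi> v (cnt (b # zs) e) (W e) = \<xi> (W e) ^ cnt (b # zs) e" for e
        using z1[of e] by (cases "cnt (b # zs) e") auto
      thus ?thesis
        unfolding Psi_def by (simp add: prod.remove[OF finite_edges e] z R_def z' numeral_2_eq_2 del: cnt.simps)
    qed
    ultimately show ?thesis using True by (simp add: algebra_simps)
  qed
qed

text \<open>The Krylov vectors \<open>kry\<close> approximate \<open>p\<^sub>k(H) x\<close> for the Chebyshev polynomials
  \<open>p\<^sub>k\<^sub>+\<^sub>1(t) = t p\<^sub>k(t) - F p\<^sub>k\<^sub>-\<^sub>1(t)\<close>.\<close>

definition kry :: "nat \<Rightarrow> (nat \<Rightarrow> nat \<Rightarrow> real) \<Rightarrow> (nat \<Rightarrow> real) \<Rightarrow> nat \<Rightarrow> nat \<Rightarrow> real" where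
  "kry n H x k i = (\<Sum>w\<in>paths n k. if hd w = i then wprod H w * x (last w) else 0)"

text \<open>The centred contribution of the walks that stop being self-avoiding after one more step.
  Only \<open>tl w\<close> is tested, since a step from \<open>hd w\<close> to itself has the entry
  0.\<close>

definition kry_rem :: "nat \<Rightarrow> (real \<Rightarrow> real) \<Rightarrow> real \<Rightarrow> (nat \<times> nat \<Rightarrow> real) \<Rightarrow> (nat \<Rightarrow> real) \<Rightarrow> nat \<Rightarrow> nat \<Rightarrow> real" where
  "kry_rem n \<xi> v W x k i = (\<Sum>w\<in>paths n k. if i \<in> set (tl w) then Psi n \<xi> v (i # w) W * x (last w) else 0)"

lemma kry_0: "i < n \<Longrightarrow> kry n H x 0 i = x i"
  by (simp add: kry_def sum_paths_0)

lemma kry_Suc: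
  assumes "i < n"
  shows "kry n H x (Suc k) i = (\<Sum>w\<in>paths n k. if i \<notin> set w then wprod H (i # w) * x (last w) else 0)"
  unfolding kry_def sum_paths_Suc
proof (rule sum.cong)
  fix w assume w: "w \<in> paths n k"
  have "(\<Sum>j\<in>{..<n} - set w. if hd (j # w) = i then wprod H (j # w) * x (last (j # w)) else 0) =
     (\<Sum>j\<in>{..<n} - set w. if j = i then wprod H (i # w) * x (last w) else 0)"
    using pathsD[OF w] by (intro sum.cong) auto
  thus "(\<Sum>j\<in>{..<n} - set w. if hd (j # w) = i then wprod H (j # w) * x (last (j # w)) else 0) =
     (if i \<notin> set w then wprod H (i # w) * x (last w) else 0)" using assms by simp
qed simp

lemma mv_kry:
  assumes i: "i < n" and H: "\<And>i. H i i = 0"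
  shows "mv n H (kry n H x k) i = kry n H x (Suc k) i +
     (\<Sum>w\<in>paths n k. if i \<in> set (tl w) then wprod H (i # w) * x (last w) else 0)"
proof -
  have "mv n H (kry n H x k) i = (\<Sum>j<n. \<Sum>w\<in>paths n k. H i j * (if hd w = j then wprod H w * x (last w) else 0))"
    by (simp add: mv_def kry_def sum_distrib_left)
  also have "\<dots> = (\<Sum>w\<in>paths n k. \<Sum>j<n. H i j * (if hd w = j then wprod H w * x (last w) else 0))"
    by (rule sum.swap)
  also have "\<dots> = (\<Sum>w\<in>paths n k. (if i \<notin> set w then wprod H (i # w) * x (last w) else 0) +
      (if i \<in> set (tl w) then wprod H (i # w) * x (last w) else 0))"
  proof (rule sum.cong)
    fix w assume w: "w \<in> paths n k"
    note w' = pathsD[OF w]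
    have "(\<Sum>j<n. H i j * (if hd w = j then wprod H w * x (last w) else 0)) =
        (\<Sum>j<n. if j = hd w then H i j * wprod H w * x (last w) else 0)"
      by (intro sum.cong) auto
    also have "\<dots> = wprod H (i # w) * x (last w)" using w' by (simp add: wprod_Cons)
    also have "\<dots> = (if i \<notin> set w then wprod H (i # w) * x (last w) else 0) +
      (if i \<in> set (tl w) then wprod H (i # w) * x (last w) else 0)"
      using w' H by (cases w) (auto simp: wprod_Cons)
    finally show "(\<Sum>j<n. H i j * (if hd w = j then wprod H w * x (last w) else 0)) = \<dots>" .
  qed simp
  finally show ?thesis using i by (simp add: kry_Suc sum.distrib)
qed

lemma mv_kry_0:
  assumes "i < n"
  shows "mv n (entry \<xi> W) (kry n (entry \<xi> W) x 0) i = kry n (entry \<xi> W) x (Suc 0) i"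
proof -
  have "(\<Sum>w\<in>paths n 0. if i \<in> set (tl w) then wprod (entry \<xi> W) (i # w) * x (last w) else 0) = 0"
    unfolding sum_paths_0 by simp
  thus ?thesis using assms by (subst mv_kry) (auto simp: entry_def)
qed

text \<open>The term in \<open>kry k\<close> collects the immediate backtracks: the erased vertex is
  any of the \<open>n - Suc k\<close> vertices off the remaining walk, and each gives
  \<open>v\<close>. For \<open>v\<close> close to \<open>F / n\<close> this is the three-term
  Chebyshev recursion.\<close>

lemma mv_kry_Suc:
  assumes i: "i < n"
  shows "mv n (entry \<xi> W) (kry n (entry \<xi> W) x (Suc k)) i = kry n (entry \<xi> W) x (Suc (Suc k)) i +
     v * real (n - Suc k) * kry n (entry \<xi> W) x k i + kry_rem n \<xi> v W x (Suc k) i"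
proof -
  let ?H = "entry \<xi> W"
  have "(\<Sum>w\<in>paths n (Suc k). if i \<in> set (tl w) then wprod ?H (i # w) * x (last w) else 0) =
     (\<Sum>w\<in>paths n (Suc k). (if i \<in> set (tl w) then Psi n \<xi> v (i # w) W * x (last w) else 0) +
         (if hd (tl w) = i then v * wprod ?H (tl w) * x (last w) else 0))"
  proof (rule sum.cong)
    fix w assume "w \<in> paths n (Suc k)"
    note w = pathsD[OF this]
    have "i \<in> set (tl w)" if "hd (tl w) = i" using w that by (cases w; cases "tl w") auto
    thus "(if i \<in> set (tl w) then wprod ?H (i # w) * x (last w) else 0) =
      (if i \<in> set (tl w) then Psi n \<xi> v (i # w) W * x (last w) else 0) +
         (if hd (tl w) = i then v * wprod ?H (tl w) * x (last w) else 0)"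
      using w wprod_lasso[of w n i \<xi> W v] by (auto simp: distrib_right)
  qed simp
  also have "\<dots> = kry_rem n \<xi> v W x (Suc k) i +
      (\<Sum>w\<in>paths n (Suc k). if hd (tl w) = i then v * wprod ?H (tl w) * x (last w) else 0)"
    by (simp add: kry_rem_def sum.distrib)
  also have "(\<Sum>w\<in>paths n (Suc k). if hd (tl w) = i then v * wprod ?H (tl w) * x (last w) else 0) =
      v * real (n - Suc k) * kry n ?H x k i"
    unfolding sum_paths_Suc kry_def sum_distrib_left
  proof (rule sum.cong)
    fix w assume "w \<in> paths n k"
    note w = pathsD[OF this]
    have "card ({..<n} - set w) = n - Suc k" using w by (subst card_Diff_subset) (auto simp: distinct_card)
    thus "(\<Sum>j\<in>{..<n} - set w. if hd (tl (j # w)) = i then v * wprod ?H (tl (j # w)) * x (last (j # w)) else 0) =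
       v * real (n - Suc k) * (if hd w = i then wprod ?H w * x (last w) else 0)"
      using w by simp
  qed simp
  finally show ?thesis using i by (subst mv_kry) (auto simp: entry_def)
qed

lemma ip_kry: "ip n x (kry n H x k) = (\<Sum>w\<in>paths n k. x (hd w) * x (last w) * wprod H w)"
proof -
  have "ip n x (kry n H x k) = (\<Sum>w\<in>paths n k. \<Sum>i<n. x i * (if hd w = i then wprod H w * x (last w) else 0))"
    unfolding ip_def kry_def sum_distrib_left by (rule sum.swap)
  also have "\<dots> = (\<Sum>w\<in>paths n k. x (hd w) * x (last w) * wprod H w)"
  proof (rule sum.cong)
    fix w assume "w \<in> paths n k"
    note w = pathsD[OF this]
    have "(\<Sum>i<n. x i * (if hd w = i then wprod H w * x (last w) else 0)) =
      (\<Sum>i<n. if i = hd w then x i * (wprod H w * x (last w)) else 0)" by (intro sum.cong) auto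
    thus "(\<Sum>i<n. x i * (if hd w = i then wprod H w * x (last w) else 0)) = x (hd w) * x (last w) * wprod H w"
      using w by simp
  qed simp
  finally show ?thesis .
qed

lemma sum_paths_last: "(\<Sum>w\<in>paths n k. (x (last w))\<^sup>2) \<le> real n ^ k * ip n x x"
proof (induction k)
  case (Suc k)
  have "(\<Sum>w\<in>paths n (Suc k). (x (last w))\<^sup>2) \<le> (\<Sum>w\<in>paths n k. \<Sum>j<n. (x (last w))\<^sup>2)"
    unfolding sum_paths_Suc
  proof (rule sum_mono)
    fix w assume "w \<in> paths n k"
    note w = pathsD[OF this]
    have "(\<Sum>j\<in>{..<n} - set w. (x (last (j # w)))\<^sup>2) = (\<Sum>j\<in>{..<n} - set w. (x (last w))\<^sup>2)"
      using w by (intro sum.cong) auto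
    also have "\<dots> \<le> (\<Sum>j<n. (x (last w))\<^sup>2)" by (intro sum_mono2) auto
    finally show "(\<Sum>j\<in>{..<n} - set w. (x (last (j # w)))\<^sup>2) \<le> (\<Sum>j<n. (x (last w))\<^sup>2)" .
  qed
  also have "\<dots> = real n * (\<Sum>w\<in>paths n k. (x (last w))\<^sup>2)" by (simp add: sum_distrib_left)
  also have "\<dots> \<le> real n * (real n ^ k * ip n x x)" using Suc by (intro mult_left_mono) auto
  finally show ?case by (simp add: mult_ac)
qed (simp add: sum_paths_0 ip_def power2_eq_square)

text \<open>Both ends carry a weight \<open>x\<close>, so of the \<open>k + 2\<close> vertices only
  \<open>k\<close> are summed freely. The missing power of \<open>n\<close> is what makes the inner
  product of \<open>x\<close> with \<open>kry\<close> vanish.\<close>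

lemma sum_paths_hd_last: "(\<Sum>w\<in>paths n (Suc k). (x (hd w) * x (last w))\<^sup>2) \<le> real n ^ k * (ip n x x)\<^sup>2"
proof -
  have "(\<Sum>w\<in>paths n (Suc k). (x (hd w) * x (last w))\<^sup>2) \<le> (\<Sum>w\<in>paths n k. ip n x x * (x (last w))\<^sup>2)"
    unfolding sum_paths_Suc
  proof (rule sum_mono)
    fix w assume "w \<in> paths n k"
    note w = pathsD[OF this]
    have "(\<Sum>j\<in>{..<n} - set w. (x (hd (j # w)) * x (last (j # w)))\<^sup>2) = (\<Sum>j\<in>{..<n} - set w. x j * x j * (x (last w))\<^sup>2)"
      using w by (intro sum.cong) (auto simp: power2_eq_square)
    also have "\<dots> \<le> (\<Sum>j<n. x j * x j * (x (last w))\<^sup>2)" by (intro sum_mono2) auto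
    finally show "(\<Sum>j\<in>{..<n} - set w. (x (hd (j # w)) * x (last (j # w)))\<^sup>2) \<le> ip n x x * (x (last w))\<^sup>2"
      by (simp add: ip_def sum_distrib_right)
  qed
  also have "\<dots> \<le> ip n x x * (real n ^ k * ip n x x)"
    unfolding sum_distrib_left[symmetric] by (intro mult_left_mono sum_paths_last ip_self_nonneg)
  finally show ?thesis by (simp add: power2_eq_square mult_ac)
qed

context centred_entry
begin

lemma expected_ip_kry:
  shows "integrable (noise n P) (\<lambda>W. (ip n x (kry n (entry \<xi> W) x (Suc k)))\<^sup>2)"
    and "(LINT W|(noise n P). (ip n x (kry n (entry \<xi> W) x (Suc k)))\<^sup>2) \<le>
      (q ^ Suc k)\<^sup>2 * real (Suc (Suc k)) ^ Suc (Suc k) * (real n ^ k * (ip n x x)\<^sup>2)"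
proof -
  have eq: "ip n x (kry n (entry \<xi> W) x (Suc k)) =
    (\<Sum>w\<in>paths n (Suc k). x (hd w) * x (last w) * Psi n \<xi> v w W)" for W
    unfolding ip_kry
    by (intro sum.cong refl arg_cong2[where f = "(*)"] wprod_eq_Psi)
       (auto dest!: pathsD simp: distinct_imp_distinct_adj' intro: order.trans[OF distinct_cnt_le_1])
  note sm = second_moment[where S = "paths n (Suc k)" and n = n and L = "Suc (Suc k)" and R = "q ^ Suc k"
      and c = "\<lambda>w. x (hd w) * x (last w)"]
  have 1: "distinct_adj w \<and> set w \<subseteq> {..<n} \<and> length w = Suc (Suc k)" "wt (psi_wt q B) w \<le> q ^ Suc k"
    if "w \<in> paths n (Suc k)" for w
    using pathsD[OF that] by (auto simp: distinct_imp_distinct_adj' wt_psi_distinct)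
  show "integrable (noise n P) (\<lambda>W. (ip n x (kry n (entry \<xi> W) x (Suc k)))\<^sup>2)"
    unfolding eq by (rule sm(1)) (use 1 in auto)
  have "(LINT W|(noise n P). (ip n x (kry n (entry \<xi> W) x (Suc k)))\<^sup>2) \<le>
      (q ^ Suc k)\<^sup>2 * real (Suc (Suc k)) ^ Suc (Suc k) * (\<Sum>w\<in>paths n (Suc k). (x (hd w) * x (last w))\<^sup>2)"
    unfolding eq by (rule sm(2)) (use 1 in auto)
  also have "\<dots> \<le> (q ^ Suc k)\<^sup>2 * real (Suc (Suc k)) ^ Suc (Suc k) * (real n ^ k * (ip n x x)\<^sup>2)"
    by (intro mult_left_mono sum_paths_hd_last) auto
  finally show "(LINT W|(noise n P). (ip n x (kry n (entry \<xi> W) x (Suc k)))\<^sup>2) \<le>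
      (q ^ Suc k)\<^sup>2 * real (Suc (Suc k)) ^ Suc (Suc k) * (real n ^ k * (ip n x x)\<^sup>2)" .
qed

text \<open>A lasso over a path with \<open>k\<close> edges takes one further step, of weight
  \<open>q\<close> along a new edge and \<open>B\<close> along the edge just crossed; hence the
  factor \<open>q + B\<close>. The closing vertex \<open>i\<close> has only \<open>k\<close>
  possible positions, so it costs no power of \<open>n\<close>.\<close>

lemma expected_kry_rem:
  shows "integrable (noise n P) (\<lambda>W. ip n (kry_rem n \<xi> v W x k) (kry_rem n \<xi> v W x k))"
    and "(LINT W|(noise n P). ip n (kry_rem n \<xi> v W x k) (kry_rem n \<xi> v W x k)) \<le>
      (q ^ k * (q + B))\<^sup>2 * real (k + 2) ^ (k + 2) * (real k * (real n ^ k * ip n x x))"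
proof -
  define S where "S i = (#) i ` {w \<in> paths n k. i \<in> set (tl w)}" for i
  have fin: "finite (S i)" for i by (simp add: S_def)
  have sumS: "(\<Sum>w\<in>S i. f w) = (\<Sum>w\<in>paths n k. if i \<in> set (tl w) then f (i # w) else 0)" for i and f :: "nat list \<Rightarrow> real"
    unfolding S_def by (subst sum.reindex) (auto simp: sum.If_cases Int_def)
  have eq: "kry_rem n \<xi> v W x k i = (\<Sum>w\<in>S i. x (last w) * Psi n \<xi> v w W)" for W i
    unfolding sumS kry_rem_def by (intro sum.cong refl) (auto dest!: pathsD)
  have 1: "distinct_adj w \<and> set w \<subseteq> {..<n} \<and> length w = k + 2" "wt (psi_wt q B) w \<le> q ^ k * (q + B)"
    if i: "i < n" and w: "w \<in> S i" for w i
  proof -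
    obtain w' where w': "w = i # w'" "w' \<in> paths n k" "i \<in> set (tl w')" using w by (auto simp: S_def)
    note p = pathsD[OF w'(2)]
    have ne: "i \<noteq> hd w'" using p w'(3) by (cases w') auto
    show "distinct_adj w \<and> set w \<subseteq> {..<n} \<and> length w = k + 2"
      using p w' i ne by (cases w') (auto simp: distinct_imp_distinct_adj')
    have "psi_wt q B (cnt w' (edge i (hd w'))) \<le> q + B"
      using p w'(3) nonneg by (auto simp: cnt_distinct_edge)
    hence "psi_wt q B (cnt w' (edge i (hd w'))) * q ^ k \<le> (q + B) * q ^ k"
      using nonneg by (intro mult_right_mono) auto
    thus "wt (psi_wt q B) w \<le> q ^ k * (q + B)"
      using p w' ne by (simp add: wt_Cons wt_psi_distinct mult.commute)
  qed
  have ipe: "ip n (kry_rem n \<xi> v W x k) (kry_rem n \<xi> v W x k) = (\<Sum>i<n. (\<Sum>w\<in>S i. x (last w) * Psi n \<xi> v w W)\<^sup>2)" for W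
    by (simp add: ip_def eq power2_eq_square)
  have I: "integrable (noise n P) (\<lambda>W. (\<Sum>w\<in>S i. x (last w) * Psi n \<xi> v w W)\<^sup>2)" if "i < n" for i
    by (rule second_moment(1)[where L = "k + 2", OF fin 1(1)[OF that] _ 1(2)[OF that]]) simp_all
  have E: "(LINT W|(noise n P). (\<Sum>w\<in>S i. x (last w) * Psi n \<xi> v w W)\<^sup>2) \<le>
      (q ^ k * (q + B))\<^sup>2 * real (k + 2) ^ (k + 2) * (\<Sum>w\<in>S i. (x (last w))\<^sup>2)" if "i < n" for i
    by (rule second_moment(2)[where L = "k + 2", OF fin 1(1)[OF that] _ 1(2)[OF that]]) simp_all
  show "integrable (noise n P) (\<lambda>W. ip n (kry_rem n \<xi> v W x k) (kry_rem n \<xi> v W x k))"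
    unfolding ipe using I by (intro Bochner_Integration.integrable_sum) auto
  have "(LINT W|(noise n P). ip n (kry_rem n \<xi> v W x k) (kry_rem n \<xi> v W x k)) =
      (\<Sum>i<n. LINT W|(noise n P). (\<Sum>w\<in>S i. x (last w) * Psi n \<xi> v w W)\<^sup>2)"
    unfolding ipe using I by (intro Bochner_Integration.integral_sum) auto
  also have "\<dots> \<le> (\<Sum>i<n. (q ^ k * (q + B))\<^sup>2 * real (k + 2) ^ (k + 2) * (\<Sum>w\<in>S i. (x (last w))\<^sup>2))"
    using E by (intro sum_mono) auto
  also have "\<dots> = (q ^ k * (q + B))\<^sup>2 * real (k + 2) ^ (k + 2) *
      (\<Sum>i<n. \<Sum>w\<in>paths n k. if i \<in> set (tl w) then (x (last w))\<^sup>2 else 0)"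
    unfolding sum_distrib_left[symmetric] sumS
    by (intro arg_cong2[where f = "(*)"] sum.cong refl) (auto dest!: pathsD)
  also have "(\<Sum>i<n. \<Sum>w\<in>paths n k. if i \<in> set (tl w) then (x (last w))\<^sup>2 else 0) =
      (\<Sum>w\<in>paths n k. \<Sum>i<n. if i \<in> set (tl w) then (x (last w))\<^sup>2 else 0)" by (rule sum.swap)
  also have "\<dots> = (\<Sum>w\<in>paths n k. real k * (x (last w))\<^sup>2)"
  proof (rule sum.cong)
    fix w assume "w \<in> paths n k"
    note w = pathsD[OF this]
    have "{..<n} \<inter> set (tl w) = set (tl w)" using w by (cases w) auto
    moreover have "card (set (tl w)) = k" using w by (cases w) (auto simp: distinct_card)
    ultimately show "(\<Sum>i<n. if i \<in> set (tl w) then (x (last w))\<^sup>2 else 0) = real k * (x (last w))\<^sup>2"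
      by (simp add: sum.If_cases)
  qed simp
  also have "(q ^ k * (q + B))\<^sup>2 * real (k + 2) ^ (k + 2) * \<dots> \<le>
      (q ^ k * (q + B))\<^sup>2 * real (k + 2) ^ (k + 2) * (real k * (real n ^ k * ip n x x))"
    unfolding sum_distrib_left[symmetric] by (intro mult_left_mono sum_paths_last) auto
  finally show "(LINT W|(noise n P). ip n (kry_rem n \<xi> v W x k) (kry_rem n \<xi> v W x k)) \<le>
      (q ^ k * (q + B))\<^sup>2 * real (k + 2) ^ (k + 2) * (real k * (real n ^ k * ip n x x))" .
qed

end

section \<open>Rank-one perturbations through Krylov vectors\<close>

text \<open>Stated over an arbitrary filter, so that convergence in probability becomes ordinary
  convergence. All that is kept of the random matrix is its symmetry, the norm bound, the
  approximate recursion and the inner products with \<open>y 0\<close>; \<open>rem\<close> and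
  \<open>prev\<close> are names fixed by their equations.\<close>

locale krylov_limit =
  fixes G :: "'b filter" and N :: "'b \<Rightarrow> nat" and H :: "'b \<Rightarrow> nat \<Rightarrow> nat \<Rightarrow> real"
    and y :: "nat \<Rightarrow> 'b \<Rightarrow> nat \<Rightarrow> real" and s F :: real and rem prev :: "nat \<Rightarrow> 'b \<Rightarrow> nat \<Rightarrow> real"
  assumes prev_def: "prev = (\<lambda>k b i. if k = 0 then 0 else y (k - 1) b i)"
    and rem_def: "rem = (\<lambda>k b i. mv (N b) (H b) (y k b) i - y (Suc k) b i - F * prev k b i)"
    and sym: "\<And>b i j. H b i j = H b j i" and s: "s > 0" and F: "F = s\<^sup>2"
    and op: "\<And>\<epsilon>. \<epsilon> > 0 \<Longrightarrow> eventually (\<lambda>b. op_le (N b) (H b) (2 * s + \<epsilon>)) G"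
    and rem0: "\<And>k. ((\<lambda>b. nrm (N b) (rem k b)) \<longlongrightarrow> 0) G"
    and ip00: "((\<lambda>b. ip (N b) (y 0 b) (y 0 b)) \<longlongrightarrow> 1) G"
    and ip0: "\<And>k. ((\<lambda>b. ip (N b) (y 0 b) (y (Suc k) b)) \<longlongrightarrow> 0) G"
begin

lemma mv_y: "mv (N b) (H b) (y k b) = (\<lambda>i. y (Suc k) b i + F * prev k b i + rem k b i)"
  by (simp add: rem_def fun_eq_iff)

lemma nrm_y_bounded: "\<exists>C. C \<ge> 0 \<and> eventually (\<lambda>b. nrm (N b) (y k b) \<le> C \<and> nrm (N b) (prev k b) \<le> C) G"
proof (induction k)
  case 0
  have "eventually (\<lambda>b. ip (N b) (y 0 b) (y 0 b) < 4) G" using ip00 by (rule order_tendstoD) simp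
  hence "eventually (\<lambda>b. nrm (N b) (y 0 b) \<le> 2 \<and> nrm (N b) (prev 0 b) \<le> 2) G"
  proof eventually_elim
    case (elim b)
    hence "(nrm (N b) (y 0 b))\<^sup>2 \<le> 2\<^sup>2" by (simp add: ip_self)
    hence "nrm (N b) (y 0 b) \<le> 2" by (rule power2_le_imp_le) simp
    moreover have "nrm (N b) (prev 0 b) = 0" by (simp add: prev_def L2_set_def)
    ultimately show ?case by simp
  qed
  thus ?case by (intro exI[of _ 2]) simp
next
  case (Suc k)
  then obtain C where C: "C \<ge> 0" "eventually (\<lambda>b. nrm (N b) (y k b) \<le> C \<and> nrm (N b) (prev k b) \<le> C) G" by blast
  have r: "eventually (\<lambda>b. nrm (N b) (rem k b) < 1) G" using rem0[of k] by (rule order_tendstoD) simp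
  have o: "eventually (\<lambda>b. op_le (N b) (H b) (2 * s + 1)) G" by (rule op) simp
  let ?C = "(2 * s + 1) * C + F * C + 1 + C"
  have "eventually (\<lambda>b. nrm (N b) (y (Suc k) b) \<le> ?C \<and> nrm (N b) (prev (Suc k) b) \<le> ?C) G"
    using C(2) r o
  proof eventually_elim
    case (elim b)
    have "nrm (N b) (y (Suc k) b) = nrm (N b) (\<lambda>i. (mv (N b) (H b) (y k b) i - F * prev k b i) - rem k b i)"
      by (simp add: mv_y)
    also have "\<dots> \<le> nrm (N b) (\<lambda>i. mv (N b) (H b) (y k b) i - F * prev k b i) + nrm (N b) (rem k b)"
      by (rule nrm_diff_le)
    also have "nrm (N b) (\<lambda>i. mv (N b) (H b) (y k b) i - F * prev k b i) \<le>
       nrm (N b) (mv (N b) (H b) (y k b)) + nrm (N b) (\<lambda>i. F * prev k b i)" by (rule nrm_diff_le)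
    also have "nrm (N b) (mv (N b) (H b) (y k b)) \<le> (2 * s + 1) * nrm (N b) (y k b)"
      using elim by (intro op_leD) simp
    also have "\<dots> \<le> (2 * s + 1) * C" using elim s by (intro mult_left_mono) auto
    also have "nrm (N b) (\<lambda>i. F * prev k b i) = F * nrm (N b) (prev k b)" by (simp add: nrm_scale F)
    also have "\<dots> \<le> F * C" using elim by (intro mult_left_mono) (auto simp: F)
    finally have "nrm (N b) (y (Suc k) b) \<le> (2 * s + 1) * C + F * C + 1" using elim by linarith
    moreover have "prev (Suc k) b = y k b" by (simp add: prev_def)
    moreover have "0 \<le> (2 * s + 1) * C" "0 \<le> F * C" using s C F by auto
    ultimately show ?case using elim C by simp
  qed
  moreover have "?C \<ge> 0" using s C F by auto
  ultimately show ?case by blast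
qed

lemma ip_small:
  assumes "eventually (\<lambda>b. nrm (N b) (u b) \<le> C) G" "((\<lambda>b. nrm (N b) (r b)) \<longlongrightarrow> 0) G"
  shows "((\<lambda>b. ip (N b) (u b) (r b)) \<longlongrightarrow> 0) G"
proof (rule tendsto_0_le[OF assms(2), of _ "\<bar>C\<bar>"])
  show "eventually (\<lambda>b. norm (ip (N b) (u b) (r b)) \<le> norm (nrm (N b) (r b)) * \<bar>C\<bar>) G"
    using assms(1)
  proof eventually_elim
    case (elim b)
    have "\<bar>ip (N b) (u b) (r b)\<bar> \<le> nrm (N b) (u b) * nrm (N b) (r b)" by (rule ip_Cauchy_Schwarz)
    also have "\<dots> \<le> \<bar>C\<bar> * nrm (N b) (r b)" using elim by (intro mult_right_mono L2_set_nonneg) linarith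
    finally show ?case by (simp add: L2_set_nonneg mult.commute)
  qed
qed

text \<open>Symmetry of \<open>H\<close> moves one application from \<open>y l\<close> to
  \<open>y k\<close>, and the recursion on both sides expresses the inner product with
  \<open>y (Suc l)\<close> through those with \<open>y l\<close> and \<open>prev l\<close>. The
  limit is the orthogonality of the Chebyshev polynomials under the semicircle law of variance
  \<open>F\<close>.\<close>

lemma ip_y_limit:
  "((\<lambda>b. ip (N b) (y k b) (y l b)) \<longlongrightarrow> (if k = l then F ^ k else 0)) G \<and>
   ((\<lambda>b. ip (N b) (y k b) (prev l b)) \<longlongrightarrow> (if Suc k = l then F ^ k else 0)) G"
proof (induction l arbitrary: k)
  case 0
  have "((\<lambda>b. ip (N b) (y k b) (y 0 b)) \<longlongrightarrow> (if k = 0 then F ^ k else 0)) G"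
  proof -
    have "(\<lambda>b. ip (N b) (y k b) (y 0 b)) = (\<lambda>b. ip (N b) (y 0 b) (y k b))" by (rule ext) (rule ip_commute)
    thus ?thesis using ip00 ip0[of "k - 1"] by (cases k) simp_all
  qed
  moreover have "ip (N b) (y k b) (prev 0 b) = 0" for b by (simp add: prev_def ip_def)
  ultimately show ?case by simp
next
  case (Suc l)
  obtain C where C: "eventually (\<lambda>b. nrm (N b) (y k b) \<le> C) G"
    using nrm_y_bounded[of k] by (auto simp: eventually_conj_iff)
  obtain D where D: "eventually (\<lambda>b. nrm (N b) (y l b) \<le> D) G"
    using nrm_y_bounded[of l] by (auto simp: eventually_conj_iff)
  have eq: "ip (N b) (y k b) (y (Suc l) b) = ip (N b) (y (Suc k) b) (y l b) + F * ip (N b) (y l b) (prev k b)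
     + ip (N b) (y l b) (rem k b) - F * ip (N b) (y k b) (prev l b) - ip (N b) (y k b) (rem l b)" for b
  proof -
    have "ip (N b) (y k b) (mv (N b) (H b) (y l b)) = ip (N b) (mv (N b) (H b) (y k b)) (y l b)"
      by (rule ip_mv_symmetric) (rule sym)
    thus ?thesis unfolding mv_y ip_linear ip_commute[of _ _ "y l b"] by linarith
  qed
  have pk: "((\<lambda>b. ip (N b) (y l b) (prev k b)) \<longlongrightarrow> (if Suc l = k then F ^ l else 0)) G"
  proof (cases k)
    case 0
    then show ?thesis by (simp add: prev_def ip_def)
  next
    case (Suc k')
    have "((\<lambda>b. ip (N b) (y k' b) (y l b)) \<longlongrightarrow> (if k' = l then F ^ k' else 0)) G" using Suc.IH[of k'] by blast
    moreover have "(\<lambda>b. ip (N b) (y l b) (prev k b)) = (\<lambda>b. ip (N b) (y k' b) (y l b))"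
      by (rule ext) (simp add: Suc prev_def, rule ip_commute)
    moreover have "(Suc l = k) = (k' = l)" using Suc by auto
    ultimately show ?thesis by auto
  qed
  have "((\<lambda>b. ip (N b) (y k b) (y (Suc l) b)) \<longlongrightarrow> (if Suc k = l then F ^ Suc k else 0) + F * (if Suc l = k then F ^ l else 0)
     + 0 - F * (if Suc k = l then F ^ k else 0) - 0) G"
    unfolding eq using Suc.IH[of k] Suc.IH[of "Suc k"] pk ip_small[OF C rem0[of l]] ip_small[OF D rem0[of k]]
    by (intro tendsto_intros) blast+
  hence "((\<lambda>b. ip (N b) (y k b) (y (Suc l) b)) \<longlongrightarrow> (if k = Suc l then F ^ k else 0)) G"
    by (auto split: if_splits)
  moreover have "((\<lambda>b. ip (N b) (y k b) (prev (Suc l) b)) \<longlongrightarrow> (if Suc k = Suc l then F ^ k else 0)) G"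
    using Suc.IH[of k] by (simp add: prev_def)
  ultimately show ?case by blast
qed

section \<open>An approximate solution of the resolvent equation\<close>

definition wvec :: "real \<Rightarrow> nat \<Rightarrow> 'b \<Rightarrow> nat \<Rightarrow> real" where
  "wvec g K b i = (\<Sum>k\<le>K. g ^ Suc k * y k b i)"

definition rvec :: "real \<Rightarrow> nat \<Rightarrow> 'b \<Rightarrow> nat \<Rightarrow> real" where
  "rvec g K b i = F * g ^ (K + 2) * y K b i - g ^ Suc K * y (Suc K) b i - (\<Sum>k\<le>K. g ^ Suc k * rem k b i)"

text \<open>With \<open>g = 1 / \<theta>\<close> and \<open>z = \<theta> + F / \<theta>\<close>, the vector \<open>wvec\<close> solves \<open>(z - H) w = x\<close> up to
  the truncation error \<open>rvec\<close>.\<close>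

lemma mv_wvec_expand:
  "mv (N b) (H b) (wvec g K b) i = (\<Sum>k\<le>K. g ^ Suc k * (y (Suc k) b i + F * prev k b i + rem k b i))"
  unfolding wvec_def[abs_def] mv_sum mv_scale mv_y ..

lemma mv_wvec:
  assumes z: "z * g = 1 + F * g\<^sup>2"
  shows "z * wvec g K b i - mv (N b) (H b) (wvec g K b) i = y 0 b i + rvec g K b i"
proof (induction K)
  case 0
  have "z * (g * y 0 b i) = (z * g) * y 0 b i" by simp
  also have "\<dots> = y 0 b i + F * g\<^sup>2 * y 0 b i" unfolding z by (simp add: algebra_simps)
  finally show ?case
    unfolding mv_wvec_expand by (simp add: wvec_def rvec_def prev_def algebra_simps power2_eq_square)
next
  case (Suc K)
  have prevS: "prev (Suc K) b i = y K b i" by (simp add: prev_def)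
  have "z * wvec g (Suc K) b i - mv (N b) (H b) (wvec g (Suc K) b) i =
      (z * wvec g K b i - mv (N b) (H b) (wvec g K b) i) + z * (g ^ Suc (Suc K) * y (Suc K) b i)
       - g ^ Suc (Suc K) * (y (Suc (Suc K)) b i + F * y K b i + rem (Suc K) b i)"
    unfolding mv_wvec_expand sum.atMost_Suc prevS wvec_def by (simp only: distrib_left)
  also have "z * (g ^ Suc (Suc K) * y (Suc K) b i) = g ^ Suc K * (z * g) * y (Suc K) b i" by simp
  also have "\<dots> = g ^ Suc K * y (Suc K) b i + F * g ^ (Suc K + 2) * y (Suc K) b i"
    unfolding z by (simp add: algebra_simps power2_eq_square)
  finally show ?case
    unfolding Suc rvec_def sum.atMost_Suc by (simp add: algebra_simps)
qed

lemma ip_x_wvec: "((\<lambda>b. ip (N b) (y 0 b) (wvec g K b)) \<longlongrightarrow> g) G"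
proof -
  have "((\<lambda>b. \<Sum>k\<le>K. g ^ Suc k * ip (N b) (y 0 b) (y k b)) \<longlongrightarrow> (\<Sum>k\<le>K. g ^ Suc k * (if 0 = k then F ^ 0 else 0))) G"
    by (intro tendsto_intros conjunct1[OF ip_y_limit])
  also have "(\<Sum>k\<le>K. g ^ Suc k * (if 0 = k then F ^ 0 else 0)) = (\<Sum>k\<le>K. if k = 0 then g else 0)"
    by (intro sum.cong) auto
  also have "\<dots> = g" by simp
  finally show ?thesis unfolding wvec_def[abs_def] ip_sum_right ip_scale_right .
qed

lemma ip_wvec_wvec: "((\<lambda>b. ip (N b) (wvec g K b) (wvec g K b)) \<longlongrightarrow> (\<Sum>k\<le>K. (g ^ Suc k)\<^sup>2 * F ^ k)) G"
proof -
  have "((\<lambda>b. \<Sum>k\<le>K. \<Sum>l\<le>K. g ^ Suc l * (g ^ Suc k * ip (N b) (y k b) (y l b))) \<longlongrightarrow>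
      (\<Sum>k\<le>K. \<Sum>l\<le>K. g ^ Suc l * (g ^ Suc k * (if k = l then F ^ k else 0)))) G"
    by (intro tendsto_intros conjunct1[OF ip_y_limit])
  also have "(\<Sum>k\<le>K. \<Sum>l\<le>K. g ^ Suc l * (g ^ Suc k * (if k = l then F ^ k else 0))) =
      (\<Sum>k\<le>K. \<Sum>l\<le>K. if l = k then (g ^ Suc k)\<^sup>2 * F ^ k else 0)"
    by (intro sum.cong refl) (auto simp: power2_eq_square)
  also have "\<dots> = (\<Sum>k\<le>K. (g ^ Suc k)\<^sup>2 * F ^ k)" by (intro sum.cong refl) simp
  finally show ?thesis
    unfolding wvec_def[abs_def] ip_sum_left ip_sum_right ip_scale_right ip_scale_left .
qed

lemma nrm_sum_le: "nrm n (\<lambda>i. \<Sum>k\<in>S. u k i) \<le> (\<Sum>k\<in>S. nrm n (u k))"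
proof (induction S rule: infinite_finite_induct)
  case (insert a S)
  have "nrm n (\<lambda>i. \<Sum>k\<in>insert a S. u k i) = nrm n (\<lambda>i. u a i + (\<Sum>k\<in>S. u k i))" using insert by simp
  also have "\<dots> \<le> nrm n (u a) + nrm n (\<lambda>i. \<Sum>k\<in>S. u k i)" by (rule L2_set_triangle_ineq)
  finally show ?case using insert by simp
qed (simp_all add: L2_set_def)

text \<open>The limiting squared norm of the two boundary terms is geometric in \<open>K\<close>
  with ratio \<open>(g * s)^2 < 1\<close>. So \<open>K\<close> is fixed first to make it small, and
  only then does the limit along \<open>G\<close> remove the finitely many \<open>rem\<close>
  terms.\<close>

lemma rvec_small:
  assumes g: "g > 0" "g * s < 1" and e: "\<epsilon> > 0"
  shows "\<exists>K0. \<forall>K\<ge>K0. eventually (\<lambda>b. nrm (N b) (rvec g K b) \<le> \<epsilon>) G"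
proof -
  define q where "q = (g * s)\<^sup>2"
  have q: "0 \<le> q" "q < 1" using g s by (auto simp: q_def power_less_one_iff abs_square_less_1)
  \<comment> \<open>By orthogonality of \<open>y K\<close> and \<open>y (Suc K)\<close> the limiting
    square is \<open>(F * g^(K+2))^2 * F^K + (g^(K+1))^2 * F^(K+1)\<close>, which equals
    \<open>A * g^2 * q^K\<close>.\<close>
  define A where "A = (F * g)\<^sup>2 + F"
  have A: "A \<ge> 0" by (simp add: A_def F)
  have "(\<lambda>K. A * g\<^sup>2 * q ^ K) \<longlonglongrightarrow> A * g\<^sup>2 * 0" using q by (intro tendsto_intros LIMSEQ_realpow_zero)
  hence "eventually (\<lambda>K. A * g\<^sup>2 * q ^ K < (\<epsilon> / 2)\<^sup>2) sequentially"
    using e by (intro order_tendstoD) auto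
  then obtain K0 where K0: "\<And>K. K \<ge> K0 \<Longrightarrow> A * g\<^sup>2 * q ^ K < (\<epsilon> / 2)\<^sup>2"
    unfolding eventually_sequentially by blast
  show ?thesis
  proof (intro exI allI impI)
    fix K assume K: "K \<ge> K0"
    define \<alpha> \<beta> where "\<alpha> = F * g ^ (K + 2)" and "\<beta> = g ^ Suc K"
    define u where "u b i = \<alpha> * y K b i - \<beta> * y (Suc K) b i" for b i
    have lim: "((\<lambda>b. \<alpha>\<^sup>2 * ip (N b) (y K b) (y K b) - 2 * (\<alpha> * \<beta>) * ip (N b) (y K b) (y (Suc K) b)
        + \<beta>\<^sup>2 * ip (N b) (y (Suc K) b) (y (Suc K) b)) \<longlongrightarrow>
        \<alpha>\<^sup>2 * (if K = K then F ^ K else 0) - 2 * (\<alpha> * \<beta>) * (if K = Suc K then F ^ K else 0)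
        + \<beta>\<^sup>2 * (if Suc K = Suc K then F ^ Suc K else 0)) G"
      by (intro tendsto_intros conjunct1[OF ip_y_limit])
    have ipu: "ip (N b) (u b) (u b) = \<alpha>\<^sup>2 * ip (N b) (y K b) (y K b) - 2 * (\<alpha> * \<beta>) * ip (N b) (y K b) (y (Suc K) b)
        + \<beta>\<^sup>2 * ip (N b) (y (Suc K) b) (y (Suc K) b)" for b
      unfolding u_def ip_linear ip_commute[of _ "y (Suc K) b" "y K b"] power2_eq_square
      by (simp add: algebra_simps)
    have l: "\<alpha>\<^sup>2 * (if K = K then F ^ K else 0) - 2 * (\<alpha> * \<beta>) * (if K = Suc K then F ^ K else 0)
        + \<beta>\<^sup>2 * (if Suc K = Suc K then F ^ Suc K else 0) = A * g\<^sup>2 * q ^ K"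
    proof -
      have "q ^ K = (g ^ K)\<^sup>2 * F ^ K" by (simp add: q_def F power2_eq_square power_mult_distrib)
      moreover have "\<alpha> = F * g\<^sup>2 * g ^ K" "\<beta> = g * g ^ K" by (simp_all add: \<alpha>_def \<beta>_def power2_eq_square)
      ultimately show ?thesis by (simp add: A_def power_mult_distrib power2_eq_square distrib_left distrib_right mult_ac)
    qed
    have "((\<lambda>b. ip (N b) (u b) (u b)) \<longlongrightarrow> A * g\<^sup>2 * q ^ K) G" using lim unfolding ipu l .
    hence ev1: "eventually (\<lambda>b. ip (N b) (u b) (u b) < (\<epsilon> / 2)\<^sup>2) G" using K0[OF K] by (rule order_tendstoD)
    have "((\<lambda>b. \<Sum>k\<le>K. g ^ Suc k * nrm (N b) (rem k b)) \<longlongrightarrow> (\<Sum>k\<le>K. g ^ Suc k * 0)) G"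
      by (intro tendsto_intros rem0)
    hence ev2: "eventually (\<lambda>b. (\<Sum>k\<le>K. g ^ Suc k * nrm (N b) (rem k b)) < \<epsilon> / 2) G"
      using e by (intro order_tendstoD) auto
    show "eventually (\<lambda>b. nrm (N b) (rvec g K b) \<le> \<epsilon>) G"
      using ev1 ev2
    proof eventually_elim
      case (elim b)
      have "(nrm (N b) (u b))\<^sup>2 \<le> (\<epsilon> / 2)\<^sup>2" using elim(1) unfolding ip_self by (rule less_imp_le)
      hence u: "nrm (N b) (u b) \<le> \<epsilon> / 2" by (rule power2_le_imp_le) (use e in simp)
      have "nrm (N b) (rvec g K b) = nrm (N b) (\<lambda>i. u b i - (\<Sum>k\<le>K. g ^ Suc k * rem k b i))"
        by (simp only: rvec_def[abs_def] u_def \<alpha>_def \<beta>_def)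
      also have "\<dots> \<le> nrm (N b) (u b) + nrm (N b) (\<lambda>i. \<Sum>k\<le>K. g ^ Suc k * rem k b i)" by (rule nrm_diff_le)
      also have "nrm (N b) (\<lambda>i. \<Sum>k\<le>K. g ^ Suc k * rem k b i) \<le> (\<Sum>k\<le>K. nrm (N b) (\<lambda>i. g ^ Suc k * rem k b i))"
        by (rule nrm_sum_le)
      also have "\<dots> = (\<Sum>k\<le>K. g ^ Suc k * nrm (N b) (rem k b))"
        unfolding nrm_scale using g(1) by (intro sum.cong refl) simp
      finally show ?case using u elim(2) by linarith
    qed
  qed
qed

lemma sum_geometric:
  assumes "g \<noteq> 0" "g\<^sup>2 * F \<noteq> 1"
  shows "(\<Sum>k\<le>K. (g ^ Suc k)\<^sup>2 * F ^ k) = g\<^sup>2 * (1 - (g\<^sup>2 * F) ^ Suc K) / (1 - g\<^sup>2 * F)"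
proof -
  have "(\<Sum>k\<le>K. (g ^ Suc k)\<^sup>2 * F ^ k) = g\<^sup>2 * (\<Sum>k\<le>K. (g\<^sup>2 * F) ^ k)"
    unfolding sum_distrib_left by (intro sum.cong refl) (simp add: power2_eq_square power_mult_distrib)
  also have "(\<Sum>k\<le>K. (g\<^sup>2 * F) ^ k) = (1 - (g\<^sup>2 * F) ^ Suc K) / (1 - g\<^sup>2 * F)"
  proof -
    have "(\<Sum>k\<le>K. (g\<^sup>2 * F) ^ k) = ((g\<^sup>2 * F) ^ Suc K - 1) / (g\<^sup>2 * F - 1)"
      unfolding lessThan_Suc_atMost[symmetric] by (rule geometric_sum) (rule assms(2))
    also have "\<dots> = (1 - (g\<^sup>2 * F) ^ Suc K) / (1 - g\<^sup>2 * F)"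
      using assms(2) by (subst frac_eq_eq) (simp_all add: algebra_simps)
    finally show ?thesis .
  qed
  finally show ?thesis by simp
qed

text \<open>As \<open>z = \<theta> + F / \<theta>\<close> exceeds \<open>2 * s\<close>, the form of
  \<open>z - H\<close> is nonnegative. Expanding it at \<open>v - c * w\<close> with
  \<open>(z - H) w \<approx> x\<close> and \<open>c = \<theta> * ip x v\<close> gives
  \<open>ip v ((z - H) v) \<ge> 2 * c * ip x v - c^2 * ip x w\<close> up to errors, and
  \<open>ip x w \<approx> 1 / \<theta>\<close> turns the right side into
  \<open>\<theta> * (ip x v)^2\<close>.\<close>

lemma upper_bound:
  assumes th: "\<theta> > s" and e: "\<epsilon> > 0"
  shows "eventually (\<lambda>b. \<forall>v. ip (N b) v (mv (N b) (H b) v) + \<theta> * (ip (N b) (y 0 b) v)\<^sup>2 \<le>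
    (\<theta> + F / \<theta> + \<epsilon>) * ip (N b) v v) G"
proof -
  define g where "g = 1 / \<theta>"
  define z where "z = \<theta> + F / \<theta>"
  have t0: "\<theta> > 0" using s th by simp
  have g: "g > 0" "g * s < 1" "z * g = 1 + F * g\<^sup>2" "\<theta> * g = 1" "g\<^sup>2 * F < 1" "g \<noteq> 0"
    using t0 th s by (auto simp: g_def z_def F field_simps power2_eq_square mult_strict_mono)
  have z2: "z - 2 * s > 0"
  proof -
    have "z - 2 * s = (\<theta> - s)\<^sup>2 / \<theta>" using t0 by (simp add: z_def F field_simps power2_eq_square)
    thus ?thesis using th t0 by simp
  qed
  \<comment> \<open>Will bound the norm of \<open>w\<close>: the limit of its square is at most
    \<open>g^2 / (1 - g^2 * F)\<close> for every \<open>K\<close>, and 1 is slack.\<close>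
  define W where "W = sqrt (g\<^sup>2 / (1 - g\<^sup>2 * F) + 1)"
  have W: "W \<ge> 0" by (simp add: W_def g(5) less_imp_le)
  \<comment> \<open>The denominator adds up the coefficients of the errors \<open>e1\<close>,
    \<open>e3\<close> and \<open>e2\<close> below, so that together they amount to exactly
    \<open>\<epsilon>\<close> times the squared norm of \<open>v\<close>.\<close>
  define d where "d = \<epsilon> / (4 * \<theta> + 4 * \<theta> + 4 * \<theta>\<^sup>2 * W)"
  have den: "4 * \<theta> + 4 * \<theta> + 4 * \<theta>\<^sup>2 * W > 0" using t0 W by (intro add_pos_nonneg) auto
  have d: "d > 0" using e den by (simp add: d_def)
  obtain K where K: "eventually (\<lambda>b. nrm (N b) (rvec g K b) \<le> d) G" using rvec_small[OF g(1,2) d] by blast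
  have "(\<Sum>k\<le>K. (g ^ Suc k)\<^sup>2 * F ^ k) < g\<^sup>2 / (1 - g\<^sup>2 * F) + 1"
  proof -
    have "g\<^sup>2 * (1 - (g\<^sup>2 * F) ^ Suc K) / (1 - g\<^sup>2 * F) \<le> g\<^sup>2 * 1 / (1 - g\<^sup>2 * F)"
      using g F by (intro divide_right_mono mult_left_mono) auto
    thus ?thesis using g by (subst sum_geometric) auto
  qed
  hence ww: "eventually (\<lambda>b. ip (N b) (wvec g K b) (wvec g K b) < g\<^sup>2 / (1 - g\<^sup>2 * F) + 1) G"
    by (rule order_tendstoD[OF ip_wvec_wvec])
  have "((\<lambda>b. \<bar>1 - \<theta> * ip (N b) (y 0 b) (wvec g K b)\<bar>) \<longlongrightarrow> \<bar>1 - \<theta> * g\<bar>) G"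
    by (intro tendsto_intros ip_x_wvec)
  hence xw: "eventually (\<lambda>b. \<bar>1 - \<theta> * ip (N b) (y 0 b) (wvec g K b)\<bar> < d) G"
    using g d by (intro order_tendstoD) auto
  have xx: "eventually (\<lambda>b. ip (N b) (y 0 b) (y 0 b) < 4) G" using ip00 by (rule order_tendstoD) simp
  have o: "eventually (\<lambda>b. op_le (N b) (H b) (2 * s + (z - 2 * s))) G" using z2 by (rule op)
  show ?thesis
    using K ww xw xx o
  proof eventually_elim
    case (elim b)
    let ?ip = "ip (N b)" and ?x = "y 0 b" and ?w = "wvec g K b" and ?r = "rvec g K b" and ?M = "mv (N b) (H b)"
    have w: "nrm (N b) ?w \<le> W"
      unfolding W_def using elim(2) by (intro real_le_rsqrt) (simp add: ip_self)
    have x: "nrm (N b) ?x \<le> 2"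
      by (rule power2_le_imp_le) (use elim(4) in \<open>simp_all add: ip_self\<close>)
    have Bw: "(\<lambda>i. z * ?w i - ?M ?w i) = (\<lambda>i. ?x i + ?r i)" using mv_wvec[OF g(3)] by blast
    show ?case
    proof
      fix v
      define a where "a = nrm (N b) v"
      define t where "t = ?ip ?x v"
      define c where "c = \<theta> * t"
      have a: "a \<ge> 0" "?ip v v = a\<^sup>2" by (simp_all add: a_def L2_set_nonneg ip_self)
      have pos: "\<bar>?ip u (?M u)\<bar> \<le> z * ?ip u u" for u using op_le_qf[OF elim(5), of u] by simp
      let ?u = "\<lambda>i. v i - c * ?w i"
      have sym1: "?ip v (?M ?w) = ?ip ?w (?M v)"
        unfolding ip_commute[of "N b" ?w] by (rule ip_mv_symmetric) (rule sym)
      have exp: "z * ?ip ?u ?u - ?ip ?u (?M ?u) = (z * ?ip v v - ?ip v (?M v))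
          - 2 * c * (z * ?ip v ?w - ?ip v (?M ?w)) + c\<^sup>2 * (z * ?ip ?w ?w - ?ip ?w (?M ?w))"
        unfolding mv_diff mv_scale ip_linear sym1 ip_commute[of _ ?w v] power2_eq_square
        by (simp add: algebra_simps)
      have vw: "z * ?ip v ?w - ?ip v (?M ?w) = t + ?ip v ?r"
        using arg_cong[OF Bw, of "?ip v"] unfolding ip_linear t_def ip_commute[of _ v ?x] .
      have ww': "z * ?ip ?w ?w - ?ip ?w (?M ?w) = ?ip ?x ?w + ?ip ?w ?r"
        using arg_cong[OF Bw, of "?ip ?w"] unfolding ip_linear ip_commute[of _ ?w ?x] .
      have main: "z * ?ip v v - ?ip v (?M v) \<ge> 2 * c * (t + ?ip v ?r) - c\<^sup>2 * (?ip ?x ?w + ?ip ?w ?r)"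
        using exp pos[of ?u] unfolding vw ww' by linarith
      have t: "\<bar>t\<bar> \<le> 2 * a"
      proof -
        have "\<bar>t\<bar> \<le> nrm (N b) ?x * a" unfolding t_def a_def by (rule ip_Cauchy_Schwarz)
        also have "\<dots> \<le> 2 * a" using x a by (intro mult_right_mono)
        finally show ?thesis .
      qed
      have t2: "t\<^sup>2 \<le> 4 * a\<^sup>2" using power_mono[OF t, of 2] by (simp add: power_mult_distrib)
      have vr: "\<bar>?ip v ?r\<bar> \<le> a * d"
        using ip_Cauchy_Schwarz[of "N b" v ?r] mult_left_mono[OF elim(1) a(1)] unfolding a_def by linarith
      have wr: "\<bar>?ip ?w ?r\<bar> \<le> W * d"
        using ip_Cauchy_Schwarz[of "N b" ?w ?r] mult_mono[OF w elim(1)] W by (simp add: L2_set_nonneg)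
      have e1: "\<bar>2 * c * ?ip v ?r\<bar> \<le> 4 * \<theta> * a\<^sup>2 * d"
      proof -
        have "\<bar>2 * c * ?ip v ?r\<bar> = 2 * \<theta> * (\<bar>t\<bar> * \<bar>?ip v ?r\<bar>)" using t0 by (simp add: c_def abs_mult)
        also have "\<dots> \<le> 2 * \<theta> * ((2 * a) * (a * d))"
          using t vr t0 a by (intro mult_left_mono mult_mono) auto
        finally show ?thesis by (simp add: power2_eq_square mult_ac)
      qed
      have e2: "c\<^sup>2 * ?ip ?w ?r \<le> 4 * \<theta>\<^sup>2 * a\<^sup>2 * (W * d)"
      proof -
        have "c\<^sup>2 * ?ip ?w ?r \<le> c\<^sup>2 * (W * d)" using wr by (intro mult_left_mono) auto
        also have "\<dots> = \<theta>\<^sup>2 * t\<^sup>2 * (W * d)" by (simp add: c_def power_mult_distrib)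
        also have "\<dots> \<le> \<theta>\<^sup>2 * (4 * a\<^sup>2) * (W * d)" using t2 W d by (intro mult_right_mono mult_left_mono) auto
        finally show ?thesis by (simp add: mult_ac)
      qed
      have e3: "c\<^sup>2 * ?ip ?x ?w \<le> \<theta> * t\<^sup>2 + 4 * \<theta> * a\<^sup>2 * d"
      proof -
        have "c\<^sup>2 * ?ip ?x ?w - \<theta> * t\<^sup>2 = \<theta> * t\<^sup>2 * (\<theta> * ?ip ?x ?w - 1)"
          by (simp add: c_def power2_eq_square algebra_simps)
        also have "\<dots> \<le> \<theta> * t\<^sup>2 * d" using elim(3) t0 by (intro mult_left_mono) auto
        also have "\<dots> \<le> \<theta> * (4 * a\<^sup>2) * d" using t2 t0 d by (intro mult_right_mono mult_left_mono) auto
        finally show ?thesis by (simp add: mult_ac)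
      qed
      have ct: "2 * c * t = 2 * (\<theta> * t\<^sup>2)" by (simp add: c_def power2_eq_square)
      have tot: "4 * \<theta> * a\<^sup>2 * d + 4 * \<theta>\<^sup>2 * a\<^sup>2 * (W * d) + 4 * \<theta> * a\<^sup>2 * d = \<epsilon> * a\<^sup>2"
      proof -
        have "4 * \<theta> * a\<^sup>2 * d + 4 * \<theta>\<^sup>2 * a\<^sup>2 * (W * d) + 4 * \<theta> * a\<^sup>2 * d = a\<^sup>2 * ((4 * \<theta> + 4 * \<theta> + 4 * \<theta>\<^sup>2 * W) * d)"
          by (simp add: algebra_simps)
        thus ?thesis using den by (simp add: d_def)
      qed
      have "2 * c * (t + ?ip v ?r) - c\<^sup>2 * (?ip ?x ?w + ?ip ?w ?r) =
          2 * c * t + 2 * c * ?ip v ?r - c\<^sup>2 * ?ip ?x ?w - c\<^sup>2 * ?ip ?w ?r" by (simp add: algebra_simps)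
      hence "\<theta> * t\<^sup>2 \<le> z * ?ip v v - ?ip v (?M v) + \<epsilon> * a\<^sup>2"
        using main e1 e2 e3 ct tot by linarith
      thus "?ip v (?M v) + \<theta> * (?ip ?x v)\<^sup>2 \<le> (\<theta> + F / \<theta> + \<epsilon>) * ?ip v v"
        unfolding t_def[symmetric] z_def[symmetric] a(2) by (simp add: algebra_simps)
    qed
  qed
qed

text \<open>Both use the test vector \<open>w\<close>, for which
  \<open>H w \<approx> z * w - x\<close>. In the first bound the surplus
  \<open>\<theta> * (ip x w)^2 - ip x w\<close> tends to 0. In the second, \<open>ip w w\<close> is
  nearly \<open>1 / (\<theta>^2 - F)\<close>, so \<open>ip x w\<close> is nearly
  \<open>(\<theta> - F / \<theta>) * ip w w\<close>; subtracting it from \<open>z * ip w w\<close>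
  leaves \<open>2 * F / \<theta>\<close>, which approaches the bulk edge \<open>2 * s\<close> as
  \<open>\<theta>\<close> decreases to \<open>s\<close>.\<close>

lemma lower_bounds:
  assumes th: "\<theta> > s" and e: "\<epsilon> > 0"
  shows "eventually (\<lambda>b. \<exists>v. ip (N b) v v > 0 \<and> ip (N b) v (mv (N b) (H b) v) + \<theta> * (ip (N b) (y 0 b) v)\<^sup>2 \<ge>
    (\<theta> + F / \<theta> - \<epsilon>) * ip (N b) v v) G"
    and "eventually (\<lambda>b. \<exists>v. ip (N b) v v > 0 \<and> ip (N b) v (mv (N b) (H b) v) \<ge>
    (2 * F / \<theta> - \<epsilon>) * ip (N b) v v) G"
proof -
  define g where "g = 1 / \<theta>"
  define z where "z = \<theta> + F / \<theta>"
  have t0: "\<theta> > 0" using s th by simp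
  have g: "g > 0" "g * s < 1" "z * g = 1 + F * g\<^sup>2" "\<theta> * g = 1" "g\<^sup>2 * F < 1" "g \<noteq> 0"
    using t0 th s by (auto simp: g_def z_def F field_simps power2_eq_square mult_strict_mono)
  have F0: "F > 0" using s F by simp
  \<comment> \<open>The inner product of \<open>w\<close> with \<open>rvec\<close> is at most
    \<open>d\<close> times the norm of \<open>w\<close>; as that norm exceeds \<open>g / 2\<close>,
    this is at most \<open>\<epsilon> / 2 * ip w w\<close>.\<close>
  define d where "d = \<epsilon> * g / 4"
  have d: "d > 0" using e g by (simp add: d_def)
  obtain K0 where K0: "\<And>K. K \<ge> K0 \<Longrightarrow> eventually (\<lambda>b. nrm (N b) (rvec g K b) \<le> d) G"
    using rvec_small[OF g(1,2) d] by blast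
  have gF: "0 \<le> g\<^sup>2 * F" using F0 by simp
  have lim: "(\<lambda>K. g * (g\<^sup>2 * F) ^ Suc K) \<longlonglongrightarrow> g * 0"
    by (rule tendsto_mult_left, rule LIMSEQ_Suc, rule LIMSEQ_realpow_zero[OF gF g(5)])
  have "eventually (\<lambda>K. g * (g\<^sup>2 * F) ^ Suc K < \<epsilon> * g\<^sup>2 / 8) sequentially"
    by (rule order_tendstoD(2)[OF lim]) (use e g(1) in simp)
  then obtain K1 where K1: "\<And>K. K \<ge> K1 \<Longrightarrow> g * (g\<^sup>2 * F) ^ Suc K < \<epsilon> * g\<^sup>2 / 8"
    unfolding eventually_sequentially by blast
  \<comment> \<open>\<open>K0\<close> controls the truncation error of \<open>w\<close>, and
    \<open>K1\<close> the tail cut off from the geometric series for \<open>ip w w\<close>.\<close>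
  define K where "K = max K0 K1"
  have K: "eventually (\<lambda>b. nrm (N b) (rvec g K b) \<le> d) G" "g * (g\<^sup>2 * F) ^ Suc K < \<epsilon> * g\<^sup>2 / 8"
    by (rule K0, simp add: K_def) (rule K1, simp add: K_def)
  define Q where "Q = (\<Sum>k\<le>K. (g ^ Suc k)\<^sup>2 * F ^ k)"
  have "Q \<ge> (g ^ Suc 0)\<^sup>2 * F ^ 0"
    unfolding Q_def using F0 by (intro member_le_sum) auto
  hence "Q \<ge> g\<^sup>2" by simp
  moreover have "g\<^sup>2 > 0" using g(1) by simp
  ultimately have Q: "Q > g\<^sup>2 / 4" by linarith
  have Qeq: "(\<theta> - F / \<theta>) * Q - g = - g * (g\<^sup>2 * F) ^ Suc K"
  proof -
    have pos: "1 - g\<^sup>2 * F \<noteq> 0" using g(5) by simp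
    have 1: "(\<theta> - F / \<theta>) * g\<^sup>2 = g * (1 - g\<^sup>2 * F)"
      using t0 by (simp add: g_def field_simps power2_eq_square)
    have "(\<theta> - F / \<theta>) * Q = (\<theta> - F / \<theta>) * (g\<^sup>2 * (1 - (g\<^sup>2 * F) ^ Suc K) / (1 - g\<^sup>2 * F))"
      unfolding Q_def using g(5,6) by (subst sum_geometric) auto
    also have "\<dots> = ((\<theta> - F / \<theta>) * g\<^sup>2) * (1 - (g\<^sup>2 * F) ^ Suc K) / (1 - g\<^sup>2 * F)" by simp
    also have "\<dots> = g * (1 - (g\<^sup>2 * F) ^ Suc K)" unfolding 1 using pos by simp
    finally show ?thesis by (simp only: right_diff_distrib)
  qed
  have ww: "eventually (\<lambda>b. ip (N b) (wvec g K b) (wvec g K b) > g\<^sup>2 / 4) G"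
    using Q unfolding Q_def by (rule order_tendstoD[OF ip_wvec_wvec])
  have "((\<lambda>b. ip (N b) (y 0 b) (wvec g K b) * (1 - \<theta> * ip (N b) (y 0 b) (wvec g K b))) \<longlongrightarrow> g * (1 - \<theta> * g)) G"
    by (intro tendsto_intros ip_x_wvec)
  hence xw: "eventually (\<lambda>b. ip (N b) (y 0 b) (wvec g K b) * (1 - \<theta> * ip (N b) (y 0 b) (wvec g K b)) < \<epsilon> * g\<^sup>2 / 8) G"
    using g e by (intro order_tendstoD) auto
  have "((\<lambda>b. (\<theta> - F / \<theta>) * ip (N b) (wvec g K b) (wvec g K b) - ip (N b) (y 0 b) (wvec g K b)) \<longlongrightarrow> (\<theta> - F / \<theta>) * Q - g) G"
    unfolding Q_def by (intro tendsto_intros ip_x_wvec ip_wvec_wvec)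
  hence xw2: "eventually (\<lambda>b. (\<theta> - F / \<theta>) * ip (N b) (wvec g K b) (wvec g K b) - ip (N b) (y 0 b) (wvec g K b) > - (\<epsilon> * g\<^sup>2 / 8)) G"
    unfolding Qeq using K(2) by (intro order_tendstoD) auto
  have main: "ip (N b) w (mv (N b) (H b) w) \<ge> z * ip (N b) w w - ip (N b) (y 0 b) w - \<epsilon> / 2 * ip (N b) w w \<and>
      \<epsilon> * g\<^sup>2 / 8 \<le> \<epsilon> / 2 * ip (N b) w w"
    if "nrm (N b) (rvec g K b) \<le> d" "ip (N b) (wvec g K b) (wvec g K b) > g\<^sup>2 / 4" "w = wvec g K b" for b w
  proof -
    let ?w = "wvec g K b"
    have Bw: "(\<lambda>i. z * ?w i - mv (N b) (H b) ?w i) = (\<lambda>i. y 0 b i + rvec g K b i)" using mv_wvec[OF g(3)] by blast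
    have 1: "z * ip (N b) ?w ?w - ip (N b) ?w (mv (N b) (H b) ?w) = ip (N b) (y 0 b) ?w + ip (N b) ?w (rvec g K b)"
      using arg_cong[OF Bw, of "ip (N b) ?w"] unfolding ip_linear ip_commute[of _ ?w "y 0 b"] .
    define a where "a = nrm (N b) ?w"
    have "a\<^sup>2 > (g / 2)\<^sup>2" using that(2) by (simp add: a_def ip_self power2_eq_square)
    hence a: "a > g / 2" using g by (intro power2_less_imp_less[of "g / 2" a]) (auto simp: a_def L2_set_nonneg)
    have "\<bar>ip (N b) ?w (rvec g K b)\<bar> \<le> a * nrm (N b) (rvec g K b)" unfolding a_def by (rule ip_Cauchy_Schwarz)
    also have "\<dots> \<le> a * d" using that(1) by (intro mult_left_mono) (auto simp: a_def L2_set_nonneg)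
    also have "\<dots> \<le> a * (\<epsilon> / 2 * a)" using a g e by (intro mult_left_mono) (auto simp: d_def)
    also have "\<dots> = \<epsilon> / 2 * ip (N b) ?w ?w" by (simp add: ip_self a_def power2_eq_square)
    finally have 2: "\<bar>ip (N b) ?w (rvec g K b)\<bar> \<le> \<epsilon> / 2 * ip (N b) ?w ?w" .
    have "\<epsilon> / 2 * (g\<^sup>2 / 4) \<le> \<epsilon> / 2 * ip (N b) ?w ?w" using that(2) e by (intro mult_left_mono) auto
    thus ?thesis using 1 2 unfolding that(3) by (simp add: abs_le_iff)
  qed
  have g4: "g\<^sup>2 / 4 > 0" using g by simp
  show "eventually (\<lambda>b. \<exists>v. ip (N b) v v > 0 \<and> ip (N b) v (mv (N b) (H b) v) + \<theta> * (ip (N b) (y 0 b) v)\<^sup>2 \<ge>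
    (\<theta> + F / \<theta> - \<epsilon>) * ip (N b) v v) G"
    using K(1) ww xw
  proof eventually_elim
    case (elim b)
    define w where "w = wvec g K b"
    note m = main[OF elim(1,2) w_def]
    have "ip (N b) w w > 0" using elim(2) g4 unfolding w_def by linarith
    moreover have "ip (N b) w (mv (N b) (H b) w) + \<theta> * (ip (N b) (y 0 b) w)\<^sup>2 \<ge> z * ip (N b) w w - \<epsilon> * ip (N b) w w"
      using m elim(3) unfolding w_def[symmetric] by (simp add: power2_eq_square algebra_simps)
    ultimately show ?case unfolding z_def by (intro exI[of _ w]) (simp add: algebra_simps)
  qed
  show "eventually (\<lambda>b. \<exists>v. ip (N b) v v > 0 \<and> ip (N b) v (mv (N b) (H b) v) \<ge>
    (2 * F / \<theta> - \<epsilon>) * ip (N b) v v) G"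
    using K(1) ww xw2
  proof eventually_elim
    case (elim b)
    define w where "w = wvec g K b"
    note m = main[OF elim(1,2) w_def]
    have "ip (N b) w w > 0" using elim(2) g4 unfolding w_def by linarith
    moreover have "z * ip (N b) w w = 2 * F / \<theta> * ip (N b) w w + (\<theta> - F / \<theta>) * ip (N b) w w"
      by (simp add: z_def algebra_simps)
    hence "ip (N b) w (mv (N b) (H b) w) \<ge> 2 * F / \<theta> * ip (N b) w w - \<epsilon> * ip (N b) w w"
      using m elim(3) unfolding w_def[symmetric] by linarith
    ultimately show ?case by (intro exI[of _ w]) (simp add: left_diff_distrib)
  qed
qed

end

section \<open>The score function\<close>

text \<open>With a nonzero limit, \<open>w\<close> would dominate a multiple of the indicator of a
  half-line, which has infinite measure.\<close>

lemma limit_at_top_integrable_eq_0: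
  fixes w :: "real \<Rightarrow> real"
  assumes int: "integrable lborel w" and lim: "(w \<longlongrightarrow> c) at_top"
  shows "c = 0"
proof (rule ccontr)
  assume c: "c \<noteq> 0"
  have "((\<lambda>x. \<bar>w x\<bar>) \<longlongrightarrow> \<bar>c\<bar>) at_top" using lim by (rule tendsto_rabs)
  hence "eventually (\<lambda>x. \<bar>w x\<bar> > \<bar>c\<bar> / 2) at_top" using c by (intro order_tendstoD) auto
  then obtain a where a: "\<And>x. x \<ge> a \<Longrightarrow> \<bar>w x\<bar> > \<bar>c\<bar> / 2" unfolding eventually_at_top_linorder by blast
  have "integrable lborel (indicator {a..} :: real \<Rightarrow> real)"
  proof (rule Bochner_Integration.integrable_bound)
    show "integrable lborel (\<lambda>x. w x / (\<bar>c\<bar> / 2))" using int by simp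
    show "AE x in lborel. norm (indicator {a..} x :: real) \<le> norm (w x / (\<bar>c\<bar> / 2))"
    proof (rule AE_I2)
      fix x show "norm (indicator {a..} x :: real) \<le> norm (w x / (\<bar>c\<bar> / 2))"
        using a[of x] c by (cases "x \<ge> a") (auto simp: field_simps)
    qed
  qed simp
  hence fin: "emeasure lborel {a..} < \<infinity>" by (simp add: integrable_indicator_iff)
  obtain k :: nat where k: "ennreal (measure lborel {a..}) < of_nat k"
    using ennreal_less_top ennreal_Ex_less_of_nat by blast
  have "ennreal (real k) = emeasure lborel {a..a + real k}" by simp
  also have "\<dots> \<le> emeasure lborel {a..}" by (rule emeasure_mono) auto
  also have "\<dots> = ennreal (measure lborel {a..})" using fin by (simp add: emeasure_eq_ennreal_measure)
  finally have "ennreal (real k) \<le> ennreal (measure lborel {a..})" .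
  thus False using k unfolding ennreal_of_nat_eq_real_of_nat by (rule leD[THEN notE])
qed

text \<open>Integrability replaces any decay assumption: the integral over \<open>{-t..t}\<close> is
  \<open>u t - u (- t)\<close>, which converges as \<open>t\<close> grows and is itself integrable
  in \<open>t\<close>, so its limit can only be 0.\<close>

lemma integral_derivative_eq_0:
  fixes u u' :: "real \<Rightarrow> real"
  assumes der: "\<And>x. (u has_real_derivative u' x) (at x)" and cont: "\<And>x. isCont u' x"
    and int: "integrable lborel u" "integrable lborel u'"
  shows "(LINT x|lborel. u' x) = 0"
proof -
  define w where "w x = u x - u (- x)" for x
  have [measurable]: "u' \<in> borel_measurable borel" using int(2) by simp
  have "((\<lambda>t. LINT x|lborel. u' x * indicator {-t..t} x) \<longlongrightarrow> (LINT x|lborel. u' x)) at_top"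
  proof (rule integral_dominated_convergence_at_top[where w = "\<lambda>x. norm (u' x)"])
    show "AE x in lborel. ((\<lambda>t. u' x * indicator {-t..t} x) \<longlongrightarrow> u' x) at_top"
    proof (rule AE_I2)
      fix x
      have "eventually (\<lambda>t. u' x * indicator {-t..t} x = u' x) at_top"
        using eventually_ge_at_top[of "\<bar>x\<bar>"]
      proof eventually_elim
        case (elim t)
        hence "x \<in> {-t..t}" by auto
        thus ?case by simp
      qed
      thus "((\<lambda>t. u' x * indicator {-t..t} x) \<longlongrightarrow> u' x) at_top" by (rule tendsto_eventually)
    qed
    show "\<forall>\<^sub>F t in at_top. AE x in lborel. norm (u' x * indicator {-t..t} x) \<le> norm (u' x)"
    proof (intro always_eventually allI AE_I2)
      fix t x :: real
      show "norm (u' x * indicator {-t..t} x) \<le> norm (u' x)" by (cases "x \<in> {-t..t}") simp_all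
    qed
  qed (use int in auto)
  moreover have "eventually (\<lambda>t. (LINT x|lborel. u' x * indicator {-t..t} x) = w t) at_top"
    using eventually_ge_at_top[of 0]
  proof eventually_elim
    case (elim t)
    show ?case unfolding w_def by (rule integral_FTC_Icc_real) (use elim der cont in auto)
  qed
  ultimately have "(w \<longlongrightarrow> (LINT x|lborel. u' x)) at_top" by (rule Lim_transform_eventually)
  moreover have "integrable lborel w"
  proof -
    have "integrable lborel (\<lambda>x. u (0 + (- 1) * x))" by (rule lborel_integrable_real_affine[OF int(1)]) simp
    hence "integrable lborel (\<lambda>x. u (- x))" by simp
    with int(1) show ?thesis unfolding w_def[abs_def] by (rule Bochner_Integration.integrable_diff)
  qed
  ultimately show ?thesis using limit_at_top_integrable_eq_0 by blast
qed

text \<open>Applied with \<open>a = w^m\<close>, this turns powers up to the fifth of the growth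
  bound into moments of order \<open>5 * m\<close>.\<close>

lemma power_le_1_plus_power5:
  fixes a :: real assumes "a \<ge> 0" "k \<le> 5"
  shows "(1 + a) ^ k \<le> 32 * (1 + a ^ 5)"
proof -
  have "(1 + a) ^ k \<le> (1 + a) ^ 5" using assms by (intro power_increasing) auto
  also have "\<dots> \<le> (2 * max 1 a) ^ 5" using assms by (intro power_mono) auto
  also have "\<dots> = 32 * max 1 a ^ 5" by (simp add: power_mult_distrib)
  also have "max 1 a ^ 5 \<le> 1 + a ^ 5" using assms by (cases "a \<le> 1") (auto simp: max_def)
  finally show ?thesis by simp
qed

locale score_model =
  fixes P :: "real measure" and p :: "real \<Rightarrow> real" and m :: nat and C :: real
  assumes prob: "prob_space P" "sets P = sets borel"
    and density: "P = density lborel (\<lambda>w. ennreal (p w))"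
    and smooth: "\<And>k w. k < 3 \<Longrightarrow> (deriv ^^ k) p field_differentiable (at w)"
    and pos: "\<And>w. p w > 0"
    and growth: "C > 0" "even m" "m \<ge> 2"
      "\<And>l w. l \<le> 2 \<Longrightarrow> \<bar>(deriv ^^ l) (score p) w\<bar> \<le> C + w ^ m"
    and moments: "\<And>k. 1 \<le> k \<Longrightarrow> k \<le> 5 * m \<Longrightarrow> integrable P (\<lambda>w. \<bar>w\<bar> ^ k)"
begin

sublocale prob_space P by (rule prob(1))

abbreviation "f \<equiv> score p"
abbreviation "f' \<equiv> deriv (score p)"
abbreviation "f'' \<equiv> deriv (deriv (score p))"

lemma p_deriv: "(p has_real_derivative deriv p w) (at w)"
  "(deriv p has_real_derivative deriv (deriv p) w) (at w)"
  "(deriv (deriv p) has_real_derivative deriv (deriv (deriv p)) w) (at w)"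
  using smooth[of 0 w] smooth[of 1 w] smooth[of 2 w]
  by (simp_all add: DERIV_deriv_iff_field_differentiable numeral_2_eq_2)

lemma score_deriv: "(f has_real_derivative f' w) (at w)" "(f' has_real_derivative f'' w) (at w)"
proof -
  define g where "g w = ((- deriv (deriv p) w) * p w - (- deriv p w) * deriv p w) / (p w * p w)" for w
  have 1: "(f has_real_derivative g w) (at w)" for w
    unfolding score_def[abs_def] g_def
    by (intro DERIV_divide DERIV_minus p_deriv less_imp_neq[OF pos, symmetric])
  hence g: "f' = g" by (intro ext DERIV_imp_deriv)
  show "(f has_real_derivative f' w) (at w)" unfolding g by (rule 1)
  have fd: "p field_differentiable (at w)" "deriv p field_differentiable (at w)"
    "deriv (deriv p) field_differentiable (at w)"
    using p_deriv[of w] unfolding field_differentiable_def by blast+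
  have pp: "p w * p w \<noteq> 0" using pos[of w] by simp
  have "g field_differentiable (at w)"
    unfolding g_def[abs_def]
    by (intro field_differentiable_divide field_differentiable_diff field_differentiable_mult
        field_differentiable_minus fd pp)
  thus "(f' has_real_derivative f'' w) (at w)" unfolding g DERIV_deriv_iff_field_differentiable .
qed

lemma continuous: "isCont p w" "isCont (deriv p) w" "isCont f w" "isCont f' w"
  by (fact DERIV_isCont[OF p_deriv(1)] DERIV_isCont[OF p_deriv(2)]
      DERIV_isCont[OF score_deriv(1)] DERIV_isCont[OF score_deriv(2)])+

lemma measurable [measurable]:
  "p \<in> borel_measurable borel" "f \<in> borel_measurable borel" "f' \<in> borel_measurable borel"
  by (intro borel_measurable_continuous_onI continuous_at_imp_continuous_on ballI continuous)+

lemma measurable_P: "g \<in> borel_measurable borel \<Longrightarrow> g \<in> borel_measurable P"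
  using measurable_cong_sets[OF prob(2) refl] by blast

lemma score_le: "\<bar>f w\<bar> \<le> (C + 1) * (1 + w ^ m)" "\<bar>f' w\<bar> \<le> (C + 1) * (1 + w ^ m)"
  "\<bar>f'' w\<bar> \<le> C + w ^ m"
proof -
  have wm: "w ^ m \<ge> 0" by (rule zero_le_even_power[OF growth(2)])
  hence "C * w ^ m \<ge> 0" using growth(1) by simp
  hence "C + w ^ m \<le> (C + 1) * (1 + w ^ m)" using wm by (simp add: algebra_simps)
  moreover have "\<bar>f w\<bar> \<le> C + w ^ m" "\<bar>f' w\<bar> \<le> C + w ^ m" "\<bar>f'' w\<bar> \<le> C + w ^ m"
    using growth(4)[of 0 w] growth(4)[of 1 w] growth(4)[of 2 w] by (simp_all add: numeral_2_eq_2)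
  ultimately show "\<bar>f w\<bar> \<le> (C + 1) * (1 + w ^ m)" "\<bar>f' w\<bar> \<le> (C + 1) * (1 + w ^ m)"
    "\<bar>f'' w\<bar> \<le> C + w ^ m" by linarith+
qed

lemma integrable_growth:
  assumes g: "g \<in> borel_measurable borel" and D: "\<And>w. \<bar>g w\<bar> \<le> D * (1 + w ^ m)" and k: "k \<le> 5"
  shows "integrable P (\<lambda>w. g w ^ k)"
proof (rule Bochner_Integration.integrable_bound)
  have "integrable P (\<lambda>w. \<bar>w\<bar> ^ (5 * m))" using growth(3) by (intro moments) auto
  thus "integrable P (\<lambda>w. D ^ k * (32 * (1 + \<bar>w\<bar> ^ (5 * m))))" by simp
  show "(\<lambda>w. g w ^ k) \<in> borel_measurable P" by (rule measurable_P) (use g in measurable)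
  show "AE w in P. norm (g w ^ k) \<le> norm (D ^ k * (32 * (1 + \<bar>w\<bar> ^ (5 * m))))"
  proof (rule AE_I2)
    fix w :: real
    have wm: "w ^ m \<ge> 0" by (rule zero_le_even_power[OF growth(2)])
    have "0 \<le> D * (1 + 0 ^ m)" using D[of 0] by linarith
    hence D0: "D \<ge> 0" using growth(3) by (simp add: zero_le_mult_iff power_0_left split: if_splits)
    have "(w ^ m) ^ 5 = \<bar>w\<bar> ^ (5 * m)"
      using growth(2) by (simp add: power_mult[symmetric] power_even_abs mult.commute)
    hence le: "(1 + w ^ m) ^ k \<le> 32 * (1 + \<bar>w\<bar> ^ (5 * m))" using power_le_1_plus_power5[OF wm k] by simp
    have "norm (g w ^ k) = \<bar>g w\<bar> ^ k" by (simp add: power_abs)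
    also have "\<dots> \<le> (D * (1 + w ^ m)) ^ k" using D by (intro power_mono) auto
    also have "\<dots> = D ^ k * (1 + w ^ m) ^ k" by (rule power_mult_distrib)
    also have "\<dots> \<le> D ^ k * (32 * (1 + \<bar>w\<bar> ^ (5 * m)))" using le D0 by (intro mult_left_mono) auto
    also have "\<dots> \<le> norm (D ^ k * (32 * (1 + \<bar>w\<bar> ^ (5 * m))))" by simp
    finally show "norm (g w ^ k) \<le> norm (D ^ k * (32 * (1 + \<bar>w\<bar> ^ (5 * m))))" .
  qed
qed

lemma integrable_score: "k \<le> 5 \<Longrightarrow> integrable P (\<lambda>w. f w ^ k)" "k \<le> 5 \<Longrightarrow> integrable P (\<lambda>w. f' w ^ k)"
  using score_le by (auto intro!: integrable_growth measurable)

lemma integral_P: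
  assumes "g \<in> borel_measurable borel"
  shows "(LINT w|P. g w) = (LINT w|lborel. p w * g w)" "integrable P g = integrable lborel (\<lambda>w. p w * g w)"
proof -
  have p0: "AE w in lborel. 0 \<le> p w" using pos by (simp add: less_imp_le)
  show "(LINT w|P. g w) = (LINT w|lborel. p w * g w)"
    using integral_density[of g lborel p] assms p0 unfolding density by simp
  show "integrable P g = integrable lborel (\<lambda>w. p w * g w)"
    using integrable_density[of g lborel p] assms p0 unfolding density by simp
qed

lemma p_score: "deriv p w = - (p w * f w)"
  using pos[of w] by (simp add: score_def)

lemma mean_score: "(LINT w|P. f w) = 0"
proof -
  have "integrable lborel (\<lambda>w. p w * 1)" using integral_P(2)[of "\<lambda>_. 1"] by simp
  hence ip: "integrable lborel p" by simp
  have "integrable P f" using integrable_score(1)[of 1] by simp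
  hence "integrable lborel (\<lambda>w. p w * f w)" using integral_P(2)[OF measurable(2)] by blast
  hence id: "integrable lborel (deriv p)" unfolding p_score[abs_def] by simp
  have "(LINT w|lborel. deriv p w) = 0"
    by (rule integral_derivative_eq_0[OF p_deriv(1) continuous(2) ip id])
  thus ?thesis unfolding integral_P(1)[OF measurable(2)] p_score by simp
qed

text \<open>Integration by parts: \<open>p' = - p * f\<close> gives
  \<open>(p * f)' = p * f' - p * f^2\<close>, a derivative with integral 0. This identity is the
  source of the effective signal strength \<open>lam * F\<close>.\<close>

lemma mean_score_deriv: "(LINT w|P. f' w) = fisher_info P p"
proof -
  have f2: "(\<lambda>w. f w ^ 2) \<in> borel_measurable borel" by measurable
  have i1: "integrable P f" "integrable P f'" "integrable P (\<lambda>w. f w ^ 2)"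
    using integrable_score(1)[of 1] integrable_score(2)[of 1] integrable_score(1)[of 2] by simp_all
  have iu: "integrable lborel (\<lambda>w. p w * f w)" using i1(1) integral_P(2)[OF measurable(2)] by blast
  have ia: "integrable lborel (\<lambda>w. p w * f' w)" using i1(2) integral_P(2)[OF measurable(3)] by blast
  have ib: "integrable lborel (\<lambda>w. p w * f w ^ 2)" using i1(3) integral_P(2)[OF f2] by blast
  have iu': "integrable lborel (\<lambda>w. p w * f' w - p w * f w ^ 2)" using ia ib by (rule Bochner_Integration.integrable_diff)
  have der: "((\<lambda>w. p w * f w) has_real_derivative (p w * f' w - p w * f w ^ 2)) (at w)" for w
  proof -
    have "((\<lambda>w. p w * f w) has_real_derivative (deriv p w * f w + f' w * p w)) (at w)"
      by (rule DERIV_mult[OF p_deriv(1) score_deriv(1)])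
    moreover have "deriv p w * f w + f' w * p w = p w * f' w - p w * f w ^ 2"
      unfolding p_score by (simp add: power2_eq_square algebra_simps)
    ultimately show ?thesis by simp
  qed
  have cont: "isCont (\<lambda>w. p w * f' w - p w * f w ^ 2) w" for w
    by (intro continuous_intros continuous)
  have "(LINT w|lborel. p w * f' w - p w * f w ^ 2) = 0"
    by (rule integral_derivative_eq_0[OF der cont iu iu'])
  hence "(LINT w|lborel. p w * f' w) = (LINT w|lborel. p w * f w ^ 2)" using ia ib by simp
  thus ?thesis unfolding fisher_info_def integral_P(1)[OF measurable(3)] integral_P(1)[OF f2] .
qed

lemma fisher_info_lborel: "fisher_info P p = (LINT w|lborel. (deriv p w)\<^sup>2 / p w)"
proof -
  have f2: "(\<lambda>w. f w ^ 2) \<in> borel_measurable borel" by measurable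
  have "p w * f w ^ 2 = (deriv p w)\<^sup>2 / p w" for w
    using pos[of w] by (simp add: score_def power2_eq_square)
  thus ?thesis unfolding fisher_info_def integral_P(1)[OF f2] by simp
qed

text \<open>If \<open>F = 0\<close>, then \<open>p'\<close> vanishes almost everywhere, so
  \<open>p\<close> is constant on a half-line and, being integrable, zero there.\<close>

lemma fisher_info_pos: "fisher_info P p > 0"
proof (rule ccontr)
  assume "\<not> fisher_info P p > 0"
  moreover have "fisher_info P p \<ge> 0" unfolding fisher_info_def by (rule integral_nonneg_AE) auto
  ultimately have "fisher_info P p = 0" by linarith
  hence F0: "(LINT w|P. f w ^ 2) = 0" unfolding fisher_info_def .
  have "integrable P (\<lambda>w. f w ^ 2)" using integrable_score(1)[of 2] by simp
  hence "AE w in P. f w ^ 2 = 0" using F0 by (subst (asm) integral_nonneg_eq_0_iff_AE) auto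
  hence "AE w in lborel. p w > 0 \<longrightarrow> f w ^ 2 = 0" unfolding density by (subst (asm) AE_density) auto
  hence f0: "AE w in lborel. f w = 0" using pos by simp
  have const: "p t = p 0" if t: "t \<ge> 0" for t
  proof -
    have "(LINT w|lborel. deriv p w * indicator {0..t} w) = p t - p 0"
      by (rule integral_FTC_Icc_real) (use t p_deriv continuous in auto)
    moreover have "(LINT w|lborel. deriv p w * indicator {0..t} w) = 0"
      by (rule integral_eq_zero_AE) (use f0 in eventually_elim, simp add: p_score)
    ultimately show ?thesis by simp
  qed
  have "integrable lborel (\<lambda>w. p w * 1)" using integral_P(2)[of "\<lambda>_. 1"] by simp
  hence ip: "integrable lborel p" by simp
  moreover have "(p \<longlongrightarrow> p 0) at_top"
    by (rule tendsto_eventually, use eventually_ge_at_top[of 0] in eventually_elim) (rule const)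
  ultimately have "p 0 = 0" by (rule limit_at_top_integrable_eq_0)
  thus False using pos[of 0] by simp
qed

text \<open>The restriction \<open>\<bar>t\<bar> \<le> 1\<close> keeps the intermediate point within
  \<open>\<bar>w\<bar> + 1\<close>, so the coefficient depends on \<open>w\<close> alone and is
  square integrable under \<open>P\<close>.\<close>

lemma taylor_score:
  assumes t: "\<bar>t\<bar> \<le> 1"
  shows "\<bar>f (w + t) - f w - f' w * t\<bar> \<le> (C + (\<bar>w\<bar> + 1) ^ m) / 2 * t\<^sup>2"
proof (cases "t = 0")
  case False
  define D where "D k = (if k = 0 then f else if k = 1 then f' else f'')" for k :: nat
  have "\<exists>z. (if w + t < w then w + t < z \<and> z < w else w < z \<and> z < w + t) \<and>
    f (w + t) = (\<Sum>k<2. (D k w / fact k) * (w + t - w) ^ k) + (D 2 z / fact 2) * (w + t - w) ^ 2"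
  proof (rule Taylor[where a = "min w (w + t)" and b = "max w (w + t)"])
    show "\<forall>k z. k < 2 \<and> min w (w + t) \<le> z \<and> z \<le> max w (w + t) \<longrightarrow> (D k has_real_derivative D (Suc k) z) (at z)"
    proof (intro allI impI)
      fix k z assume "k < (2::nat) \<and> min w (w + t) \<le> z \<and> z \<le> max w (w + t)"
      hence "k = 0 \<or> k = 1" by auto
      thus "(D k has_real_derivative D (Suc k) z) (at z)" using score_deriv[of z] by (auto simp: D_def)
    qed
  qed (use False in \<open>auto simp: D_def\<close>)
  then obtain z where z: "if w + t < w then w + t < z \<and> z < w else w < z \<and> z < w + t"
    "f (w + t) = (\<Sum>k<2. (D k w / fact k) * (w + t - w) ^ k) + (D 2 z / fact 2) * (w + t - w) ^ 2" by blast
  have e: "f (w + t) - f w - f' w * t = f'' z / 2 * t\<^sup>2"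
    unfolding z(2) by (simp add: D_def numeral_2_eq_2)
  have "\<bar>z\<bar> \<le> \<bar>w\<bar> + 1" using z(1) t by (auto split: if_splits)
  hence "z ^ m \<le> (\<bar>w\<bar> + 1) ^ m" using growth(2) power_mono[of "\<bar>z\<bar>" "\<bar>w\<bar> + 1" m] by (simp add: power_even_abs)
  hence "\<bar>f'' z\<bar> \<le> C + (\<bar>w\<bar> + 1) ^ m" using score_le(3)[of z] by linarith
  hence "\<bar>f'' z\<bar> / 2 * t\<^sup>2 \<le> (C + (\<bar>w\<bar> + 1) ^ m) / 2 * t\<^sup>2" by (intro mult_right_mono divide_right_mono) auto
  thus ?thesis unfolding e by (simp add: abs_mult)
next
  case True
  then show ?thesis by simp
qed

lemma integrable_taylor_bound: "integrable P (\<lambda>w. ((C + (\<bar>w\<bar> + 1) ^ m) / 2) ^ 2)"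
proof (rule integrable_growth)
  fix w :: real
  have "(\<bar>w\<bar> + 1) ^ m \<le> (2 * max 1 \<bar>w\<bar>) ^ m" by (intro power_mono) auto
  also have "\<dots> = 2 ^ m * max 1 \<bar>w\<bar> ^ m" by (rule power_mult_distrib)
  also have "max 1 \<bar>w\<bar> ^ m \<le> 1 + \<bar>w\<bar> ^ m" by (cases "\<bar>w\<bar> \<le> 1") (auto simp: max_def)
  also have "\<bar>w\<bar> ^ m = w ^ m" using growth(2) by (simp add: power_even_abs)
  finally have "(\<bar>w\<bar> + 1) ^ m \<le> 2 ^ m * (1 + w ^ m)" by simp
  moreover have "C \<le> C * (1 + w ^ m)" using growth(1) zero_le_even_power[OF growth(2), of w] by simp
  ultimately have "C + (\<bar>w\<bar> + 1) ^ m \<le> (C + 2 ^ m) * (1 + w ^ m)" by (simp add: distrib_right)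
  moreover have "0 \<le> C + (\<bar>w\<bar> + 1) ^ m" using growth(1) by simp
  ultimately show "\<bar>(C + (\<bar>w\<bar> + 1) ^ m) / 2\<bar> \<le> (C + 2 ^ m) * (1 + w ^ m)" by simp
qed auto

end

section \<open>Events of high probability and the largest eigenvalue\<close>

text \<open>The filter of events of probability tending to one turns convergence in probability into
  ordinary convergence along a filter on pairs \<open>(n, \<omega>)\<close>.\<close>

definition whp_filter :: "(nat \<Rightarrow> 'a measure) \<Rightarrow> (nat \<times> 'a) filter" where
  "whp_filter M = Abs_filter (\<lambda>Q. \<exists>E. (\<forall>n. E n \<in> sets (M n) \<and> (\<forall>\<omega>\<in>E n. Q (n, \<omega>))) \<and>
     (\<lambda>n. measure (M n) (E n)) \<longlonglongrightarrow> 1)"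

text \<open>The family is closed under intersection because
  \<open>P(E \<inter> D) \<ge> P(E) + P(D) - 1\<close>. Asking for measurable sets
  \<open>E n\<close> inside the good event allows arbitrary predicates \<open>Q\<close>, so that
  monotonicity holds as well.\<close>

lemma eventually_whp_filter:
  assumes M: "\<And>n. prob_space (M n)"
  shows "eventually Q (whp_filter M) \<longleftrightarrow>
    (\<exists>E. (\<forall>n. E n \<in> sets (M n) \<and> (\<forall>\<omega>\<in>E n. Q (n, \<omega>))) \<and> (\<lambda>n. measure (M n) (E n)) \<longlonglongrightarrow> 1)"
  unfolding whp_filter_def
proof (rule eventually_Abs_filter, unfold_locales)
  show "\<exists>E. (\<forall>n. E n \<in> sets (M n) \<and> (\<forall>\<omega>\<in>E n. True)) \<and> (\<lambda>n. measure (M n) (E n)) \<longlonglongrightarrow> 1"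
    by (intro exI[of _ "\<lambda>n. space (M n)"]) (simp add: prob_space.prob_space[OF M])
next
  fix Q R
  assume "\<exists>E. (\<forall>n. E n \<in> sets (M n) \<and> (\<forall>\<omega>\<in>E n. Q (n, \<omega>))) \<and> (\<lambda>n. measure (M n) (E n)) \<longlonglongrightarrow> 1"
  then obtain E where E: "\<And>n. E n \<in> sets (M n)" "\<And>n \<omega>. \<omega> \<in> E n \<Longrightarrow> Q (n, \<omega>)" "(\<lambda>n. measure (M n) (E n)) \<longlonglongrightarrow> 1" by blast
  assume "\<exists>E. (\<forall>n. E n \<in> sets (M n) \<and> (\<forall>\<omega>\<in>E n. R (n, \<omega>))) \<and> (\<lambda>n. measure (M n) (E n)) \<longlonglongrightarrow> 1"
  then obtain D where D: "\<And>n. D n \<in> sets (M n)" "\<And>n \<omega>. \<omega> \<in> D n \<Longrightarrow> R (n, \<omega>)" "(\<lambda>n. measure (M n) (D n)) \<longlonglongrightarrow> 1" by blast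
  have low: "measure (M n) (E n) + measure (M n) (D n) - 1 \<le> measure (M n) (E n \<inter> D n)" for n
  proof -
    interpret prob_space "M n" by (rule M)
    have "prob (E n \<union> D n) = prob (E n) + prob (D n) - prob (E n \<inter> D n)"
      using E(1) D(1) by (intro measure_Un3) (auto simp: fmeasurable_eq_sets)
    thus ?thesis using prob_le_1[of "E n \<union> D n"] by linarith
  qed
  have up: "measure (M n) (E n \<inter> D n) \<le> 1" for n using prob_space.prob_le_1[OF M] .
  have "(\<lambda>n. measure (M n) (E n) + measure (M n) (D n) - 1) \<longlonglongrightarrow> 1 + 1 - 1"
    by (intro tendsto_intros E D)
  hence lim0: "(\<lambda>n. measure (M n) (E n) + measure (M n) (D n) - 1) \<longlonglongrightarrow> 1" by simp
  have "(\<lambda>n. measure (M n) (E n \<inter> D n)) \<longlonglongrightarrow> 1"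
    by (rule tendsto_sandwich[OF always_eventually[OF allI[OF low]] always_eventually[OF allI[OF up]] lim0 tendsto_const])
  thus "\<exists>E. (\<forall>n. E n \<in> sets (M n) \<and> (\<forall>\<omega>\<in>E n. Q (n, \<omega>) \<and> R (n, \<omega>))) \<and> (\<lambda>n. measure (M n) (E n)) \<longlonglongrightarrow> 1"
    using E(1,2) D(1,2) by (intro exI[of _ "\<lambda>n. E n \<inter> D n"]) auto
next
  fix Q R :: "nat \<times> 'a \<Rightarrow> bool"
  assume "\<forall>x. Q x \<longrightarrow> R x"
    "\<exists>E. (\<forall>n. E n \<in> sets (M n) \<and> (\<forall>\<omega>\<in>E n. Q (n, \<omega>))) \<and> (\<lambda>n. measure (M n) (E n)) \<longlonglongrightarrow> 1"
  thus "\<exists>E. (\<forall>n. E n \<in> sets (M n) \<and> (\<forall>\<omega>\<in>E n. R (n, \<omega>))) \<and> (\<lambda>n. measure (M n) (E n)) \<longlonglongrightarrow> 1"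
    by blast
qed

lemma eventually_whp_filterI:
  assumes M: "\<And>n. prob_space (M n)" and E: "\<And>n. E n \<in> sets (M n)" "\<And>n \<omega>. \<omega> \<in> E n \<Longrightarrow> Q (n, \<omega>)"
    "(\<lambda>n. measure (M n) (E n)) \<longlonglongrightarrow> 1"
  shows "eventually Q (whp_filter M)"
  unfolding eventually_whp_filter[OF M] using E by blast

lemma whp_imp_eventually:
  assumes M: "\<And>n. prob_space (M n)" and w: "whp M Q"
  shows "eventually (\<lambda>(n, \<omega>). Q n \<omega>) (whp_filter M)"
proof (rule eventually_whp_filterI[OF M])
  let ?S = "\<lambda>n. {\<omega> \<in> space (M n). Q n \<omega>}"
  \<comment> \<open>A non-measurable set has measure 0 by convention, so replacing it by the empty
    set leaves the probabilities unchanged.\<close>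
  let ?E = "\<lambda>n. if ?S n \<in> sets (M n) then ?S n else {}"
  show "?E n \<in> sets (M n)" for n by simp
  show "case (n, \<omega>) of (n, \<omega>) \<Rightarrow> Q n \<omega>" if "\<omega> \<in> ?E n" for n \<omega> using that by (auto split: if_splits)
  have "measure (M n) (?E n) = measure (M n) (?S n)" for n by (simp add: measure_notin_sets)
  thus "(\<lambda>n. measure (M n) (?E n)) \<longlonglongrightarrow> 1" using w unfolding whp_def by simp
qed

text \<open>The way back requires measurability, as otherwise the good event would be assigned
  measure 0. It is asked for \<open>n > 0\<close> only, where \<open>lambda_max\<close> is
  meaningful.\<close>

lemma eventually_imp_whp:
  assumes M: "\<And>n. prob_space (M n)" and Q: "eventually (\<lambda>(n, \<omega>). Q n \<omega>) (whp_filter M)"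
    and meas: "\<And>n. n > 0 \<Longrightarrow> {\<omega> \<in> space (M n). Q n \<omega>} \<in> sets (M n)"
  shows "whp M Q"
proof -
  obtain E where E: "\<And>n. E n \<in> sets (M n)" "\<And>n \<omega>. \<omega> \<in> E n \<Longrightarrow> Q n \<omega>" "(\<lambda>n. measure (M n) (E n)) \<longlonglongrightarrow> 1"
    using Q unfolding eventually_whp_filter[OF M] by auto
  have low: "eventually (\<lambda>n. measure (M n) (E n) \<le> measure (M n) {\<omega> \<in> space (M n). Q n \<omega>}) sequentially"
    using eventually_gt_at_top[of 0]
  proof eventually_elim
    case (elim n)
    interpret prob_space "M n" by (rule M)
    have "E n \<subseteq> {\<omega> \<in> space (M n). Q n \<omega>}" using E(2) sets.sets_into_space[OF E(1)[of n]] by blast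
    thus ?case using meas[OF elim] by (rule finite_measure_mono)
  qed
  show ?thesis
    unfolding whp_def
    by (rule tendsto_sandwich[OF low _ E(3) tendsto_const])
       (intro always_eventually allI prob_space.prob_le_1[OF M])
qed

lemma whp_filter_n_at_top:
  assumes M: "\<And>n. prob_space (M n)" and R: "eventually R sequentially"
  shows "eventually (\<lambda>(n, \<omega>). R n) (whp_filter M)"
proof (rule eventually_whp_filterI[OF M])
  let ?E = "\<lambda>n. if R n then space (M n) else {}"
  show "(\<lambda>n. measure (M n) (?E n)) \<longlonglongrightarrow> 1"
    by (rule tendsto_eventually) (use R in eventually_elim, simp add: prob_space.prob_space[OF M])
qed (auto split: if_splits)

lemma filterlim_fst_whp:
  assumes M: "\<And>n. prob_space (M n)"
  shows "filterlim fst sequentially (whp_filter M)"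
  unfolding filterlim_iff
proof (intro allI impI)
  fix R :: "nat \<Rightarrow> bool" assume "eventually R sequentially"
  from whp_filter_n_at_top[where M = M, OF M this] show "eventually (\<lambda>x. R (fst x)) (whp_filter M)"
    unfolding case_prod_unfold .
qed

text \<open>Markov's inequality. The hypothesis is on the nonnegative integral, which makes sense
  before integrability is known.\<close>

lemma tendsto_whp_filter_0:
  fixes Z :: "nat \<Rightarrow> 'a \<Rightarrow> real"
  assumes M: "\<And>n. prob_space (M n)" and Z: "\<And>n. Z n \<in> borel_measurable (M n)" "\<And>n \<omega>. Z n \<omega> \<ge> 0"
    and e: "eventually (\<lambda>n. (\<integral>\<^sup>+\<omega>. ennreal (Z n \<omega>) \<partial>M n) \<le> ennreal (e n)) sequentially" "e \<longlonglongrightarrow> 0"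
  shows "((\<lambda>(n, \<omega>). Z n \<omega>) \<longlongrightarrow> 0) (whp_filter M)"
  unfolding tendsto_iff
proof (intro allI impI)
  fix d :: real assume d: "d > 0"
  show "eventually (\<lambda>x. dist (case x of (n, \<omega>) \<Rightarrow> Z n \<omega>) 0 < d) (whp_filter M)"
  proof (rule eventually_whp_filterI[OF M])
    let ?E = "\<lambda>n. {\<omega> \<in> space (M n). Z n \<omega> < d}"
    show E: "?E n \<in> sets (M n)" for n using Z(1)[of n] by measurable
    show "dist (case (n, \<omega>) of (n, \<omega>) \<Rightarrow> Z n \<omega>) 0 < d" if "\<omega> \<in> ?E n" for n \<omega>
      using that Z(2)[of n \<omega>] by simp
    have low: "eventually (\<lambda>n. 1 - \<bar>e n\<bar> / d \<le> measure (M n) (?E n)) sequentially"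
      using e(1)
    proof eventually_elim
      case (elim n)
      interpret prob_space "M n" by (rule M)
      let ?B = "{\<omega> \<in> space (M n). 1 \<le> ennreal (1 / d) * ennreal (Z n \<omega>)}"
      have [measurable]: "Z n \<in> borel_measurable (M n)" by (rule Z)
      have "emeasure (M n) ?B \<le> ennreal (1 / d) * (\<integral>\<^sup>+\<omega>. ennreal (Z n \<omega>) * indicator (space (M n)) \<omega> \<partial>M n)"
        by (rule nn_integral_Markov_inequality) auto
      also have "(\<integral>\<^sup>+\<omega>. ennreal (Z n \<omega>) * indicator (space (M n)) \<omega> \<partial>M n) = (\<integral>\<^sup>+\<omega>. ennreal (Z n \<omega>) \<partial>M n)"
        by (intro nn_integral_cong) auto
      also have "ennreal (1 / d) * \<dots> \<le> ennreal (1 / d) * ennreal (e n)" using elim by (rule mult_left_mono) simp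
      also have "\<dots> \<le> ennreal (1 / d) * ennreal \<bar>e n\<bar>" by (intro mult_left_mono ennreal_leI) auto
      also have "\<dots> = ennreal (\<bar>e n\<bar> / d)" using d by (simp add: ennreal_mult[symmetric])
      finally have "prob ?B \<le> \<bar>e n\<bar> / d" using d by (simp add: emeasure_eq_measure)
      moreover have "space (M n) - ?E n = ?B"
      proof -
        have "1 \<le> ennreal (1 / d) * ennreal (Z n \<omega>) \<longleftrightarrow> \<not> Z n \<omega> < d" for \<omega>
        proof -
          have "ennreal (1 / d) * ennreal (Z n \<omega>) = ennreal (Z n \<omega> / d)"
            using d Z(2)[of n \<omega>] by (simp add: ennreal_mult[symmetric])
          thus ?thesis using d Z(2)[of n \<omega>] by (simp add: ennreal_ge_1 field_simps not_less)
        qed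
        thus ?thesis by auto
      qed
      moreover have "prob (space (M n) - ?E n) = 1 - prob (?E n)" using E by (rule prob_compl)
      ultimately show ?case by simp
    qed
    have "(\<lambda>n. 1 - \<bar>e n\<bar> / d) \<longlonglongrightarrow> 1 - \<bar>0\<bar> / d" by (intro tendsto_intros e) (use d in simp)
    hence lim: "(\<lambda>n. 1 - \<bar>e n\<bar> / d) \<longlonglongrightarrow> 1" by simp
    show "(\<lambda>n. measure (M n) (?E n)) \<longlonglongrightarrow> 1"
      by (rule tendsto_sandwich[OF low _ lim tendsto_const])
         (intro always_eventually allI prob_space.prob_le_1[OF M])
  qed
qed

text \<open>Tonelli's theorem with the spike held fixed: the moment bounds are conditional on
  \<open>x\<close> and available only where its norm is bounded, hence the indicator of
  \<open>B\<close>.\<close>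

lemma nn_integral_pair_le:
  fixes Z :: "'a \<times> 'b \<Rightarrow> real"
  assumes X: "prob_space X" and Q: "prob_space Q"
    and Z: "Z \<in> borel_measurable (X \<Otimes>\<^sub>M Q)" "\<And>\<omega>. Z \<omega> \<ge> 0" and B: "B \<in> sets X"
    and le: "\<And>x. x \<in> B \<Longrightarrow> integrable Q (\<lambda>W. Z (x, W)) \<and> (LINT W|Q. Z (x, W)) \<le> e"
  shows "(\<integral>\<^sup>+\<omega>. ennreal (indicator B (fst \<omega>) * Z \<omega>) \<partial>(X \<Otimes>\<^sub>M Q)) \<le> ennreal e"
proof -
  interpret X: prob_space X by fact
  interpret Q: prob_space Q by fact
  have [measurable]: "B \<in> sets X" "Z \<in> borel_measurable (X \<Otimes>\<^sub>M Q)" by fact+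
  have "(\<integral>\<^sup>+\<omega>. ennreal (indicator B (fst \<omega>) * Z \<omega>) \<partial>(X \<Otimes>\<^sub>M Q)) =
      (\<integral>\<^sup>+x. \<integral>\<^sup>+W. ennreal (indicator B (fst (x, W)) * Z (x, W)) \<partial>Q \<partial>X)"
    by (rule Q.nn_integral_fst[symmetric]) measurable
  also have "\<dots> \<le> (\<integral>\<^sup>+x. ennreal e \<partial>X)"
  proof (rule nn_integral_mono)
    fix x
    show "(\<integral>\<^sup>+W. ennreal (indicator B (fst (x, W)) * Z (x, W)) \<partial>Q) \<le> ennreal e"
    proof (cases "x \<in> B")
      case True
      have "(\<integral>\<^sup>+W. ennreal (Z (x, W)) \<partial>Q) = ennreal (LINT W|Q. Z (x, W))"
        using le[OF True] Z(2) by (intro nn_integral_eq_integral) auto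
      also have "\<dots> \<le> ennreal e" using le[OF True] by (intro ennreal_leI) auto
      finally show ?thesis using True by simp
    qed simp
  qed
  also have "\<dots> = ennreal e" by (simp add: X.emeasure_space_1)
  finally show ?thesis .
qed

section \<open>The variational description of the largest eigenvalue\<close>

lemma compact_unit_sphere:
  "compact {v :: nat \<Rightarrow> real. (\<forall>i\<ge>n. v i = 0) \<and> ip n v v = 1}"
proof -
  \<comment> \<open>Coordinates beyond \<open>n\<close> are pinned to 0, so that the sphere sits
    inside a product of compact sets indexed by all of \<open>nat\<close>.\<close>
  define S where "S i = (if i < n then {-1..1} else {0 :: real})" for i
  have "compactin (product_topology (\<lambda>_. euclidean) UNIV) (PiE UNIV S)"
    unfolding compactin_PiE by (auto simp: S_def compactin_euclidean_iff)
  hence 1: "compact (PiE UNIV S)" by (simp add: euclidean_product_topology compactin_euclidean_iff)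
  have cont: "continuous_on UNIV (\<lambda>v :: nat \<Rightarrow> real. ip n v v)"
    unfolding ip_def by (intro continuous_intros continuous_on_product_coordinates)
  have 2: "closed {v :: nat \<Rightarrow> real. ip n v v = 1}"
    by (intro closed_Collect_eq cont continuous_on_const)
  have "{v :: nat \<Rightarrow> real. (\<forall>i\<ge>n. v i = 0) \<and> ip n v v = 1} = PiE UNIV S \<inter> {v. ip n v v = 1}"
  proof (intro equalityI subsetI)
    fix v :: "nat \<Rightarrow> real" assume v: "v \<in> {v. (\<forall>i\<ge>n. v i = 0) \<and> ip n v v = 1}"
    have "v i \<in> S i" for i
    proof (cases "i < n")
      case True
      have "v i * v i \<le> ip n v v" unfolding ip_def by (rule member_le_sum) (use True in auto)
      hence "\<bar>v i\<bar> \<le> 1" using v by (simp add: power2_eq_square[symmetric] abs_square_le_1)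
      thus ?thesis using True by (simp add: S_def abs_le_iff)
    qed (use v in \<open>auto simp: S_def\<close>)
    thus "v \<in> PiE UNIV S \<inter> {v. ip n v v = 1}" using v by (auto simp: PiE_def)
  next
    fix v assume v: "v \<in> PiE UNIV S \<inter> {v. ip n v v = 1}"
    have "v i = 0" if "i \<ge> n" for i using v that by (auto simp: PiE_def S_def Pi_iff dest: spec[of _ i])
    thus "v \<in> {v. (\<forall>i\<ge>n. v i = 0) \<and> ip n v v = 1}" using v by auto
  qed
  thus ?thesis using compact_Int_closed[OF 1 2] by simp
qed

lemma continuous_qf: "continuous_on S (\<lambda>v :: nat \<Rightarrow> real. ip n v (mv n a v))"
  unfolding ip_def mv_def
  by (rule continuous_on_subset[OF _ subset_UNIV]) (intro continuous_intros continuous_on_product_coordinates)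

lemma continuous_ip: "continuous_on S (\<lambda>v :: nat \<Rightarrow> real. ip n v x)"
  unfolding ip_def
  by (rule continuous_on_subset[OF _ subset_UNIV]) (intro continuous_intros continuous_on_product_coordinates)

lemma to_unit_sphere:
  assumes "ip n v v > 0"
  defines "u \<equiv> \<lambda>i. if i < n then v i / nrm n v else 0"
  shows "(\<forall>i\<ge>n. u i = 0) \<and> ip n u u = 1"
    "ip n v (mv n a v) = ip n v v * ip n u (mv n a u)" "(ip n v x)\<^sup>2 = ip n v v * (ip n u x)\<^sup>2"
proof -
  define r where "r = nrm n v"
  have r: "r \<noteq> 0" "ip n v v = r\<^sup>2" using assms(1) by (auto simp: r_def ip_self)
  have u: "u i = (1 / r) * v i" if "i < n" for i using that by (simp add: u_def r_def)
  have 1: "ip n u w = (1 / r) * ip n v w" for w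
    unfolding ip_def sum_distrib_left using u by (intro sum.cong refl) simp
  have 2: "mv n a u i = (1 / r) * mv n a v i" for i
    unfolding mv_def sum_distrib_left using u by (intro sum.cong refl) simp
  show "(\<forall>i\<ge>n. u i = 0) \<and> ip n u u = 1"
    using r 1[of u] 1[of v] ip_commute[of n v u] by (simp add: u_def power2_eq_square)
  have "ip n u (mv n a u) = (1 / r) * ((1 / r) * ip n v (mv n a v))"
    unfolding 1 2[abs_def] ip_scale_right ..
  thus "ip n v (mv n a v) = ip n v v * ip n u (mv n a u)" using r by (simp add: power2_eq_square)
  show "(ip n v x)\<^sup>2 = ip n v v * (ip n u x)\<^sup>2" unfolding 1 r(2) using r(1) by (simp add: power_divide)
qed

text \<open>The first-order condition: moving from \<open>v\<close> by \<open>t\<close> along the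
  residual \<open>e\<close> changes the nonnegative form of \<open>\<mu> - a\<close> from 0 to
  \<open>t^2 * D - 2 * t * ip e e\<close>, which is negative for small positive \<open>t\<close>
  unless \<open>e = 0\<close>.\<close>

lemma qf_maximiser_eigenvector:
  assumes sym: "\<And>i j. a i j = a j i"
    and max: "\<And>u. ip n u (mv n a u) \<le> \<mu> * ip n u u" and v: "ip n v (mv n a v) = \<mu> * ip n v v"
  shows "i < n \<Longrightarrow> mv n a v i = \<mu> * v i"
proof -
  define e where "e i = mv n a v i - \<mu> * v i" for i
  define D where "D = \<mu> * ip n e e - ip n e (mv n a e)"
  define q where "q = ip n e e"
  have q0: "q \<ge> 0" by (simp add: q_def ip_self_nonneg)
  have ineq: "0 \<le> t\<^sup>2 * D - 2 * t * q" for t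
  proof -
    let ?u = "\<lambda>i. v i - (- t) * e i"
    have s: "ip n v (mv n a e) = ip n e (mv n a v)"
      unfolding ip_commute[of n e] by (rule ip_mv_symmetric) (rule sym)
    have q': "q = ip n e (mv n a v) - \<mu> * ip n e v"
      unfolding q_def using ip_diff_right[of n e "mv n a v" "\<lambda>i. \<mu> * v i"]
      by (simp add: e_def[symmetric] ip_scale_right)
    have "\<mu> * ip n ?u ?u - ip n ?u (mv n a ?u) = (\<mu> * ip n v v - ip n v (mv n a v)) - 2 * t * q + t\<^sup>2 * D"
      unfolding mv_diff mv_scale ip_linear s D_def q' ip_commute[of n v e] power2_eq_square
      by (simp add: algebra_simps)
    thus ?thesis using max[of ?u] v by simp
  qed
  have "q = 0"
  proof (cases "D > 0")
    case True
    \<comment> \<open>The value \<open>q / D\<close> minimises the quadratic in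
      \<open>t\<close>.\<close>
    have "0 \<le> (q / D)\<^sup>2 * D - 2 * (q / D) * q" by (rule ineq)
    also have "\<dots> = - (q * q / D)" using True by (simp add: power2_eq_square field_simps)
    finally have "q * q / D \<le> 0" by simp
    hence "q * q \<le> 0" using True by (simp add: divide_le_0_iff)
    thus ?thesis by (simp add: mult_le_0_iff) (use q0 in linarith)
  next
    case False
    thus ?thesis using ineq[of 1] q0 by simp
  qed
  hence "\<forall>i<n. e i * e i = 0"
    unfolding q_def ip_def by (subst (asm) sum_nonneg_eq_0_iff) auto
  thus "i < n \<Longrightarrow> mv n a v i = \<mu> * v i" by (simp add: e_def)
qed

lemma eigenvector_mat_iff:
  fixes a :: "nat \<Rightarrow> nat \<Rightarrow> real"
  shows "eigenvector (mat n n (\<lambda>(i, j). a i j)) v k \<longleftrightarrow>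
    v \<in> carrier_vec n \<and> v \<noteq> 0\<^sub>v n \<and> (\<forall>i<n. mv n a (vec_index v) i = k * vec_index v i)"
proof (cases "v \<in> carrier_vec n")
  case True
  hence d: "dim_vec v = n" by simp
  have 1: "vec_index (mat n n (\<lambda>(i, j). a i j) *\<^sub>v v) i = mv n a (vec_index v) i" if "i < n" for i
    using that d by (simp add: mv_def scalar_prod_def lessThan_atLeast0)
  have "mat n n (\<lambda>(i, j). a i j) *\<^sub>v v = k \<cdot>\<^sub>v v \<longleftrightarrow> (\<forall>i<n. mv n a (vec_index v) i = k * vec_index v i)"
  proof
    assume e: "mat n n (\<lambda>(i, j). a i j) *\<^sub>v v = k \<cdot>\<^sub>v v"
    show "\<forall>i<n. mv n a (vec_index v) i = k * vec_index v i"
    proof (intro allI impI)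
      fix i assume i: "i < n"
      show "mv n a (vec_index v) i = k * vec_index v i"
        unfolding 1[OF i, symmetric] e using i d by simp
    qed
  next
    assume e: "\<forall>i<n. mv n a (vec_index v) i = k * vec_index v i"
    show "mat n n (\<lambda>(i, j). a i j) *\<^sub>v v = k \<cdot>\<^sub>v v"
    proof (rule eq_vecI)
      fix i assume "i < dim_vec (k \<cdot>\<^sub>v v)"
      hence i: "i < n" using d by simp
      show "vec_index (mat n n (\<lambda>(i, j). a i j) *\<^sub>v v) i = vec_index (k \<cdot>\<^sub>v v) i"
        unfolding 1[OF i] using e i d by simp
    qed (simp add: d)
  qed
  thus ?thesis unfolding eigenvector_def by simp
next
  case False
  thus ?thesis unfolding eigenvector_def by simp
qed

lemma scalar_prod_ip: "v \<in> carrier_vec n \<Longrightarrow> scalar_prod v v = ip n (vec_index v) (vec_index v)"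
  "v \<in> carrier_vec n \<Longrightarrow> scalar_prod v (vec n x) = ip n (vec_index v) x"
  by (auto simp: scalar_prod_def ip_def lessThan_atLeast0)

text \<open>A maximiser of the form on the compact sphere is an eigenvector, and every eigenvalue is
  a value of the Rayleigh quotient, so the maximum is the \<open>Max\<close> of the
  spectrum.\<close>

lemma lambda_max_attained:
  fixes a :: "nat \<Rightarrow> nat \<Rightarrow> real"
  assumes n: "n > 0" and sym: "\<And>i j. a i j = a j i"
  shows "(\<forall>u. ip n u (mv n a u) \<le> lambda_max (mat n n (\<lambda>(i, j). a i j)) * ip n u u) \<and>
    (\<exists>v. ip n v v = 1 \<and> ip n v (mv n a v) = lambda_max (mat n n (\<lambda>(i, j). a i j)))"
proof -
  let ?K = "{v :: nat \<Rightarrow> real. (\<forall>i\<ge>n. v i = 0) \<and> ip n v v = 1}"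
  let ?A = "mat n n (\<lambda>(i, j). a i j)"
  have "ip n (\<lambda>_. 1) (\<lambda>_. 1) > 0" using n by (simp add: ip_def)
  from to_unit_sphere(1)[OF this] have "(\<lambda>i. if i < n then 1 / nrm n (\<lambda>_. 1) else 0) \<in> ?K"
    unfolding mem_Collect_eq .
  hence ne: "?K \<noteq> {}" by (rule ex_in_conv[THEN iffD1, OF exI])
  have "\<exists>v\<in>?K. \<forall>u\<in>?K. ip n u (mv n a u) \<le> ip n v (mv n a v)"
    by (rule continuous_attains_sup[OF compact_unit_sphere ne continuous_qf])
  then obtain v where v: "v \<in> ?K" "\<And>u. u \<in> ?K \<Longrightarrow> ip n u (mv n a u) \<le> ip n v (mv n a v)"
    by (elim bexE) (rule that, assumption, erule bspec)
  define \<mu> where "\<mu> = ip n v (mv n a v)"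
  have max: "ip n u (mv n a u) \<le> \<mu> * ip n u u" for u
  proof (cases "ip n u u > 0")
    case True
    let ?u = "\<lambda>i. if i < n then u i / nrm n u else 0"
    note t = to_unit_sphere[OF True]
    have "ip n ?u (mv n a ?u) \<le> \<mu>" unfolding \<mu>_def by (rule v(2), unfold mem_Collect_eq, rule t(1))
    hence "ip n u u * ip n ?u (mv n a ?u) \<le> ip n u u * \<mu>" using True by (intro mult_left_mono) auto
    thus ?thesis unfolding t(2)[of a] by (simp add: mult.commute)
  next
    case False
    hence z: "nrm n u = 0" using ip_self_nonneg[of n u] by (simp add: ip_self)
    hence "\<bar>ip n u (mv n a u)\<bar> \<le> 0" using ip_Cauchy_Schwarz[of n u "mv n a u"] by simp
    thus ?thesis using z by (simp add: ip_self)
  qed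
  have ev: "mv n a v i = \<mu> * v i" if "i < n" for i
    by (rule qf_maximiser_eigenvector[OF sym max _ that]) (use v(1) in \<open>simp add: \<mu>_def\<close>)
  have "eigenvector ?A (vec n v) \<mu>"
    unfolding eigenvector_mat_iff
  proof (intro conjI allI impI)
    show "vec n v \<noteq> 0\<^sub>v n"
    proof
      assume z: "vec n v = 0\<^sub>v n"
      have "v i = 0" if "i < n" for i using arg_cong[OF z, of "\<lambda>w. vec_index w i"] that by simp
      hence "ip n v v = 0" by (simp add: ip_def)
      thus False using v(1) by simp
    qed
    fix i assume i: "i < n"
    have "mv n a (vec_index (vec n v)) = mv n a v" by (rule mv_cong) simp
    thus "mv n a (vec_index (vec n v)) i = \<mu> * vec_index (vec n v) i" using ev[OF i] i by simp
  qed simp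
  hence mem: "\<mu> \<in> spectrum ?A" unfolding spectrum_def eigenvalue_def by blast
  have fin: "finite (spectrum ?A)" by (rule card_finite_spectrum(1)[of _ n]) simp
  have le: "k \<le> \<mu>" if "k \<in> spectrum ?A" for k
  proof -
    have "\<exists>w. eigenvector ?A w k" using that unfolding spectrum_def mem_Collect_eq eigenvalue_def .
    then obtain w where "eigenvector ?A w k" by (rule exE)
    hence w: "w \<in> carrier_vec n" "w \<noteq> 0\<^sub>v n" "\<And>i. i < n \<Longrightarrow> mv n a (vec_index w) i = k * vec_index w i"
      unfolding eigenvector_mat_iff by blast+
    let ?w = "vec_index w"
    have q: "ip n ?w (mv n a ?w) = k * ip n ?w ?w"
      unfolding ip_scale_right[symmetric] by (rule ip_cong) (use w(3) in auto)
    have "ip n ?w ?w > 0"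
    proof (rule ccontr)
      assume "\<not> ip n ?w ?w > 0"
      hence "ip n ?w ?w = 0" using ip_self_nonneg[of n ?w] by simp
      hence "\<forall>i<n. ?w i * ?w i = 0" unfolding ip_def by (subst (asm) sum_nonneg_eq_0_iff) auto
      hence "w = 0\<^sub>v n" using w(1) by (intro eq_vecI) auto
      thus False using w(2) by simp
    qed
    thus ?thesis using max[of ?w] unfolding q by simp
  qed
  have "lambda_max ?A = \<mu>" unfolding lambda_max_def by (rule Max_eqI[OF fin le mem])
  thus ?thesis using max v(1) \<mu>_def by auto
qed

lemma lambda_max_le_iff:
  fixes a :: "nat \<Rightarrow> nat \<Rightarrow> real"
  assumes "n > 0" "\<And>i j. a i j = a j i"
  shows "lambda_max (mat n n (\<lambda>(i, j). a i j)) \<le> t \<longleftrightarrow> (\<forall>u. ip n u (mv n a u) \<le> t * ip n u u)"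
proof -
  let ?l = "lambda_max (mat n n (\<lambda>(i, j). a i j))"
  note l = lambda_max_attained[where n = n and a = a, OF assms]
  show ?thesis
  proof
    assume t: "?l \<le> t"
    show "\<forall>u. ip n u (mv n a u) \<le> t * ip n u u"
    proof
      fix u
      have "ip n u (mv n a u) \<le> ?l * ip n u u" using l by blast
      also have "\<dots> \<le> t * ip n u u" using t by (rule mult_right_mono) (rule ip_self_nonneg)
      finally show "ip n u (mv n a u) \<le> t * ip n u u" .
    qed
  next
    assume t: "\<forall>u. ip n u (mv n a u) \<le> t * ip n u u"
    obtain v where v: "ip n v v = 1" "ip n v (mv n a v) = ?l" using l by blast
    show "?l \<le> t" using t[rule_format, of v] v by simp
  qed
qed

lemma lambda_max_ge:
  fixes a :: "nat \<Rightarrow> nat \<Rightarrow> real"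
  assumes "n > 0" "\<And>i j. a i j = a j i" and v: "ip n v v > 0" "ip n v (mv n a v) \<ge> t * ip n v v"
  shows "lambda_max (mat n n (\<lambda>(i, j). a i j)) \<ge> t"
proof -
  have "ip n v (mv n a v) \<le> lambda_max (mat n n (\<lambda>(i, j). a i j)) * ip n v v"
    using lambda_max_attained[where n = n and a = a, OF assms(1,2)] by blast
  hence "t * ip n v v \<le> lambda_max (mat n n (\<lambda>(i, j). a i j)) * ip n v v" using v(2) by linarith
  thus ?thesis using v(1) by simp
qed

section \<open>Measurability by reduction to countably many rational vectors\<close>

definition ratv :: "rat list \<Rightarrow> nat \<Rightarrow> real" where
  "ratv l i = of_rat (l ! i)"

lemma ratv_dense: "\<exists>l :: nat \<Rightarrow> rat list. \<forall>i<n. (\<lambda>k. ratv (l k) i) \<longlonglongrightarrow> v i"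
proof -
  have "\<exists>q. \<bar>of_rat q - x\<bar> < 1 / real (Suc k)" for x :: real and k
  proof -
    have "x < x + 1 / real (Suc k)" by simp
    then obtain q where "x < of_rat q" "of_rat q < x + 1 / real (Suc k)" using of_rat_dense by blast
    thus ?thesis by (intro exI[of _ q]) auto
  qed
  then obtain q where q: "\<And>x k. \<bar>of_rat (q x k) - x\<bar> < 1 / real (Suc k)" by metis
  define l where "l k = map (\<lambda>i. q (v i) k) [0..<n]" for k
  have "(\<lambda>k. ratv (l k) i) \<longlonglongrightarrow> v i" if i: "i < n" for i
  proof (rule Lim_transform)
    show "(\<lambda>k. v i) \<longlonglongrightarrow> v i" by simp
    have b: "eventually (\<lambda>k. norm (ratv (l k) i - v i) \<le> 1 / real (Suc k)) sequentially"
    proof (rule always_eventually, rule allI)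
      fix k
      have "ratv (l k) i = of_rat (q (v i) k)" using i by (simp add: ratv_def l_def)
      thus "norm (ratv (l k) i - v i) \<le> 1 / real (Suc k)" using q[of "v i" k] by simp
    qed
    show "(\<lambda>k. ratv (l k) i - v i) \<longlonglongrightarrow> 0"
      by (rule Lim_null_comparison[OF b]) (rule LIMSEQ_inverse_real_of_nat[unfolded inverse_eq_divide])
  qed
  thus ?thesis by blast
qed

text \<open>One expression serves both the characterisation of \<open>lambda_max\<close>, with
  \<open>d = 0\<close>, and the penalised eigenvector inequality. As \<open>rat list\<close> is
  countable, a quantifier over \<open>l\<close> becomes a countable intersection of measurable
  sets.\<close>

lemma rat_nonneg_imp_nonneg:
  assumes "\<And>l. 0 \<le> c * ip n (ratv l) (ratv l) + d * (ip n (ratv l) x)\<^sup>2 - e * ip n (ratv l) (mv n a (ratv l))"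
  shows "0 \<le> c * ip n v v + d * (ip n v x)\<^sup>2 - e * ip n v (mv n a v)"
proof -
  obtain l where l: "\<And>i. i < n \<Longrightarrow> (\<lambda>k. ratv (l k) i) \<longlonglongrightarrow> v i" using ratv_dense by blast
  have "(\<lambda>k. c * ip n (ratv (l k)) (ratv (l k)) + d * (ip n (ratv (l k)) x)\<^sup>2 - e * ip n (ratv (l k)) (mv n a (ratv (l k)))) \<longlonglongrightarrow>
      c * ip n v v + d * (ip n v x)\<^sup>2 - e * ip n v (mv n a v)"
    unfolding ip_def mv_def by (intro tendsto_intros l) auto
  thus ?thesis by (rule LIMSEQ_le_const) (use assms in blast)
qed

lemma measurable_ip [measurable (raw)]:
  fixes u v :: "'a \<Rightarrow> nat \<Rightarrow> real"
  assumes "\<And>i. i < n \<Longrightarrow> (\<lambda>\<omega>. u \<omega> i) \<in> borel_measurable M" "\<And>i. i < n \<Longrightarrow> (\<lambda>\<omega>. v \<omega> i) \<in> borel_measurable M"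
  shows "(\<lambda>\<omega>. ip n (u \<omega>) (v \<omega>)) \<in> borel_measurable M"
  unfolding ip_def using assms by (intro borel_measurable_sum borel_measurable_times) auto

lemma measurable_mv [measurable (raw)]:
  fixes a :: "'a \<Rightarrow> nat \<Rightarrow> nat \<Rightarrow> real"
  assumes "\<And>j. j < n \<Longrightarrow> (\<lambda>\<omega>. a \<omega> i j) \<in> borel_measurable M" "\<And>j. j < n \<Longrightarrow> (\<lambda>\<omega>. u \<omega> j) \<in> borel_measurable M"
  shows "(\<lambda>\<omega>. mv n (a \<omega>) (u \<omega>) i) \<in> borel_measurable M"
  unfolding mv_def using assms by (intro borel_measurable_sum borel_measurable_times) auto

lemma measurable_lambda_max:
  fixes a :: "'a \<Rightarrow> nat \<Rightarrow> nat \<Rightarrow> real"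
  assumes n: "n > 0" and sym: "\<And>\<omega> i j. a \<omega> i j = a \<omega> j i"
    and meas: "\<And>i j. i < n \<Longrightarrow> j < n \<Longrightarrow> (\<lambda>\<omega>. a \<omega> i j) \<in> borel_measurable M"
  shows "(\<lambda>\<omega>. lambda_max (mat n n (\<lambda>(i, j). a \<omega> i j))) \<in> borel_measurable M"
  unfolding borel_measurable_iff_le
proof
  fix t
  have "{\<omega> \<in> space M. lambda_max (mat n n (\<lambda>(i, j). a \<omega> i j)) \<le> t} =
      {\<omega> \<in> space M. \<forall>l. ip n (ratv l) (mv n (a \<omega>) (ratv l)) \<le> t * ip n (ratv l) (ratv l)}"
  proof (intro Collect_cong conj_cong refl)
    fix \<omega>
    show "lambda_max (mat n n (\<lambda>(i, j). a \<omega> i j)) \<le> t \<longleftrightarrow>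
       (\<forall>l. ip n (ratv l) (mv n (a \<omega>) (ratv l)) \<le> t * ip n (ratv l) (ratv l))"
      unfolding lambda_max_le_iff[where n = n and a = "a \<omega>", OF n sym]
    proof (intro iffI allI)
      fix u assume l: "\<forall>l. ip n (ratv l) (mv n (a \<omega>) (ratv l)) \<le> t * ip n (ratv l) (ratv l)"
      have "0 \<le> t * ip n u u + 0 * (ip n u (\<lambda>_. 0))\<^sup>2 - 1 * ip n u (mv n (a \<omega>) u)"
        by (rule rat_nonneg_imp_nonneg) (use l in simp)
      thus "ip n u (mv n (a \<omega>) u) \<le> t * ip n u u" by simp
    qed blast
  qed
  also have "\<dots> \<in> sets M"
  proof -
    have "(\<lambda>\<omega>. ip n (ratv l) (mv n (a \<omega>) (ratv l))) \<in> borel_measurable M" for l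
      by (intro measurable_ip measurable_mv meas) auto
    thus ?thesis by measurable
  qed
  finally show "{\<omega> \<in> space M. lambda_max (mat n n (\<lambda>(i, j). a \<omega> i j)) \<le> t} \<in> sets M" .
qed

text \<open>By compactness, a bound for all top eigenvectors is equivalent to a penalised bound for all
  vectors, which by density only has to be checked on countably many of them.\<close>

lemma top_eigenvector_penalised:
  assumes max: "\<And>u. ip n u (mv n a u) \<le> \<mu> * ip n u u"
    and top: "\<And>u. ip n u u = 1 \<Longrightarrow> ip n u (mv n a u) = \<mu> \<Longrightarrow> (ip n u x)\<^sup>2 \<ge> c" and e: "\<epsilon> > 0"
  shows "\<exists>k :: nat. \<forall>v. (c - \<epsilon>) * ip n v v \<le> (ip n v x)\<^sup>2 + real k * (\<mu> * ip n v v - ip n v (mv n a v))"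
proof -
  let ?K = "{v :: nat \<Rightarrow> real. (\<forall>i\<ge>n. v i = 0) \<and> ip n v v = 1}"
  let ?g = "\<lambda>v :: nat \<Rightarrow> real. (ip n v x)\<^sup>2"
  let ?L = "?K \<inter> {v. ?g v \<le> c - \<epsilon>}"
  have "closed {v. ?g v \<le> c - \<epsilon>}"
    by (intro closed_Collect_le continuous_intros continuous_ip)
  hence cL: "compact ?L" by (rule compact_Int_closed[OF compact_unit_sphere])
  have ch: "continuous_on ?L (\<lambda>v. \<mu> - ip n v (mv n a v))" by (intro continuous_intros continuous_qf)
  have unit: "\<exists>k :: nat. \<forall>u\<in>?K. c - \<epsilon> \<le> ?g u + real k * (\<mu> - ip n u (mv n a u))"
  proof (cases "?L = {}")
    case True
    show ?thesis
    proof (intro exI[of _ 0] ballI)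
      fix u assume "u \<in> ?K"
      hence "\<not> ?g u \<le> c - \<epsilon>" using True by blast
      thus "c - \<epsilon> \<le> ?g u + real 0 * (\<mu> - ip n u (mv n a u))" by simp
    qed
  next
    case False
    obtain u0 where u0: "u0 \<in> ?L" "\<And>u. u \<in> ?L \<Longrightarrow> \<mu> - ip n u0 (mv n a u0) \<le> \<mu> - ip n u (mv n a u)"
      by (rule bexE[OF continuous_attains_inf[OF cL False ch]]) (rule that, assumption, erule bspec)
    \<comment> \<open>The gap: on the compact set of badly aligned unit vectors the form stays below
      \<open>\<mu>\<close> by at least \<open>d\<close>, and \<open>d > 0\<close> because a vector
      attaining \<open>\<mu>\<close> there would contradict \<open>top\<close>. A large enough
      \<open>k\<close> then lets \<open>k * d\<close> outweigh
      \<open>c - \<epsilon>\<close>.\<close>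
    define d where "d = \<mu> - ip n u0 (mv n a u0)"
    have "d \<noteq> 0" using top[of u0] u0(1) e by (auto simp: d_def)
    moreover have "d \<ge> 0" using max[of u0] u0(1) by (auto simp: d_def)
    ultimately have d: "d > 0" by simp
    obtain k :: nat where k: "\<bar>c - \<epsilon>\<bar> / d \<le> real k" using real_arch_simple by blast
    show ?thesis
    proof (intro exI[of _ k] ballI)
      fix u assume u: "u \<in> ?K"
      have m: "\<mu> - ip n u (mv n a u) \<ge> 0" using max[of u] u by auto
      show "c - \<epsilon> \<le> ?g u + real k * (\<mu> - ip n u (mv n a u))"
      proof (cases "?g u \<le> c - \<epsilon>")
        case True
        have "\<bar>c - \<epsilon>\<bar> \<le> real k * d" using k d by (simp add: field_simps)
        also have "\<dots> \<le> real k * (\<mu> - ip n u (mv n a u))"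
          using u0(2)[of u] u True by (intro mult_left_mono) (auto simp: d_def)
        finally show ?thesis using zero_le_power2[of "ip n u x"] by linarith
      next
        case False
        have "0 \<le> real k * (\<mu> - ip n u (mv n a u))" using m by simp
        thus ?thesis using False by linarith
      qed
    qed
  qed
  then obtain k where k: "\<And>u. u \<in> ?K \<Longrightarrow> c - \<epsilon> \<le> ?g u + real k * (\<mu> - ip n u (mv n a u))" by blast
  show ?thesis
  proof (intro exI[of _ k] allI)
    fix v
    show "(c - \<epsilon>) * ip n v v \<le> (ip n v x)\<^sup>2 + real k * (\<mu> * ip n v v - ip n v (mv n a v))"
    proof (cases "ip n v v > 0")
      case True
      let ?u = "\<lambda>i. if i < n then v i / nrm n v else 0"
      note t = to_unit_sphere[OF True]
      have "c - \<epsilon> \<le> ?g ?u + real k * (\<mu> - ip n ?u (mv n a ?u))" by (rule k, unfold mem_Collect_eq, rule t(1))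
      hence "ip n v v * (c - \<epsilon>) \<le> ip n v v * (?g ?u + real k * (\<mu> - ip n ?u (mv n a ?u)))"
        using True by (intro mult_left_mono) auto
      also have "\<dots> = ip n v v * ?g ?u + real k * (\<mu> * ip n v v - ip n v v * ip n ?u (mv n a ?u))"
        by (simp only: distrib_left right_diff_distrib mult_ac)
      finally show ?thesis unfolding t(2)[of a] t(3)[of x] by (simp only: mult.commute)
    next
      case False
      hence z: "ip n v v = 0" using ip_self_nonneg[of n v] by simp
      have "0 \<le> real k * (\<mu> * ip n v v - ip n v (mv n a v))" using max[of v] by simp
      moreover have "(c - \<epsilon>) * ip n v v = 0" using z by simp
      ultimately show ?thesis using zero_le_power2[of "ip n v x"] by linarith
    qed
  qed
qed

text \<open>The quantifier over all unit vectors is traded for countable ones: the slack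
  \<open>1 / Suc i\<close>, the penalty \<open>k\<close> and the rational vector \<open>l\<close>.
  For the converse, the penalty vanishes at a unit top vector, and letting \<open>i\<close> grow
  removes the slack.\<close>

lemma sets_top_eigenvector:
  fixes a :: "'a \<Rightarrow> nat \<Rightarrow> nat \<Rightarrow> real"
  assumes n: "n > 0" and sym: "\<And>\<omega> i j. a \<omega> i j = a \<omega> j i"
    and meas: "\<And>i j. i < n \<Longrightarrow> j < n \<Longrightarrow> (\<lambda>\<omega>. a \<omega> i j) \<in> borel_measurable M"
    and x: "\<And>i. i < n \<Longrightarrow> (\<lambda>\<omega>. x \<omega> i) \<in> borel_measurable M"
  shows "{\<omega> \<in> space M. \<forall>u. ip n u u = 1 \<and> ip n u (mv n (a \<omega>) u) = lambda_max (mat n n (\<lambda>(i, j). a \<omega> i j)) \<longrightarrow>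
    (ip n u (x \<omega>))\<^sup>2 \<ge> c} \<in> sets M"
proof -
  let ?l = "\<lambda>\<omega>. lambda_max (mat n n (\<lambda>(i, j). a \<omega> i j))"
  let ?R = "\<lambda>\<omega> i k v. (c - 1 / real (Suc i)) * ip n v v \<le> (ip n v (x \<omega>))\<^sup>2 + real k * (?l \<omega> * ip n v v - ip n v (mv n (a \<omega>) v))"
  have eqv: "(\<forall>u. ip n u u = 1 \<and> ip n u (mv n (a \<omega>) u) = ?l \<omega> \<longrightarrow> (ip n u (x \<omega>))\<^sup>2 \<ge> c) \<longleftrightarrow>
      (\<forall>i :: nat. \<exists>k :: nat. \<forall>l. ?R \<omega> i k (ratv l))" for \<omega>
  proof
    assume *: "\<forall>u. ip n u u = 1 \<and> ip n u (mv n (a \<omega>) u) = ?l \<omega> \<longrightarrow> (ip n u (x \<omega>))\<^sup>2 \<ge> c"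
    show "\<forall>i :: nat. \<exists>k :: nat. \<forall>l. ?R \<omega> i k (ratv l)"
    proof
      fix i :: nat
      have "\<exists>k :: nat. \<forall>v. ?R \<omega> i k v"
      proof (rule top_eigenvector_penalised)
        show "ip n u (mv n (a \<omega>) u) \<le> ?l \<omega> * ip n u u" for u
          using lambda_max_attained[where n = n and a = "a \<omega>", OF n sym] by blast
        show "(ip n u (x \<omega>))\<^sup>2 \<ge> c" if "ip n u u = 1" "ip n u (mv n (a \<omega>) u) = ?l \<omega>" for u
          using * that by blast
      qed simp
      thus "\<exists>k :: nat. \<forall>l. ?R \<omega> i k (ratv l)" by blast
    qed
  next
    assume *: "\<forall>i :: nat. \<exists>k :: nat. \<forall>l. ?R \<omega> i k (ratv l)"
    show "\<forall>u. ip n u u = 1 \<and> ip n u (mv n (a \<omega>) u) = ?l \<omega> \<longrightarrow> (ip n u (x \<omega>))\<^sup>2 \<ge> c"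
    proof (intro allI impI)
      fix u assume u: "ip n u u = 1 \<and> ip n u (mv n (a \<omega>) u) = ?l \<omega>"
      have i: "c - 1 / real (Suc i) \<le> (ip n u (x \<omega>))\<^sup>2" for i
      proof -
        obtain k where k: "\<And>l. ?R \<omega> i k (ratv l)" using * by blast
        have "0 \<le> (real k * ?l \<omega> - (c - 1 / real (Suc i))) * ip n u u + 1 * (ip n u (x \<omega>))\<^sup>2 - real k * ip n u (mv n (a \<omega>) u)"
        proof (rule rat_nonneg_imp_nonneg)
          fix l
          show "0 \<le> (real k * ?l \<omega> - (c - 1 / real (Suc i))) * ip n (ratv l) (ratv l) + 1 * (ip n (ratv l) (x \<omega>))\<^sup>2 -
            real k * ip n (ratv l) (mv n (a \<omega>) (ratv l))"
            using k[of l] by (simp only: left_diff_distrib right_diff_distrib mult_1 mult.assoc)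
        qed
        thus ?thesis using u by simp
      qed
      have "(\<lambda>i. c - 1 / real (Suc i)) \<longlonglongrightarrow> c - 0"
        by (intro tendsto_intros LIMSEQ_inverse_real_of_nat[unfolded inverse_eq_divide])
      hence "(\<lambda>i. c - 1 / real (Suc i)) \<longlonglongrightarrow> c" by simp
      thus "(ip n u (x \<omega>))\<^sup>2 \<ge> c" by (rule LIMSEQ_le_const2) (use i in blast)
    qed
  qed
  have "{\<omega> \<in> space M. \<forall>i :: nat. \<exists>k :: nat. \<forall>l. ?R \<omega> i k (ratv l)} \<in> sets M"
  proof -
    have 1: "(\<lambda>\<omega>. ip n (ratv l) (mv n (a \<omega>) (ratv l))) \<in> borel_measurable M" for l
      by (intro measurable_ip measurable_mv meas) auto
    have 2: "(\<lambda>\<omega>. ip n (ratv l) (x \<omega>)) \<in> borel_measurable M" for l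
      by (intro measurable_ip x) auto
    have 3: "?l \<in> borel_measurable M" by (rule measurable_lambda_max[where a = a and n = n, OF n sym meas])
    show ?thesis using 1 2 3 by measurable
  qed
  thus ?thesis unfolding eqv .
qed

section \<open>Truncated scores\<close>

lemma prod_step_wt: "(\<Prod>i<Suc (Suc k). step_wt s B n i) = s\<^sup>2 / real n * B ^ k"
proof (induction k)
  case 0
  show ?case by (simp add: lessThan_Suc power2_eq_square)
next
  case (Suc k)
  show ?case unfolding prod.lessThan_Suc[of _ "Suc (Suc k)"] Suc by simp
qed

context score_model
begin

definition Fi :: real where "Fi = fisher_info P p"

lemma Fi_pos: "Fi > 0" using fisher_info_pos by (simp add: Fi_def)

definition M5 :: real where "M5 = (LINT w|P. \<bar>f w\<bar> ^ 5)"

lemma integrable_f5: "integrable P (\<lambda>w. \<bar>f w\<bar> ^ 5)"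
  using integrable_score(1)[of 5] by (simp add: power_abs[symmetric] integrable_abs)

definition tail :: "real \<Rightarrow> real \<Rightarrow> real" where
  "tail T w = (if \<bar>f w\<bar> \<le> T then 0 else 1)"

lemma measurable_tail [measurable]: "tail T \<in> borel_measurable borel"
  unfolding tail_def[abs_def] by measurable

text \<open>Markov's inequality in pointwise form with the fifth power. The cases
  \<open>k = 0, 1, 2\<close> control the number of altered entries, the shift of the mean and the
  loss of variance.\<close>

lemma tail_le:
  assumes T: "T > 0" and k: "k \<le> 5"
  shows "\<bar>f w\<bar> ^ k * tail T w \<le> \<bar>f w\<bar> ^ 5 / T ^ (5 - k)"
proof (cases "\<bar>f w\<bar> \<le> T")
  case True
  then show ?thesis using T by (simp add: tail_def)
next
  case False
  hence "T ^ (5 - k) \<le> \<bar>f w\<bar> ^ (5 - k)" using T by (intro power_mono) auto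
  hence "\<bar>f w\<bar> ^ k * T ^ (5 - k) \<le> \<bar>f w\<bar> ^ k * \<bar>f w\<bar> ^ (5 - k)" by (intro mult_left_mono) auto
  also have "\<dots> = \<bar>f w\<bar> ^ 5" using k by (simp add: power_add[symmetric])
  finally show ?thesis using False T by (simp add: tail_def field_simps)
qed

lemma integrable_tail:
  assumes T: "T > 0" and k: "k \<le> 5"
  shows "integrable P (\<lambda>w. \<bar>f w\<bar> ^ k * tail T w)" "(LINT w|P. \<bar>f w\<bar> ^ k * tail T w) \<le> M5 / T ^ (5 - k)"
proof -
  have i: "integrable P (\<lambda>w. \<bar>f w\<bar> ^ 5 / T ^ (5 - k))" using integrable_f5 by simp
  have nn: "\<bar>f w\<bar> ^ k * tail T w \<ge> 0" for w by (simp add: tail_def)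
  show 1: "integrable P (\<lambda>w. \<bar>f w\<bar> ^ k * tail T w)"
  proof (rule Bochner_Integration.integrable_bound[OF i])
    show "(\<lambda>w. \<bar>f w\<bar> ^ k * tail T w) \<in> borel_measurable P" by (rule measurable_P) measurable
    show "AE w in P. norm (\<bar>f w\<bar> ^ k * tail T w) \<le> norm (\<bar>f w\<bar> ^ 5 / T ^ (5 - k))"
    proof (rule AE_I2)
      fix w
      have "norm (\<bar>f w\<bar> ^ k * tail T w) = \<bar>f w\<bar> ^ k * tail T w" using nn by (simp only: real_norm_def abs_of_nonneg)
      also have "\<dots> \<le> \<bar>f w\<bar> ^ 5 / T ^ (5 - k)" by (rule tail_le[OF T k])
      also have "\<dots> \<le> norm (\<bar>f w\<bar> ^ 5 / T ^ (5 - k))" unfolding real_norm_def by (rule abs_ge_self)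
      finally show "norm (\<bar>f w\<bar> ^ k * tail T w) \<le> norm (\<bar>f w\<bar> ^ 5 / T ^ (5 - k))" .
    qed
  qed
  have "(LINT w|P. \<bar>f w\<bar> ^ k * tail T w) \<le> (LINT w|P. \<bar>f w\<bar> ^ 5 / T ^ (5 - k))"
    by (rule integral_mono[OF 1 i tail_le[OF T k]])
  thus "(LINT w|P. \<bar>f w\<bar> ^ k * tail T w) \<le> M5 / T ^ (5 - k)" by (simp add: M5_def)
qed

definition trunc :: "real \<Rightarrow> real \<Rightarrow> real" where
  "trunc T w = f w * (1 - tail T w)"

lemma measurable_trunc [measurable]: "trunc T \<in> borel_measurable borel"
  unfolding trunc_def[abs_def] by measurable

lemma trunc_le: "T \<ge> 0 \<Longrightarrow> \<bar>trunc T w\<bar> \<le> T"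
  by (simp add: trunc_def tail_def)

lemma integrable_bounded_P:
  fixes g :: "real \<Rightarrow> real"
  assumes "g \<in> borel_measurable borel" "\<And>w. \<bar>g w\<bar> \<le> D"
  shows "integrable P g"
  by (rule integrable_const_bound[of _ D]) (use assms measurable_P in auto)

definition tmean :: "real \<Rightarrow> real" where "tmean T = (LINT w|P. trunc T w)"

lemma tmean_le: "T \<ge> 0 \<Longrightarrow> \<bar>tmean T\<bar> \<le> T"
proof -
  assume T: "T \<ge> 0"
  have "\<bar>tmean T\<bar> \<le> (LINT w|P. \<bar>trunc T w\<bar>)" unfolding tmean_def by (rule integral_abs_bound)
  also have "\<dots> \<le> (LINT w|P. T)"
    by (rule integral_mono) (use trunc_le[OF T] in \<open>auto intro!: integrable_bounded_P[of _ T]\<close>)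
  also have "\<dots> = T" by (simp add: prob_space)
  finally show ?thesis .
qed

text \<open>As \<open>f\<close> has mean 0, the mean of the kept part is minus the mean of the part
  cut off.\<close>

lemma tmean_small: "T > 0 \<Longrightarrow> \<bar>tmean T\<bar> \<le> M5 / T ^ 4"
proof -
  assume T: "T > 0"
  have m: "(\<lambda>w. f w * tail T w) \<in> borel_measurable P" by (rule measurable_P) measurable
  have i1: "integrable P (\<lambda>w. \<bar>f w\<bar> ^ 1 * tail T w)" using integrable_tail(1)[OF T, of 1] by simp
  have i2: "integrable P (\<lambda>w. f w * tail T w)"
    by (rule Bochner_Integration.integrable_bound[OF i1 m]) (simp add: abs_mult)
  have f: "integrable P f" using integrable_score(1)[of 1] by simp
  have "tmean T = (LINT w|P. f w - f w * tail T w)" by (simp add: tmean_def trunc_def algebra_simps)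
  also have "\<dots> = - (LINT w|P. f w * tail T w)" using f i2 mean_score by simp
  finally have "\<bar>tmean T\<bar> = \<bar>LINT w|P. f w * tail T w\<bar>" by simp
  also have "\<dots> \<le> (LINT w|P. \<bar>f w * tail T w\<bar>)" by (rule integral_abs_bound)
  also have "(\<lambda>w. \<bar>f w * tail T w\<bar>) = (\<lambda>w. \<bar>f w\<bar> ^ 1 * tail T w)" by (auto simp: tail_def)
  also have "(LINT w|P. \<bar>f w\<bar> ^ 1 * tail T w) \<le> M5 / T ^ (5 - 1)" by (rule integrable_tail[OF T]) simp
  finally show ?thesis by simp
qed

text \<open>Truncating and centring both lower the second moment, which gives the one-sided bound
  \<open>Fi\<close> without an error term.\<close>

lemma variance_trunc:
  assumes T: "T > 0"
  shows "(LINT w|P. (trunc T w - tmean T)\<^sup>2) \<le> Fi"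
    and "\<bar>(LINT w|P. (trunc T w - tmean T)\<^sup>2) - Fi\<bar> \<le> M5 / T ^ 3 + (M5 / T ^ 4)\<^sup>2"
proof -
  have t1: "integrable P (trunc T)" by (rule integrable_bounded_P[OF measurable_trunc trunc_le]) (use T in simp)
  have t2: "integrable P (\<lambda>w. (trunc T w)\<^sup>2)"
  proof (rule integrable_bounded_P)
    show "\<bar>(trunc T w)\<^sup>2\<bar> \<le> T\<^sup>2" for w using power_mono[OF trunc_le, of T w 2] T by simp
  qed measurable
  have f2: "integrable P (\<lambda>w. (f w)\<^sup>2)" using integrable_score(1)[of 2] by simp
  have ft: "integrable P (\<lambda>w. \<bar>f w\<bar> ^ 2 * tail T w)" using integrable_tail(1)[OF T, of 2] by simp
  have eq: "(trunc T w)\<^sup>2 = (f w)\<^sup>2 - \<bar>f w\<bar> ^ 2 * tail T w" for w by (simp add: trunc_def tail_def)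
  have "(LINT w|P. (trunc T w - tmean T)\<^sup>2) = (LINT w|P. (trunc T w)\<^sup>2 - 2 * tmean T * trunc T w + (tmean T)\<^sup>2)"
    by (simp add: power2_eq_square algebra_simps)
  also have "\<dots> = (LINT w|P. (trunc T w)\<^sup>2) - (tmean T)\<^sup>2"
    using t1 t2 by (simp add: prob_space tmean_def[symmetric] power2_eq_square)
  also have "(LINT w|P. (trunc T w)\<^sup>2) = Fi - (LINT w|P. \<bar>f w\<bar> ^ 2 * tail T w)"
    unfolding eq Fi_def fisher_info_def by (rule Bochner_Integration.integral_diff[OF f2 ft])
  finally have main: "(LINT w|P. (trunc T w - tmean T)\<^sup>2) = Fi - (LINT w|P. \<bar>f w\<bar> ^ 2 * tail T w) - (tmean T)\<^sup>2" .
  have a: "(LINT w|P. \<bar>f w\<bar> ^ 2 * tail T w) \<ge> 0" by (rule integral_nonneg_AE) (simp add: tail_def)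
  have b: "(LINT w|P. \<bar>f w\<bar> ^ 2 * tail T w) \<le> M5 / T ^ 3" using integrable_tail(2)[OF T, of 2] by simp
  have c: "(tmean T)\<^sup>2 \<le> (M5 / T ^ 4)\<^sup>2" using power_mono[OF tmean_small[OF T], of 2] by simp
  show "(LINT w|P. (trunc T w - tmean T)\<^sup>2) \<le> Fi" using main a zero_le_power2[of "tmean T"] by linarith
  show "\<bar>(LINT w|P. (trunc T w - tmean T)\<^sup>2) - Fi\<bar> \<le> M5 / T ^ 3 + (M5 / T ^ 4)\<^sup>2"
    using main a b c zero_le_power2[of "tmean T"] by linarith
qed

section \<open>The rescaled, truncated and centred noise entries\<close>

definition Tn :: "nat \<Rightarrow> real" where "Tn n = real n powr (9/20)"
definition xi :: "nat \<Rightarrow> real \<Rightarrow> real" where "xi n w = (trunc (Tn n) w - tmean (Tn n)) / sqrt (real n)"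
text \<open>Twice the truncation level, since centring may add as much again. The result is of order
  \<open>n^(-1/20)\<close>.\<close>

definition Bn :: "nat \<Rightarrow> real" where "Bn n = 2 * Tn n / sqrt (real n)"
definition vn :: "nat \<Rightarrow> real" where "vn n = (LINT w|P. (xi n w)\<^sup>2)"
definition sg :: real where "sg = sqrt Fi"

lemma sg: "sg > 0" "sg\<^sup>2 = Fi" using Fi_pos by (simp_all add: sg_def)

lemma Tn_pos: "n > 0 \<Longrightarrow> Tn n > 0" by (simp add: Tn_def)
lemma Bn_nonneg: "Bn n \<ge> 0" by (simp add: Bn_def Tn_def)

lemma measurable_xi [measurable]: "xi n \<in> borel_measurable borel"
  unfolding xi_def[abs_def] by measurable

lemma xi_le: "\<bar>xi n w\<bar> \<le> Bn n"
proof -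
  have T: "Tn n \<ge> 0" by (simp add: Tn_def)
  have "\<bar>trunc (Tn n) w - tmean (Tn n)\<bar> \<le> 2 * Tn n" using trunc_le[OF T, of w] tmean_le[OF T] by linarith
  hence "\<bar>trunc (Tn n) w - tmean (Tn n)\<bar> / sqrt (real n) \<le> 2 * Tn n / sqrt (real n)" by (rule divide_right_mono) simp
  thus ?thesis by (simp add: xi_def Bn_def)
qed

lemma integrable_xi: "integrable P (\<lambda>w. xi n w ^ k)"
proof (rule integrable_bounded_P)
  show "\<bar>xi n w ^ k\<bar> \<le> Bn n ^ k" for w unfolding power_abs by (intro power_mono xi_le) simp
qed measurable

lemma mean_xi: "(LINT w|P. xi n w) = 0"
proof -
  have T: "Tn n \<ge> 0" by (simp add: Tn_def)
  have "integrable P (trunc (Tn n))" by (rule integrable_bounded_P[OF measurable_trunc trunc_le[OF T]])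
  thus ?thesis unfolding xi_def by (simp add: prob_space tmean_def)
qed

lemma vn_eq: "n > 0 \<Longrightarrow> real n * vn n = (LINT w|P. (trunc (Tn n) w - tmean (Tn n))\<^sup>2)"
  unfolding vn_def xi_def power_divide by simp

lemma vn_le: "n > 0 \<Longrightarrow> vn n \<le> (sg / sqrt (real n))\<^sup>2"
  using variance_trunc(1)[OF Tn_pos, of n] vn_eq[of n] by (simp add: power_divide sg(2) field_simps)

lemma moment_xi: "\<bar>LINT w|P. xi n w ^ (k + 2)\<bar> \<le> vn n * Bn n ^ k"
proof -
  have "\<bar>LINT w|P. xi n w ^ (k + 2)\<bar> \<le> (LINT w|P. \<bar>xi n w ^ (k + 2)\<bar>)" by (rule integral_abs_bound)
  also have "\<dots> \<le> (LINT w|P. Bn n ^ k * (xi n w)\<^sup>2)"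
  proof (rule integral_mono)
    show "integrable P (\<lambda>w. \<bar>xi n w ^ (k + 2)\<bar>)" by (intro integrable_abs integrable_xi)
    show "integrable P (\<lambda>w. Bn n ^ k * (xi n w)\<^sup>2)" by (intro integrable_mult_right integrable_xi)
    fix w
    have "\<bar>xi n w ^ (k + 2)\<bar> = \<bar>xi n w\<bar> ^ k * (xi n w)\<^sup>2" 
      by (simp only: power_add abs_mult power_abs power2_abs)
    also have "\<dots> \<le> Bn n ^ k * (xi n w)\<^sup>2" by (intro mult_right_mono power_mono xi_le) auto
    finally show "\<bar>xi n w ^ (k + 2)\<bar> \<le> Bn n ^ k * (xi n w)\<^sup>2" .
  qed
  also have "\<dots> = vn n * Bn n ^ k" by (simp add: vn_def)
  finally show ?thesis .
qed

lemma moment_xi_le: "n > 0 \<Longrightarrow> \<bar>LINT w|P. xi n w ^ (k + 2)\<bar> \<le> (sg / sqrt (real n))\<^sup>2 * Bn n ^ k"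
  using moment_xi[of n k] mult_right_mono[OF vn_le[of n] zero_le_power[OF Bn_nonneg[of n], of k]] by linarith

lemma centred_xi: "n > 0 \<Longrightarrow> centred_entry P (xi n) (vn n) (sg / sqrt (real n)) (Bn n)"
proof unfold_locales
  assume n: "n > 0"
  have e3: "1 + 2 = (3::nat)" and e4: "2 + 2 = (4::nat)" by simp_all
  show "integrable P (\<lambda>w. xi n w ^ k)" for k by (rule integrable_xi)
  show "(LINT w|P. xi n w) = 0" by (rule mean_xi)
  show "(LINT w|P. xi n w ^ 2) = vn n" by (simp add: vn_def)
  show "vn n \<le> (sg / sqrt (real n))\<^sup>2" by (rule vn_le[OF n])
  show "\<bar>LINT w|P. xi n w ^ 3\<bar> \<le> (sg / sqrt (real n))\<^sup>2 * Bn n"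
    using moment_xi_le[OF n, of 1] by (simp only: e3 power_one_right)
  show "(LINT w|P. xi n w ^ 4) \<le> (sg / sqrt (real n))\<^sup>2 * (Bn n)\<^sup>2"
    using moment_xi_le[OF n, of 2] unfolding e4 by linarith
  show "sg / sqrt (real n) \<ge> 0" using sg by simp
  show "Bn n \<ge> 0" by (rule Bn_nonneg)
qed

lemma step_bound_xi: "n > 0 \<Longrightarrow> \<bar>LINT w|P. xi n w ^ k\<bar> \<le> (\<Prod>i<k. step_wt sg (Bn n) n i)"
proof -
  assume n: "n > 0"
  consider "k = 0" | "k = 1" | l where "k = l + 2" by (cases k; cases "k - 1") auto
  thus ?thesis
  proof cases
    case 1
    then show ?thesis by (simp add: prob_space)
  next
    case 2
    then show ?thesis using mean_xi[of n] sg by simp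
  next
    case 3
    have "(sg / sqrt (real n))\<^sup>2 = sg\<^sup>2 / real n" by (simp add: power_divide)
    thus ?thesis using moment_xi_le[OF n, of l] prod_step_wt[where k = l and s = sg and B = "Bn n" and n = n]
      unfolding 3 by (simp del: prod.lessThan_Suc)
  qed
qed

text \<open>The factor \<open>n - k\<close> is the number of vertices available to a backtracking
  step, as counted in \<open>mv_kry_Suc\<close>. Losing \<open>k\<close> of them does not affect the
  limit.\<close>

lemma vn_limit: "(\<lambda>n. vn n * real (n - k)) \<longlonglongrightarrow> Fi"
proof -
  have b: "\<bar>real n * vn n - Fi\<bar> \<le> M5 / Tn n ^ 3 + (M5 / Tn n ^ 4)\<^sup>2" if "n > 0" for n
    using variance_trunc(2)[OF Tn_pos[OF that]] vn_eq[OF that] by simp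
  have a: "(\<lambda>n. 1 / Tn n ^ 3) \<longlonglongrightarrow> 0" "(\<lambda>n. 1 / Tn n ^ 4) \<longlonglongrightarrow> 0"
    unfolding Tn_def by real_asymp+
  have "(\<lambda>n. M5 * (1 / Tn n ^ 3) + (M5 * (1 / Tn n ^ 4))\<^sup>2) \<longlonglongrightarrow> M5 * 0 + (M5 * 0)\<^sup>2"
    by (intro tendsto_add tendsto_mult tendsto_power tendsto_const a)
  hence l: "(\<lambda>n. M5 / Tn n ^ 3 + (M5 / Tn n ^ 4)\<^sup>2) \<longlonglongrightarrow> 0" by simp
  have "(\<lambda>n. real n * vn n - Fi) \<longlonglongrightarrow> 0"
    by (rule Lim_null_comparison[OF _ l], use eventually_gt_at_top[of 0] in eventually_elim) (simp add: b)
  hence 1: "(\<lambda>n. real n * vn n) \<longlonglongrightarrow> Fi" by (rule LIM_zero_cancel)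
  have 2: "(\<lambda>n. real (n - k) / real n) \<longlonglongrightarrow> 1"
  proof (rule Lim_transform_eventually)
    show "(\<lambda>n. (real n - real k) / real n) \<longlonglongrightarrow> 1" by real_asymp
    show "eventually (\<lambda>n. (real n - real k) / real n = real (n - k) / real n) sequentially"
      using eventually_ge_at_top[of k] by eventually_elim (simp add: of_nat_diff)
  qed
  have "(\<lambda>n. (real n * vn n) * (real (n - k) / real n)) \<longlonglongrightarrow> Fi * 1" by (intro tendsto_mult 1 2)
  moreover have "eventually (\<lambda>n. (real n * vn n) * (real (n - k) / real n) = vn n * real (n - k)) sequentially"
    using eventually_gt_at_top[of 0] by eventually_elim simp
  ultimately show ?thesis by (simp add: Lim_transform_eventually)
qed

end

section \<open>The spiked model\<close>

text \<open>By symmetry each diagonal entry is a sum of squares. Nonnegativity is what allows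
  Markov's inequality to be applied to the trace.\<close>

lemma trace_even_power_nonneg:
  assumes H: "\<And>i j. H i j = H j i"
  shows "(\<Sum>i<n. hp n H (2 * N) i i) \<ge> 0"
proof (rule sum_nonneg)
  fix i assume "i \<in> {..<n}"
  hence i: "i < n" by simp
  have "hp n H (2 * N) i i = (\<Sum>l<n. hp n H N i l * hp n H N l i)" unfolding mult_2 by (rule hp_add[OF i i])
  also have "\<dots> = (\<Sum>l<n. hp n H N i l * hp n H N i l)"
  proof (rule sum.cong)
    fix l assume "l \<in> {..<n}"
    hence "hp n H N l i = hp n H N i l" by (intro hp_symmetric H i) simp
    thus "hp n H N i l * hp n H N l i = hp n H N i l * hp n H N i l" by (rule arg_cong)
  qed simp
  also have "\<dots> \<ge> 0" by (rule sum_nonneg) simp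
  finally show "hp n H (2 * N) i i \<ge> 0" .
qed

text \<open>The square of the logarithm exceeds every fixed multiple of \<open>ln n\<close>, so one
  exponent serves all ratios \<open>\<rho> < 1\<close>: the power is eventually at most
  \<open>n^(-2)\<close>.\<close>

lemma tendsto_le_power_log:
  fixes \<rho> :: real
  assumes \<rho>: "0 < \<rho>" "\<rho> < 1"
  shows "(\<lambda>n. real n * \<rho> ^ nat \<lceil>(ln (real n))\<^sup>2\<rceil>) \<longlonglongrightarrow> 0"
proof -
  define c where "c = - ln \<rho>"
  have c: "c > 0" using \<rho> by (simp add: c_def)
  have "filterlim (\<lambda>n. ln (real n)) at_top sequentially" by real_asymp
  hence "eventually (\<lambda>n. ln (real n) \<ge> 2 / c) sequentially" by (simp add: filterlim_at_top)
  hence "eventually (\<lambda>n. norm (real n * \<rho> ^ nat \<lceil>(ln (real n))\<^sup>2\<rceil>) \<le> 1 / real n) sequentially"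
    using eventually_gt_at_top[of 0]
  proof eventually_elim
    case (elim n)
    let ?L = "ln (real n)"
    have L: "?L \<ge> 0" using elim by simp
    have "?L\<^sup>2 \<le> real (nat \<lceil>?L\<^sup>2\<rceil>)" by (rule real_nat_ceiling_ge)
    moreover have "2 * ?L \<le> c * ?L\<^sup>2"
    proof -
      have "2 \<le> c * ?L" using elim(1) c by (simp add: field_simps)
      hence "2 * ?L \<le> c * ?L * ?L" using L by (rule mult_right_mono)
      thus ?thesis by (simp add: power2_eq_square)
    qed
    moreover have "c * ?L\<^sup>2 \<le> c * real (nat \<lceil>?L\<^sup>2\<rceil>)" using calculation(1) c by (intro mult_left_mono) auto
    ultimately have le: "- (c * real (nat \<lceil>?L\<^sup>2\<rceil>)) \<le> - (2 * ?L)" by linarith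
    have "\<rho> ^ k = exp (- (c * real k))" for k
      using exp_of_nat_mult[of k "ln \<rho>"] \<rho>(1) by (simp add: c_def mult.commute)
    hence "\<rho> ^ nat \<lceil>?L\<^sup>2\<rceil> = exp (- (c * real (nat \<lceil>?L\<^sup>2\<rceil>)))" .
    also have "\<dots> \<le> exp (- (2 * ?L))" using le by simp
    also have "\<dots> = 1 / (real n)\<^sup>2"
      using elim(2) by (simp add: exp_minus exp_double inverse_eq_divide)
    finally have "real n * \<rho> ^ nat \<lceil>?L\<^sup>2\<rceil> \<le> real n * (1 / (real n)\<^sup>2)" by (rule mult_left_mono) simp
    also have "\<dots> = 1 / real n" using elim(2) by (simp add: power2_eq_square)
    finally show ?case using \<rho> by simp
  qed
  thus ?thesis by (rule Lim_null_comparison) (rule lim_1_over_n)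
qed

lemma power_div_sqrt: "((a / sqrt (real n)) ^ k)\<^sup>2 = (a ^ k)\<^sup>2 / real n ^ k"
proof -
  have c: "(y ^ k)\<^sup>2 = (y\<^sup>2) ^ k" for y :: real by (simp only: power_mult[symmetric] mult.commute)
  have "(a / sqrt (real n))\<^sup>2 = a\<^sup>2 / real n" by (simp add: power_divide)
  thus ?thesis unfolding c by (simp add: power_divide)
qed

locale spiked_model = score_model P p m C for P p m C +
  fixes lam alpha :: real and X :: "nat \<Rightarrow> (nat \<Rightarrow> real) measure"
  assumes lam: "lam \<ge> 0" and prior: "spike_prior X"
    and deloc: "alpha < 1/32" "whp X (\<lambda>n x. \<forall>i<n. \<bar>x i\<bar> \<le> real n powr (- 1/2 + alpha))"
begin

abbreviation Om :: "nat \<Rightarrow> ((nat \<Rightarrow> real) \<times> (nat \<times> nat \<Rightarrow> real)) measure" where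
  "Om n \<equiv> wig_space n P (X n)"

lemma Om_eq: "Om n = X n \<Otimes>\<^sub>M noise n P"
  by (simp add: wig_space_def edges_def)

lemma X_prob: "prob_space (X n)" and X_sets: "sets (X n) = sets (Pi\<^sub>M {..<n} (\<lambda>_. borel))"
  using prior by (auto simp: spike_prior_def)

lemma noise_prob: "prob_space (noise n P)"
  by (rule prob_space_PiM) (rule prob(1))

lemma Om_prob: "prob_space (Om n)"
  unfolding Om_eq by (rule prob_space_pair[OF X_prob noise_prob])

abbreviation Gf :: "(nat \<times> (nat \<Rightarrow> real) \<times> (nat \<times> nat \<Rightarrow> real)) filter" where
  "Gf \<equiv> whp_filter (\<lambda>n. wig_space n P (X n))"

lemma lift_X:
  assumes "eventually (\<lambda>(n, x). Q n x) (whp_filter X)"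
  shows "eventually (\<lambda>(n, \<omega>). Q n (fst \<omega>)) Gf"
proof -
  obtain E where E: "\<And>n. E n \<in> sets (X n)" "\<And>n x. x \<in> E n \<Longrightarrow> Q n x" "(\<lambda>n. measure (X n) (E n)) \<longlonglongrightarrow> 1"
    using assms unfolding eventually_whp_filter[where M = X, OF X_prob] by auto
  show ?thesis
  proof (rule eventually_whp_filterI[OF Om_prob])
    let ?E = "\<lambda>n. E n \<times> space (noise n P)"
    show "?E n \<in> sets (Om n)" for n unfolding Om_eq using E(1) by auto
    show "case (n, \<omega>) of (n, \<omega>) \<Rightarrow> Q n (fst \<omega>)" if "\<omega> \<in> ?E n" for n \<omega> using that E(2) by auto
    have "measure (Om n) (?E n) = measure (X n) (E n)" for n
    proof -
      interpret N: prob_space "noise n P" by (rule noise_prob)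
      have "emeasure (Om n) (?E n) = emeasure (X n) (E n)"
        unfolding Om_eq by (subst N.emeasure_pair_measure_Times) (use E(1) N.emeasure_space_1 in auto)
      thus ?thesis by (simp add: measure_def)
    qed
    thus "(\<lambda>n. measure (Om n) (?E n)) \<longlonglongrightarrow> 1" using E(3) by simp
  qed
qed

lemma measurable_x: "i < n \<Longrightarrow> (\<lambda>\<omega>. fst \<omega> i) \<in> borel_measurable (Om n)"
proof -
  assume i: "i < n"
  have "(\<lambda>x. x i) \<in> borel_measurable (Pi\<^sub>M {..<n} (\<lambda>_. borel :: real measure))"
    by (rule measurable_component_singleton) (use i in simp)
  hence "(\<lambda>x. x i) \<in> borel_measurable (X n)" using measurable_cong_sets[OF X_sets refl] by blast
  thus ?thesis unfolding Om_eq by (rule measurable_compose[OF measurable_fst])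
qed

lemma measurable_W:
  assumes "e \<in> edges n" "g \<in> borel_measurable borel"
  shows "(\<lambda>\<omega>. g (snd \<omega> e)) \<in> borel_measurable (Om n)"
proof -
  have "(\<lambda>W. W e) \<in> measurable (noise n P) P" by (rule measurable_component_singleton[OF assms(1)])
  hence "(\<lambda>W. g (W e)) \<in> borel_measurable (noise n P)"
    using measurable_P[OF assms(2)] by (rule measurable_compose)
  thus ?thesis unfolding Om_eq by (rule measurable_compose[OF measurable_snd])
qed

lemma measurable_entry:
  assumes "i < n" "j < n" "g \<in> borel_measurable borel"
  shows "(\<lambda>\<omega>. entry g (snd \<omega>) i j) \<in> borel_measurable (Om n)"
proof (cases "i = j")
  case False
  thus ?thesis unfolding entry_def using measurable_W[OF edge_in_edges[OF False assms(1,2)] assms(3)] by simp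
qed (simp add: entry_def)

lemma measurable_hp:
  assumes "i < n" "j < n" "g \<in> borel_measurable borel"
  shows "(\<lambda>\<omega>. hp n (entry g (snd \<omega>)) r i j) \<in> borel_measurable (Om n)"
  using assms(1)
proof (induction r arbitrary: i)
  case (Suc r)
  show ?case
    unfolding hp.simps
    by (intro borel_measurable_sum borel_measurable_times Suc.IH measurable_entry Suc.prems assms(3)) auto
qed simp

lemma measurable_wprod:
  assumes g: "g \<in> borel_measurable borel"
  shows "set w \<subseteq> {..<n} \<Longrightarrow> (\<lambda>\<omega>. wprod (entry g (snd \<omega>)) w) \<in> borel_measurable (Om n)"
proof (induction w rule: induct_list012)
  case (3 x y zs)
  show ?case
    unfolding wprod.simps by (intro borel_measurable_times 3(2) measurable_entry g) (use 3(3) in auto)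
qed auto

lemma measurable_psi: "g \<in> borel_measurable borel \<Longrightarrow> psi g v k \<in> borel_measurable borel"
proof -
  assume [measurable]: "g \<in> borel_measurable borel"
  consider "k = 0" | "k = 1" | l where "k = Suc (Suc l)" by (cases k; cases "k - 1") auto
  thus ?thesis
  proof cases
    case 1
    have "psi g v k = (\<lambda>_. 1)" by (rule ext) (simp add: 1)
    thus ?thesis by simp
  next
    case 2
    have "psi g v k = g" by (rule ext) (simp add: 2)
    thus ?thesis by simp
  next
    case 3
    have "psi g v k = (\<lambda>w. g w ^ 2 - v)" by (rule ext) (simp add: 3)
    thus ?thesis by simp
  qed
qed

lemma measurable_Psi:
  assumes "g \<in> borel_measurable borel"
  shows "(\<lambda>\<omega>. Psi n g v w (snd \<omega>)) \<in> borel_measurable (Om n)"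
  unfolding Psi_def by (intro borel_measurable_prod measurable_W measurable_psi assms)

lemma measurable_kry:
  assumes "i < n" "g \<in> borel_measurable borel"
  shows "(\<lambda>\<omega>. kry n (entry g (snd \<omega>)) (fst \<omega>) k i) \<in> borel_measurable (Om n)"
  unfolding kry_def
proof (rule borel_measurable_sum)
  fix w assume "w \<in> paths n k"
  note w = pathsD[OF this]
  have "(\<lambda>\<omega>. wprod (entry g (snd \<omega>)) w * fst \<omega> (last w)) \<in> borel_measurable (Om n)"
    by (intro borel_measurable_times measurable_wprod assms measurable_x) (use w in auto)
  thus "(\<lambda>\<omega>. if hd w = i then wprod (entry g (snd \<omega>)) w * fst \<omega> (last w) else 0) \<in> borel_measurable (Om n)"
    by (cases "hd w = i") simp_all
qed

lemma measurable_kry_rem: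
  assumes "i < n" "g \<in> borel_measurable borel"
  shows "(\<lambda>\<omega>. kry_rem n g v (snd \<omega>) (fst \<omega>) k i) \<in> borel_measurable (Om n)"
  unfolding kry_rem_def
proof (rule borel_measurable_sum)
  fix w assume "w \<in> paths n k"
  note w = pathsD[OF this]
  have "(\<lambda>\<omega>. Psi n g v (i # w) (snd \<omega>) * fst \<omega> (last w)) \<in> borel_measurable (Om n)"
    by (intro borel_measurable_times measurable_Psi assms measurable_x) (use w in auto)
  thus "(\<lambda>\<omega>. if i \<in> set (tl w) then Psi n g v (i # w) (snd \<omega>) * fst \<omega> (last w) else 0) \<in> borel_measurable (Om n)"
    by (cases "i \<in> set (tl w)") simp_all
qed

lemma ip_x_limit: "((\<lambda>(n, \<omega>). ip n (fst \<omega>) (fst \<omega>)) \<longlongrightarrow> 1) Gf"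
proof -
  have "((\<lambda>(n, \<omega>). nrm n (fst \<omega>)) \<longlongrightarrow> 1) Gf"
    unfolding tendsto_iff
  proof (intro allI impI)
    fix e :: real assume "e > 0"
    hence "whp X (\<lambda>n x. \<bar>nrm n x - 1\<bar> < e)" using prior by (auto simp: spike_prior_def tendsto_in_prob_def)
    from lift_X[OF whp_imp_eventually[where M = X, OF X_prob this]]
    show "eventually (\<lambda>b. dist (case b of (n, \<omega>) \<Rightarrow> nrm n (fst \<omega>)) 1 < e) Gf"
      by (simp add: case_prod_unfold dist_real_def)
  qed
  from tendsto_power[OF this, of 2] show ?thesis by (simp add: case_prod_unfold ip_self)
qed

lemma ip_x_le: "eventually (\<lambda>(n, \<omega>). ip n (fst \<omega>) (fst \<omega>) \<le> 4) Gf"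
proof -
  have "eventually (\<lambda>b. (case b of (n, \<omega>) \<Rightarrow> ip n (fst \<omega>) (fst \<omega>)) < 4) Gf"
    by (rule order_tendstoD(2)[OF ip_x_limit]) simp
  thus ?thesis by eventually_elim auto
qed

lemma in_space: "eventually (\<lambda>(n, \<omega>). \<omega> \<in> space (Om n)) Gf"
proof (rule eventually_whp_filterI[OF Om_prob])
  show "(\<lambda>n. measure (Om n) (space (Om n))) \<longlonglongrightarrow> 1" by (simp add: prob_space.prob_space[OF Om_prob])
qed auto

lemma n_eventually: "eventually R sequentially \<Longrightarrow> eventually (\<lambda>(n, \<omega>). R n) Gf"
  by (rule whp_filter_n_at_top[OF Om_prob])

lemma n_limit:
  fixes h :: "nat \<Rightarrow> real"
  assumes "h \<longlonglongrightarrow> c" shows "((\<lambda>(n, \<omega>). h n) \<longlongrightarrow> c) Gf"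
  using filterlim_compose[OF assms filterlim_fst_whp[where M = Om, OF Om_prob]] by (simp add: case_prod_unfold)

text \<open>The working form of Markov's inequality. The spike is frozen with squared norm at most
  4, which holds with high probability since that quantity tends to 1; moment bounds over the noise
  then only have to be uniform in such \<open>x\<close>.\<close>

lemma conditional_limit_0:
  fixes Z :: "nat \<Rightarrow> (nat \<Rightarrow> real) \<times> (nat \<times> nat \<Rightarrow> real) \<Rightarrow> real"
  assumes Z: "\<And>n. Z n \<in> borel_measurable (Om n)" "\<And>n \<omega>. Z n \<omega> \<ge> 0"
    and le: "\<And>n x. n > 0 \<Longrightarrow> ip n x x \<le> 4 \<Longrightarrow> integrable (noise n P) (\<lambda>W. Z n (x, W)) \<and> (LINT W|(noise n P). Z n (x, W)) \<le> e n"
    and e: "e \<longlonglongrightarrow> 0"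
  shows "((\<lambda>(n, \<omega>). Z n \<omega>) \<longlongrightarrow> 0) Gf"
proof -
  define B where "B n = {x \<in> space (X n). ip n x x \<le> 4}" for n
  have B: "B n \<in> sets (X n)" for n
  proof -
    have "(\<lambda>x. x i) \<in> borel_measurable (X n)" if "i < n" for i
    proof -
      have "(\<lambda>x. x i) \<in> borel_measurable (Pi\<^sub>M {..<n} (\<lambda>_. borel :: real measure))"
        by (rule measurable_component_singleton) (use that in simp)
      thus ?thesis using measurable_cong_sets[OF X_sets refl] by blast
    qed
    hence "(\<lambda>x. ip n x x) \<in> borel_measurable (X n)" by (intro measurable_ip) auto
    thus ?thesis unfolding B_def by measurable
  qed
  have "((\<lambda>(n, \<omega>). indicator (B n) (fst \<omega>) * Z n \<omega>) \<longlongrightarrow> 0) Gf"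
  proof (rule tendsto_whp_filter_0[OF Om_prob _ _ _ e])
    fix n
    have "(\<lambda>\<omega>. indicator (B n) (fst \<omega>)) \<in> borel_measurable (Om n)"
      unfolding Om_eq by (rule measurable_compose[OF measurable_fst]) (rule borel_measurable_indicator[OF B])
    thus "(\<lambda>\<omega>. indicator (B n) (fst \<omega>) * Z n \<omega>) \<in> borel_measurable (Om n)"
      using Z(1) by (rule borel_measurable_times)
    show "indicator (B n) (fst \<omega>) * Z n \<omega> \<ge> 0" for \<omega> using Z(2)[of n \<omega>] by simp
  next
    show "eventually (\<lambda>n. (\<integral>\<^sup>+\<omega>. ennreal (indicator (B n) (fst \<omega>) * Z n \<omega>) \<partial>Om n) \<le> ennreal (e n)) sequentially"
      using eventually_gt_at_top[of 0]
    proof eventually_elim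
      case (elim n)
      show ?case
        unfolding Om_eq
      proof (rule nn_integral_pair_le[OF X_prob noise_prob _ _ B])
        show "Z n \<in> borel_measurable (X n \<Otimes>\<^sub>M noise n P)" using Z(1)[of n] unfolding Om_eq .
        show "integrable (noise n P) (\<lambda>W. Z n (x, W)) \<and> (LINT W|(noise n P). Z n (x, W)) \<le> e n" if "x \<in> B n" for x
          by (rule le[OF elim]) (use that in \<open>simp add: B_def\<close>)
      qed (rule Z(2))
    qed
  qed
  moreover have "eventually (\<lambda>b. (case b of (n, \<omega>) \<Rightarrow> indicator (B n) (fst \<omega>) * Z n \<omega>) = (case b of (n, \<omega>) \<Rightarrow> Z n \<omega>)) Gf"
    using ip_x_le in_space
  proof eventually_elim
    case (elim b)
    obtain n x W where b: "b = (n, x, W)" by (cases b)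
    have "x \<in> B n" using elim unfolding b Om_eq by (simp add: B_def space_pair_measure)
    thus ?case by (simp add: b)
  qed
  ultimately show ?thesis by (rule Lim_transform_eventually)
qed

abbreviation "Hn n \<omega> \<equiv> entry (xi n) (snd \<omega>)"

text \<open>Markov's inequality for a trace of order about \<open>2 * (ln n)^2\<close>. The walk
  bound per step, \<open>A n\<close>, tends to \<open>2 * sg\<close>, since cubes of the order over
  \<open>n\<close> and its squares times \<open>Bn n\<close> vanish; the factor \<open>n\<close> of
  the trace is beaten by \<open>(A n / D)^N\<close>.\<close>

lemma op_le_H:
  assumes e: "\<epsilon> > 0"
  shows "eventually (\<lambda>(n, \<omega>). op_le n (Hn n \<omega>) (2 * sg + \<epsilon>)) Gf"
proof -
  define K where "K n = nat \<lceil>(ln (real n))\<^sup>2\<rceil>" for n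
  define N where "N n = 2 * Suc (K n)" for n
  define D where "D = 2 * sg + \<epsilon>"
  define A where "A n = 2 * sg + sg * real (Suc (N n)) ^ 3 / real n + Bn n * (real (Suc (N n)))\<^sup>2" for n
  define Z where "Z n \<omega> = (\<Sum>i<n. hp n (Hn n \<omega>) (N n) i i) / D ^ N n" for n and \<omega> :: "(nat \<Rightarrow> real) \<times> (nat \<times> nat \<Rightarrow> real)"
  have D: "D > 0" using e sg by (simp add: D_def)
  have A0: "A n \<ge> 0" for n using sg Bn_nonneg[of n] by (simp add: A_def)
  have NL: "real (Suc (N n)) \<le> 2 * (ln (real n))\<^sup>2 + 5" for n
  proof -
    have "real (K n) \<le> (ln (real n))\<^sup>2 + 1" unfolding K_def
      using of_nat_ceiling[of "(ln (real n))\<^sup>2"] ceiling_correct[of "(ln (real n))\<^sup>2"] by (simp add: of_nat_nat)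
    thus ?thesis by (simp add: N_def)
  qed
  have Alim: "A \<longlonglongrightarrow> 2 * sg"
  proof -
    define U where "U n = 2 * (ln (real n))\<^sup>2 + 5" for n :: nat
    have 1: "(\<lambda>n. U n ^ 3 / real n) \<longlonglongrightarrow> 0" unfolding U_def by real_asymp
    have 2: "(\<lambda>n. Bn n * (U n)\<^sup>2) \<longlonglongrightarrow> 0" unfolding U_def Bn_def Tn_def by real_asymp
    have "(\<lambda>n. sg * (U n ^ 3 / real n) + Bn n * (U n)\<^sup>2) \<longlonglongrightarrow> sg * 0 + 0"
      by (intro tendsto_add tendsto_mult tendsto_const 1 2)
    hence lim: "(\<lambda>n. sg * (U n ^ 3 / real n) + Bn n * (U n)\<^sup>2) \<longlonglongrightarrow> 0" by simp
    have "(\<lambda>n. A n - 2 * sg) \<longlonglongrightarrow> 0"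
    proof (rule Lim_null_comparison[OF _ lim], rule always_eventually, rule allI)
      fix n
      have "real (Suc (N n)) ^ 3 \<le> U n ^ 3" "(real (Suc (N n)))\<^sup>2 \<le> (U n)\<^sup>2"
        using NL[of n] unfolding U_def by (intro power_mono; simp)+
      hence "sg * (real (Suc (N n)) ^ 3 / real n) \<le> sg * (U n ^ 3 / real n)" "Bn n * (real (Suc (N n)))\<^sup>2 \<le> Bn n * (U n)\<^sup>2"
        using sg Bn_nonneg[of n] by (intro mult_left_mono divide_right_mono; simp)+
      moreover have "A n - 2 * sg = sg * (real (Suc (N n)) ^ 3 / real n) + Bn n * (real (Suc (N n)))\<^sup>2" by (simp add: A_def)
      moreover have "0 \<le> sg * (real (Suc (N n)) ^ 3 / real n)" using sg by simp
      moreover have "0 \<le> Bn n * (real (Suc (N n)))\<^sup>2" using Bn_nonneg[of n] by simp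
      ultimately show "norm (A n - 2 * sg) \<le> sg * (U n ^ 3 / real n) + Bn n * (U n)\<^sup>2" unfolding real_norm_def by linarith
    qed
    thus ?thesis by (rule LIM_zero_cancel)
  qed
  \<comment> \<open>Half of the margin \<open>\<epsilon>\<close> is left for \<open>A n\<close> to
    come close to its limit.\<close>
  define \<rho> where "\<rho> = (2 * sg + \<epsilon> / 2) / D"
  have \<rho>: "0 < \<rho>" "\<rho> < 1" using e sg D by (simp_all add: \<rho>_def D_def)
  have elim0: "(\<lambda>n. real n * A n ^ N n / D ^ N n) \<longlonglongrightarrow> 0"
  proof (rule Lim_null_comparison[OF _ tendsto_le_power_log[OF \<rho>]])
    have "eventually (\<lambda>n. A n < 2 * sg + \<epsilon> / 2) sequentially" by (rule order_tendstoD(2)[OF Alim]) (use e in simp)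
    thus "eventually (\<lambda>n. norm (real n * A n ^ N n / D ^ N n) \<le> real n * \<rho> ^ nat \<lceil>(ln (real n))\<^sup>2\<rceil>) sequentially"
    proof eventually_elim
      case (elim n)
      have "A n / D \<le> \<rho>" unfolding \<rho>_def using elim D by (intro divide_right_mono) auto
      hence "(A n / D) ^ N n \<le> \<rho> ^ N n" using A0[of n] D by (intro power_mono) auto
      also have "\<dots> \<le> \<rho> ^ nat \<lceil>(ln (real n))\<^sup>2\<rceil>"
      proof (rule power_decreasing)
        show "nat \<lceil>(ln (real n))\<^sup>2\<rceil> \<le> N n" unfolding K_def[symmetric] N_def by simp
      qed (use \<rho> in simp_all)
      finally have "real n * (A n / D) ^ N n \<le> real n * \<rho> ^ nat \<lceil>(ln (real n))\<^sup>2\<rceil>" by (rule mult_left_mono) simp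
      moreover have "real n * A n ^ N n / D ^ N n = real n * (A n / D) ^ N n" by (simp add: power_divide)
      moreover have "real n * (A n / D) ^ N n \<ge> 0" using A0[of n] D by simp
      ultimately show ?case unfolding real_norm_def by linarith
    qed
  qed
  have "((\<lambda>(n, \<omega>). Z n \<omega>) \<longlongrightarrow> 0) Gf"
  proof (rule conditional_limit_0[OF _ _ _ elim0])
    show "Z n \<in> borel_measurable (Om n)" for n
      unfolding Z_def[abs_def]
      by (intro borel_measurable_divide borel_measurable_sum measurable_hp measurable_xi borel_measurable_const) auto
    show "Z n \<omega> \<ge> 0" for n \<omega>
      unfolding Z_def N_def using D by (intro divide_nonneg_nonneg trace_even_power_nonneg entry_symmetric) auto
    fix n x assume n: "n > (0::nat)"
    note tr = expected_trace_power[where N = "N n" and \<xi> = "xi n" and s = sg and B = "Bn n" and n = n,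
        OF prob(1) integrable_xi step_bound_xi[OF n] less_imp_le[OF sg(1)] Bn_nonneg]
    show "integrable (noise n P) (\<lambda>W. Z n (x, W)) \<and> (LINT W|(noise n P). Z n (x, W)) \<le> real n * A n ^ N n / D ^ N n"
    proof
      show "integrable (noise n P) (\<lambda>W. Z n (x, W))" unfolding Z_def snd_conv by (rule integrable_divide[OF tr(1)])
      have "(LINT W|(noise n P). Z n (x, W)) = (LINT W|(noise n P). (\<Sum>i<n. hp n (entry (xi n) W) (N n) i i)) / D ^ N n"
        unfolding Z_def snd_conv by (rule integral_divide_zero)
      also have "\<dots> \<le> real n * A n ^ N n / D ^ N n"
        unfolding A_def by (rule divide_right_mono[OF tr(2)]) (use D in simp)
      finally show "(LINT W|(noise n P). Z n (x, W)) \<le> real n * A n ^ N n / D ^ N n" .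
    qed
  qed
  hence "eventually (\<lambda>b. (case b of (n, \<omega>) \<Rightarrow> Z n \<omega>) < 1) Gf" by (rule order_tendstoD) simp
  thus ?thesis
  proof eventually_elim
    case (elim b)
    obtain n \<omega> where b: "b = (n, \<omega>)" by (cases b)
    have "(\<Sum>i<n. hp n (Hn n \<omega>) (N n) i i) / D ^ N n < 1" using elim by (simp add: b Z_def)
    hence "(\<Sum>i<n. hp n (Hn n \<omega>) (N n) i i) \<le> D ^ N n" using D by (simp add: divide_less_eq)
    hence "op_le n (Hn n \<omega>) D"
      unfolding N_def by (intro op_le_trace_power[where k = "K n"] entry_symmetric less_imp_le[OF D])
    thus ?case by (simp add: b D_def)
  qed
qed

lemma limit_0_if_square:
  fixes g :: "nat \<times> 'c \<Rightarrow> real"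
  assumes "((\<lambda>b. (g b)\<^sup>2) \<longlongrightarrow> 0) F" shows "(g \<longlongrightarrow> 0) F"
proof -
  have "((\<lambda>b. sqrt ((g b)\<^sup>2)) \<longlongrightarrow> sqrt 0) F" using assms by (rule tendsto_real_sqrt)
  thus ?thesis by (simp add: tendsto_rabs_zero_iff)
qed

text \<open>The second moment is of order \<open>1 / n\<close>: the \<open>k + 1\<close> edges give
  \<open>n^(-k-1)\<close> against \<open>n^k\<close> from the freely summed vertices.\<close>

lemma ip_kry_limit: "((\<lambda>(n, \<omega>). ip n (fst \<omega>) (kry n (Hn n \<omega>) (fst \<omega>) (Suc k))) \<longlongrightarrow> 0) Gf"
proof -
  define c where "c = (sg ^ Suc k)\<^sup>2 * real (Suc (Suc k)) ^ Suc (Suc k) * 16"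
  have e: "(\<lambda>n. c * (1 / real n)) \<longlonglongrightarrow> 0" using tendsto_mult_right_zero[OF lim_1_over_n, of c] .
  have "((\<lambda>(n, \<omega>). (ip n (fst \<omega>) (kry n (Hn n \<omega>) (fst \<omega>) (Suc k)))\<^sup>2) \<longlongrightarrow> 0) Gf"
  proof (rule conditional_limit_0[OF _ _ _ e])
    show "(\<lambda>\<omega>. (ip n (fst \<omega>) (kry n (Hn n \<omega>) (fst \<omega>) (Suc k)))\<^sup>2) \<in> borel_measurable (Om n)" for n
      by (intro borel_measurable_power measurable_ip measurable_x measurable_kry measurable_xi) auto
    fix n x assume n: "n > (0::nat)" and x: "ip n x x \<le> 4"
    interpret ce: centred_entry P "xi n" "vn n" "sg / sqrt (real n)" "Bn n" by (rule centred_xi[OF n])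
    have q: "((sg / sqrt (real n)) ^ Suc k)\<^sup>2 * real n ^ k = (sg ^ Suc k)\<^sup>2 * (1 / real n)"
    proof -
      have "real n ^ k \<noteq> 0" using n by simp
      thus ?thesis unfolding power_div_sqrt power_Suc[of "real n"] by simp
    qed
    have x2: "(ip n x x)\<^sup>2 \<le> 16" using power_mono[OF x ip_self_nonneg, of 2] by simp
    have "(LINT W|(noise n P). (ip n x (kry n (entry (xi n) W) x (Suc k)))\<^sup>2) \<le>
       ((sg / sqrt (real n)) ^ Suc k)\<^sup>2 * real (Suc (Suc k)) ^ Suc (Suc k) * (real n ^ k * (ip n x x)\<^sup>2)"
      by (rule ce.expected_ip_kry(2))
    also have "\<dots> \<le> ((sg / sqrt (real n)) ^ Suc k)\<^sup>2 * real (Suc (Suc k)) ^ Suc (Suc k) * (real n ^ k * 16)"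
      using x2 by (intro mult_left_mono) auto
    also have "\<dots> = (((sg / sqrt (real n)) ^ Suc k)\<^sup>2 * real n ^ k) * (real (Suc (Suc k)) ^ Suc (Suc k) * 16)"
      by (simp only: mult_ac)
    also have "\<dots> = c * (1 / real n)" unfolding q c_def by (simp only: mult_ac)
    finally show "integrable (noise n P) (\<lambda>W. (ip n (fst (x, W)) (kry n (Hn n (x, W)) (fst (x, W)) (Suc k)))\<^sup>2) \<and>
      (LINT W|(noise n P). (ip n (fst (x, W)) (kry n (Hn n (x, W)) (fst (x, W)) (Suc k)))\<^sup>2) \<le> c * (1 / real n)"
      unfolding fst_conv snd_conv using ce.expected_ip_kry(1) by blast
  qed simp
  thus ?thesis unfolding case_prod_unfold by (rule limit_0_if_square)
qed

text \<open>Here the powers of \<open>n\<close> balance exactly, and the gain is the factor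
  \<open>(q + B)^2\<close>, which truncation makes of order \<open>n^(-1/10)\<close>.\<close>

lemma kry_rem_limit: "((\<lambda>(n, \<omega>). nrm n (kry_rem n (xi n) (vn n) (snd \<omega>) (fst \<omega>) k)) \<longlongrightarrow> 0) Gf"
proof -
  define c where "c = (sg ^ k)\<^sup>2 * real (k + 2) ^ (k + 2) * (real k * 4)"
  have "(\<lambda>n. c * (sg * (1 / sqrt (real n)) + Bn n)\<^sup>2) \<longlonglongrightarrow> c * (sg * 0 + 0)\<^sup>2"
  proof (intro tendsto_mult tendsto_const tendsto_power tendsto_add)
    show "(\<lambda>n. 1 / sqrt (real n)) \<longlonglongrightarrow> 0" by real_asymp
    show "Bn \<longlonglongrightarrow> 0" unfolding Bn_def[abs_def] Tn_def by real_asymp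
  qed
  hence e: "(\<lambda>n. c * (sg * (1 / sqrt (real n)) + Bn n)\<^sup>2) \<longlonglongrightarrow> 0" by simp
  let ?r = "\<lambda>n \<omega>. kry_rem n (xi n) (vn n) (snd \<omega>) (fst \<omega>) k"
  have "((\<lambda>(n, \<omega>). ip n (?r n \<omega>) (?r n \<omega>)) \<longlongrightarrow> 0) Gf"
  proof (rule conditional_limit_0[OF _ _ _ e])
    show "(\<lambda>\<omega>. ip n (?r n \<omega>) (?r n \<omega>)) \<in> borel_measurable (Om n)" for n
      by (intro measurable_ip measurable_kry_rem measurable_xi) auto
    fix n x assume n: "n > (0::nat)" and x: "ip n x x \<le> 4"
    interpret ce: centred_entry P "xi n" "vn n" "sg / sqrt (real n)" "Bn n" by (rule centred_xi[OF n])
    have q: "((sg / sqrt (real n)) ^ k)\<^sup>2 * real n ^ k = (sg ^ k)\<^sup>2"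
    proof -
      have "real n ^ k \<noteq> 0" using n by simp
      thus ?thesis unfolding power_div_sqrt by simp
    qed
    have "(LINT W|(noise n P). ip n (kry_rem n (xi n) (vn n) W x k) (kry_rem n (xi n) (vn n) W x k)) \<le>
       ((sg / sqrt (real n)) ^ k * (sg / sqrt (real n) + Bn n))\<^sup>2 * real (k + 2) ^ (k + 2) * (real k * (real n ^ k * ip n x x))"
      by (rule ce.expected_kry_rem(2))
    also have "\<dots> \<le> ((sg / sqrt (real n)) ^ k * (sg / sqrt (real n) + Bn n))\<^sup>2 * real (k + 2) ^ (k + 2) * (real k * (real n ^ k * 4))"
      using x by (intro mult_left_mono) auto
    also have "\<dots> = (((sg / sqrt (real n)) ^ k)\<^sup>2 * real n ^ k) * ((sg / sqrt (real n) + Bn n)\<^sup>2 * (real (k + 2) ^ (k + 2) * (real k * 4)))"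
      unfolding power_mult_distrib by (simp only: mult_ac)
    also have "\<dots> = c * (sg * (1 / sqrt (real n)) + Bn n)\<^sup>2" unfolding q c_def by (simp only: mult_ac times_divide_eq_right mult_1_right mult_1_left)
    finally show "integrable (noise n P) (\<lambda>W. ip n (?r n (x, W)) (?r n (x, W))) \<and>
      (LINT W|(noise n P). ip n (?r n (x, W)) (?r n (x, W))) \<le> c * (sg * (1 / sqrt (real n)) + Bn n)\<^sup>2"
      unfolding fst_conv snd_conv using ce.expected_kry_rem(1) by blast
  qed (rule ip_self_nonneg)
  thus ?thesis unfolding case_prod_unfold ip_self by (rule limit_0_if_square)
qed

end

section \<open>The remainder of the linearised score matrix\<close>

lemma op_le_add:
  assumes "op_le n A r" "op_le n D t"
  shows "op_le n (\<lambda>i j. A i j + D i j) (r + t)"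
  unfolding op_le_def
proof
  fix v
  have "mv n (\<lambda>i j. A i j + D i j) v = (\<lambda>i. mv n A v i + mv n D v i)"
    by (rule ext) (simp only: mv_def distrib_right sum.distrib)
  hence "nrm n (mv n (\<lambda>i j. A i j + D i j) v) \<le> nrm n (mv n A v) + nrm n (mv n D v)"
    by (simp only: L2_set_triangle_ineq)
  also have "\<dots> \<le> r * nrm n v + t * nrm n v" by (intro add_mono op_leD assms)
  finally show "nrm n (mv n (\<lambda>i j. A i j + D i j) v) \<le> (r + t) * nrm n v" by (simp only: distrib_right)
qed

lemma op_le_cong:
  assumes "op_le n A r" "\<And>i j. i < n \<Longrightarrow> j < n \<Longrightarrow> D i j = A i j"
  shows "op_le n D r"
  unfolding op_le_def
proof
  fix v
  have "nrm n (mv n D v) = nrm n (mv n A v)" using assms(2) by (intro nrm_cong) (simp add: mv_def)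
  thus "nrm n (mv n D v) \<le> r * nrm n v" using op_leD[OF assms(1)] by simp
qed

lemma op_le_mono: "op_le n A r \<Longrightarrow> r \<le> t \<Longrightarrow> op_le n A t"
  unfolding op_le_def using mult_right_mono[OF _ L2_set_nonneg] order_trans by blast

lemma nrm_mult_le:
  assumes b: "\<And>i. i < n \<Longrightarrow> \<bar>x i\<bar> \<le> a" and a: "a \<ge> 0"
  shows "nrm n (\<lambda>i. x i * v i) \<le> a * nrm n v"
proof -
  have "(nrm n (\<lambda>i. x i * v i))\<^sup>2 \<le> (a * nrm n v)\<^sup>2"
    unfolding power_mult_distrib nrm_square sum_distrib_left
  proof (rule sum_mono)
    fix i assume "i \<in> {..<n}"
    hence "(x i)\<^sup>2 \<le> a\<^sup>2" using power_mono[OF b abs_ge_zero, of i 2] by simp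
    thus "(x i)\<^sup>2 * (v i)\<^sup>2 \<le> a\<^sup>2 * (v i)\<^sup>2" by (rule mult_right_mono) simp
  qed
  thus ?thesis by (rule power2_le_imp_le) (simp add: a L2_set_nonneg)
qed

text \<open>The entrywise product with \<open>x x^T\<close> is \<open>A\<close> multiplied on both
  sides by the diagonal matrix of \<open>x\<close>, which has norm at most \<open>a\<close>.\<close>

lemma op_le_hadamard_rank_one:
  assumes A: "op_le n A r" and b: "\<And>i. i < n \<Longrightarrow> \<bar>x i\<bar> \<le> a" and a: "a \<ge> 0" "r \<ge> 0" and c: "c \<ge> 0"
  shows "op_le n (\<lambda>i j. c * (x i * x j) * A i j) (c * a\<^sup>2 * r)"
  unfolding op_le_def
proof
  fix v
  have "mv n (\<lambda>i j. c * (x i * x j) * A i j) v = (\<lambda>i. c * (x i * mv n A (\<lambda>j. x j * v j) i))"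
    by (rule ext) (simp only: mv_def sum_distrib_left mult_ac)
  hence "nrm n (mv n (\<lambda>i j. c * (x i * x j) * A i j) v) = c * nrm n (\<lambda>i. x i * mv n A (\<lambda>j. x j * v j) i)"
    using c by (simp only: nrm_scale abs_of_nonneg)
  also have "\<dots> \<le> c * (a * nrm n (mv n A (\<lambda>j. x j * v j)))" by (intro mult_left_mono nrm_mult_le b a c)
  also have "\<dots> \<le> c * (a * (r * nrm n (\<lambda>j. x j * v j)))" by (intro mult_left_mono op_leD[OF A] a c)
  also have "\<dots> \<le> c * (a * (r * (a * nrm n v)))" by (intro mult_left_mono nrm_mult_le b a c)
  finally show "nrm n (mv n (\<lambda>i j. c * (x i * x j) * A i j) v) \<le> c * a\<^sup>2 * r * nrm n v"
    by (simp only: power2_eq_square mult_ac)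
qed

context score_model
begin

lemma noise_component:
  fixes g :: "real \<Rightarrow> real"
  assumes e: "e \<in> edges n" and g: "integrable P g"
  shows "integrable (noise n P) (\<lambda>W. g (W e))" "(LINT W|(noise n P). g (W e)) = (LINT w|P. g w)"
proof -
  define u where "u e' w = (if e' = e then g w else 1)" for e' w
  have i: "integrable P (u e')" for e' by (cases "e' = e") (simp_all add: u_def[abs_def] g)
  have eq: "(\<Prod>e'\<in>edges n. u e' (W e')) = g (W e)" for W
    using e by (simp add: u_def)
  have eq2: "(\<Prod>e'\<in>edges n. LINT w|P. u e' w) = (LINT w|P. g w)"
  proof -
    have "(LINT w|P. u e' w) = (if e' = e then (LINT w|P. g w) else 1)" for e' by (simp add: u_def prob_space)
    thus ?thesis using e by simp
  qed
  show "integrable (noise n P) (\<lambda>W. g (W e))"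
    using noise_prod(1)[where u = u and n = n, OF prob(1) i] unfolding eq .
  show "(LINT W|(noise n P). g (W e)) = (LINT w|P. g w)"
    using noise_prod(2)[where u = u and n = n, OF prob(1) i] unfolding eq eq2 .
qed

lemma expected_entry_sum:
  fixes g :: "real \<Rightarrow> real"
  assumes g: "integrable P g" "\<And>w. g w \<ge> 0"
  shows "integrable (noise n P) (\<lambda>W. \<Sum>i<n. \<Sum>j<n. entry g W i j)"
    "(LINT W|(noise n P). (\<Sum>i<n. \<Sum>j<n. entry g W i j)) \<le> (real n)\<^sup>2 * (LINT w|P. g w)"
proof -
  have I: "integrable (noise n P) (\<lambda>W. entry g W i j)" and L: "(LINT W|(noise n P). entry g W i j) \<le> (LINT w|P. g w)"
    if "i < n" "j < n" for i j
  proof -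
    have 0: "0 \<le> (LINT w|P. g w)" using g(2) by (intro integral_nonneg_AE) simp
    show "integrable (noise n P) (\<lambda>W. entry g W i j)"
    proof (cases "i = j")
      case False
      thus ?thesis using noise_component(1)[OF edge_in_edges[OF False that] g(1)] by (simp add: entry_def)
    qed (simp add: entry_def)
    show "(LINT W|(noise n P). entry g W i j) \<le> (LINT w|P. g w)"
    proof (cases "i = j")
      case False
      thus ?thesis using noise_component(2)[OF edge_in_edges[OF False that] g(1)] by (simp add: entry_def)
    qed (use 0 in \<open>simp add: entry_def\<close>)
  qed
  show "integrable (noise n P) (\<lambda>W. \<Sum>i<n. \<Sum>j<n. entry g W i j)"
    by (intro Bochner_Integration.integrable_sum I) auto
  have "(LINT W|(noise n P). (\<Sum>i<n. \<Sum>j<n. entry g W i j)) = (\<Sum>i<n. LINT W|(noise n P). (\<Sum>j<n. entry g W i j))"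
    by (intro Bochner_Integration.integral_sum Bochner_Integration.integrable_sum I) auto
  also have "\<dots> = (\<Sum>i<n. \<Sum>j<n. LINT W|(noise n P). entry g W i j)"
    by (intro sum.cong refl Bochner_Integration.integral_sum I) auto
  also have "\<dots> \<le> (\<Sum>i<n. \<Sum>j<n. LINT w|P. g w)" by (intro sum_mono L) auto
  also have "\<dots> = (real n)\<^sup>2 * (LINT w|P. g w)" by (simp add: power2_eq_square)
  finally show "(LINT W|(noise n P). (\<Sum>i<n. \<Sum>j<n. entry g W i j)) \<le> (real n)\<^sup>2 * (LINT w|P. g w)" .
qed

text \<open>The fluctuation of \<open>f'\<close> about its mean, scaled like \<open>xi\<close>. A
  crude norm bound suffices for it, because it only occurs multiplied entrywise by the small matrix
  \<open>x x^T\<close>.\<close>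

definition g2 :: "nat \<Rightarrow> real \<Rightarrow> real" where "g2 n w = (f' w - Fi) / sqrt (real n)"
definition hb :: "real \<Rightarrow> real" where "hb w = (C + (\<bar>w\<bar> + 1) ^ m) / 2"

lemma measurable_g2 [measurable]: "g2 n \<in> borel_measurable borel"
  unfolding g2_def[abs_def] by measurable

lemma integrable_centred_deriv: "k \<le> 5 \<Longrightarrow> integrable P (\<lambda>w. (f' w - Fi) ^ k)"
proof (rule integrable_growth)
  show "(\<lambda>w. f' w - Fi) \<in> borel_measurable borel" by measurable
  fix w :: real
  have wm: "w ^ m \<ge> 0" by (rule zero_le_even_power[OF growth(2)])
  have "Fi * w ^ m \<ge> 0" using wm Fi_pos by simp
  hence "Fi \<le> Fi * (1 + w ^ m)" by (simp add: distrib_left)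
  moreover have "\<bar>f' w - Fi\<bar> \<le> \<bar>f' w\<bar> + Fi" using Fi_pos by linarith
  ultimately have "\<bar>f' w - Fi\<bar> \<le> (C + 1) * (1 + w ^ m) + Fi * (1 + w ^ m)" using score_le(2)[of w] by linarith
  thus "\<bar>f' w - Fi\<bar> \<le> (C + 1 + Fi) * (1 + w ^ m)" by (simp only: distrib_right)
qed

text \<open>A common bound for the absolute moments up to order 4. The added 1 gives
  \<open>K4 \<le> K4 ^ k\<close> for positive \<open>k\<close>, so that the same constant can be
  used for \<open>s\<close> and, divided by \<open>sqrt n\<close>, for \<open>B\<close> in the step
  weights.\<close>

definition K4 :: real where "K4 = 1 + (\<Sum>k\<le>4. LINT w|P. \<bar>f' w - Fi\<bar> ^ k)"

lemma K4: "K4 \<ge> 1" "k \<le> 4 \<Longrightarrow> (LINT w|P. \<bar>f' w - Fi\<bar> ^ k) \<le> K4"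
proof -
  have nn: "(LINT w|P. \<bar>f' w - Fi\<bar> ^ k) \<ge> 0" for k by (rule integral_nonneg_AE) simp
  have "(\<Sum>k\<le>4. LINT w|P. \<bar>f' w - Fi\<bar> ^ k) \<ge> 0" by (rule sum_nonneg) (rule nn)
  thus "K4 \<ge> 1" by (simp only: K4_def)
  assume k: "k \<le> 4"
  have "(LINT w|P. \<bar>f' w - Fi\<bar> ^ k) \<le> (\<Sum>k\<le>4. LINT w|P. \<bar>f' w - Fi\<bar> ^ k)"
    by (rule member_le_sum[where f = "\<lambda>k. LINT w|P. \<bar>f' w - Fi\<bar> ^ k"]) (use k nn in auto)
  thus "(LINT w|P. \<bar>f' w - Fi\<bar> ^ k) \<le> K4" unfolding K4_def by linarith
qed

lemma step_bound_g2:
  assumes n: "n > 0" and k: "k \<le> 4"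
  shows "\<bar>LINT w|P. g2 n w ^ k\<bar> \<le> (\<Prod>i<k. step_wt K4 (K4 / sqrt (real n)) n i)"
proof -
  consider "k = 0" | "k = 1" | l where "k = Suc (Suc l)" by (cases k; cases "k - 1") auto
  thus ?thesis
  proof cases
    case 1
    thus ?thesis by (simp add: prob_space)
  next
    case 2
    have "integrable P f'" using integrable_score(2)[of 1] by simp
    hence "(LINT w|P. g2 n w) = 0" unfolding g2_def by (simp add: prob_space mean_score_deriv Fi_def)
    thus ?thesis using 2 K4(1) by simp
  next
    case 3
    have "\<bar>LINT w|P. g2 n w ^ k\<bar> \<le> (LINT w|P. \<bar>g2 n w ^ k\<bar>)" by (rule integral_abs_bound)
    also have "(\<lambda>w. \<bar>g2 n w ^ k\<bar>) = (\<lambda>w. \<bar>f' w - Fi\<bar> ^ k / sqrt (real n) ^ k)"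
      by (rule ext) (simp add: g2_def power_abs power_divide)
    also have "(LINT w|P. \<bar>f' w - Fi\<bar> ^ k / sqrt (real n) ^ k) = (LINT w|P. \<bar>f' w - Fi\<bar> ^ k) / sqrt (real n) ^ k"
      by (rule integral_divide_zero)
    also have "\<dots> \<le> K4 / sqrt (real n) ^ k" using K4(2)[OF k] by (intro divide_right_mono) auto
    also have "\<dots> \<le> K4 ^ k / sqrt (real n) ^ k"
    proof -
      have "K4 ^ 1 \<le> K4 ^ k" by (rule power_increasing) (use 3 K4(1) in auto)
      thus ?thesis by (intro divide_right_mono) auto
    qed
    also have "\<dots> = K4\<^sup>2 / real n * (K4 / sqrt (real n)) ^ l"
    proof -
      have "sqrt (real n) ^ k = real n * sqrt (real n) ^ l" unfolding 3 using n by (simp add: power_Suc mult.assoc[symmetric])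
      moreover have "K4 ^ k = K4\<^sup>2 * K4 ^ l" unfolding 3 by (simp add: power2_eq_square)
      ultimately show ?thesis by (simp add: power_divide)
    qed
    finally show ?thesis unfolding 3 prod_step_wt .
  qed
qed

end

context spiked_model
begin

definition th :: real where "th = lam * Fi"

definition amat :: "nat \<Rightarrow> (nat \<Rightarrow> real) \<times> (nat \<times> nat \<Rightarrow> real) \<Rightarrow> nat \<Rightarrow> nat \<Rightarrow> real" where
  "amat n \<omega> i j = (if i = j then 0
     else f (sqrt (real n) * (lam * (fst \<omega> i * fst \<omega> j) + 1 / sqrt (real n) * snd \<omega> (edge i j))))"

lemma score_matrix_eq: "score_matrix n lam p \<omega> = mat n n (\<lambda>(i, j). amat n \<omega> i j)"
  unfolding score_matrix_def offdiag_map_def wig_matrix_def amat_def edge_def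
  by (cases \<omega>) (rule eq_matI; auto)

lemma amat_symmetric: "amat n \<omega> i j = amat n \<omega> j i"
  by (simp add: amat_def edge_commute mult.commute)

lemma amat_shift:
  assumes "n > 0" "i \<noteq> j"
  shows "amat n \<omega> i j = f (snd \<omega> (edge i j) + lam * sqrt (real n) * (fst \<omega> i * fst \<omega> j))"
proof -
  have "sqrt (real n) * (lam * (fst \<omega> i * fst \<omega> j) + 1 / sqrt (real n) * snd \<omega> (edge i j)) =
      snd \<omega> (edge i j) + lam * sqrt (real n) * (fst \<omega> i * fst \<omega> j)"
    using assms(1) by (simp add: field_simps)
  thus ?thesis using assms(2) by (simp only: amat_def if_False)
qed

definition Err :: "nat \<Rightarrow> (nat \<Rightarrow> real) \<times> (nat \<times> nat \<Rightarrow> real) \<Rightarrow> nat \<Rightarrow> nat \<Rightarrow> real" where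
  "Err n \<omega> i j = amat n \<omega> i j / sqrt (real n) - Hn n \<omega> i j - th * (fst \<omega> i * fst \<omega> j)"

text \<open>The expected number of entries above the level is at most \<open>n^2 * M5 / T^5\<close>,
  of order \<open>n^(-1/4)\<close>. A sum of zeros and ones that is below 1 has only zero
  terms.\<close>

lemma tail_vanishes: "eventually (\<lambda>(n, \<omega>). \<forall>i<n. \<forall>j<n. entry (tail (Tn n)) (snd \<omega>) i j = 0) Gf"
proof -
  define Z where "Z n \<omega> = (\<Sum>i<n. \<Sum>j<n. entry (tail (Tn n)) (snd \<omega>) i j)" for n and \<omega> :: "(nat \<Rightarrow> real) \<times> (nat \<times> nat \<Rightarrow> real)"
  have tail01: "entry (tail T) W i j = 0 \<or> entry (tail T) W i j = 1" for T W i j by (auto simp: entry_def tail_def)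
  have tail0: "entry (tail T) W i j \<ge> 0" for T W i j using tail01[of T W i j] by auto
  have "(\<lambda>n. (real n)\<^sup>2 / (real n powr (9/20)) ^ 5) \<longlonglongrightarrow> 0" by real_asymp
  hence "(\<lambda>n. M5 * ((real n)\<^sup>2 / (real n powr (9/20)) ^ 5)) \<longlonglongrightarrow> 0" by (rule tendsto_mult_right_zero)
  hence e: "(\<lambda>n. (real n)\<^sup>2 * (M5 / Tn n ^ 5)) \<longlonglongrightarrow> 0" unfolding Tn_def by (simp add: mult.commute)
  have "((\<lambda>(n, \<omega>). Z n \<omega>) \<longlongrightarrow> 0) Gf"
  proof (rule conditional_limit_0[OF _ _ _ e])
    show "Z n \<in> borel_measurable (Om n)" for n
      unfolding Z_def[abs_def] by (intro borel_measurable_sum measurable_entry measurable_tail) auto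
    show "Z n \<omega> \<ge> 0" for n \<omega> unfolding Z_def by (intro sum_nonneg tail0)
    fix n x assume n: "n > (0::nat)"
    have i: "integrable P (tail (Tn n))" using integrable_tail(1)[OF Tn_pos[OF n], of 0] by simp
    have t0: "tail (Tn n) w \<ge> 0" for w by (simp add: tail_def)
    have l: "(LINT w|P. tail (Tn n) w) \<le> M5 / Tn n ^ 5" using integrable_tail(2)[OF Tn_pos[OF n], of 0] by simp
    have "(LINT W|(noise n P). Z n (x, W)) \<le> (real n)\<^sup>2 * (LINT w|P. tail (Tn n) w)"
      unfolding Z_def snd_conv by (rule expected_entry_sum(2)[OF i t0])
    also have "\<dots> \<le> (real n)\<^sup>2 * (M5 / Tn n ^ 5)" using l by (rule mult_left_mono) simp
    finally show "integrable (noise n P) (\<lambda>W. Z n (x, W)) \<and> (LINT W|(noise n P). Z n (x, W)) \<le> (real n)\<^sup>2 * (M5 / Tn n ^ 5)"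
      unfolding Z_def snd_conv using expected_entry_sum(1)[OF i t0] by blast
  qed
  hence "eventually (\<lambda>b. (case b of (n, \<omega>) \<Rightarrow> Z n \<omega>) < 1) Gf" by (rule order_tendstoD) simp
  thus ?thesis
  proof eventually_elim
    case (elim b)
    obtain n \<omega> where b: "b = (n, \<omega>)" by (cases b)
    have Z: "Z n \<omega> < 1" using elim by (simp add: b)
    have "entry (tail (Tn n)) (snd \<omega>) i j = 0" if ij: "i < n" "j < n" for i j
    proof (rule ccontr)
      assume "entry (tail (Tn n)) (snd \<omega>) i j \<noteq> 0"
      hence "1 = entry (tail (Tn n)) (snd \<omega>) i j" using tail01[of "Tn n" "snd \<omega>" i j] by (elim disjE) simp_all
      also have "\<dots> \<le> (\<Sum>j<n. entry (tail (Tn n)) (snd \<omega>) i j)"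
        by (rule member_le_sum[where f = "\<lambda>j. entry (tail (Tn n)) (snd \<omega>) i j"]) (use ij tail0 in auto)
      also have "\<dots> \<le> Z n \<omega>" unfolding Z_def
        by (rule member_le_sum[where f = "\<lambda>i. \<Sum>j<n. entry (tail (Tn n)) (snd \<omega>) i j"]) (use ij tail0 in \<open>auto intro: sum_nonneg\<close>)
      finally show False using Z by simp
    qed
    thus ?case by (simp add: b)
  qed
qed

text \<open>The expectation is of order \<open>n^2\<close>, and \<open>5/2\<close> leaves room for
  Markov's inequality. It is still small enough, because in the squared Taylor remainder this sum is
  multiplied by a factor of order \<open>n^(-11/4)\<close>.\<close>

lemma remainder_bounded: "eventually (\<lambda>(n, \<omega>). (\<Sum>i<n. \<Sum>j<n. entry (\<lambda>w. (hb w)\<^sup>2) (snd \<omega>) i j) \<le> real n powr (5/2)) Gf"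
proof -
  define Z where "Z n \<omega> = (\<Sum>i<n. \<Sum>j<n. entry (\<lambda>w. (hb w)\<^sup>2) (snd \<omega>) i j) / real n powr (5/2)" for n and \<omega> :: "(nat \<Rightarrow> real) \<times> (nat \<times> nat \<Rightarrow> real)"
  have mh: "(\<lambda>w. (hb w)\<^sup>2) \<in> borel_measurable borel" unfolding hb_def by measurable
  have ih: "integrable P (\<lambda>w. (hb w)\<^sup>2)" unfolding hb_def by (rule integrable_taylor_bound)
  define Kh where "Kh = (LINT w|P. (hb w)\<^sup>2)"
  have "(\<lambda>n. (real n)\<^sup>2 / real n powr (5/2)) \<longlonglongrightarrow> 0" by real_asymp
  hence "(\<lambda>n. Kh * ((real n)\<^sup>2 / real n powr (5/2))) \<longlonglongrightarrow> 0" by (rule tendsto_mult_right_zero)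
  hence e: "(\<lambda>n. (real n)\<^sup>2 * Kh / real n powr (5/2)) \<longlonglongrightarrow> 0" by (simp add: mult.commute)
  have "((\<lambda>(n, \<omega>). Z n \<omega>) \<longlongrightarrow> 0) Gf"
  proof (rule conditional_limit_0[OF _ _ _ e])
    show "Z n \<in> borel_measurable (Om n)" for n
      unfolding Z_def[abs_def] by (intro borel_measurable_divide borel_measurable_sum measurable_entry mh borel_measurable_const) auto
    have "entry (\<lambda>w. (hb w)\<^sup>2) W i j \<ge> 0" for W i j by (simp add: entry_def)
    thus "Z n \<omega> \<ge> 0" for n \<omega> unfolding Z_def by (intro divide_nonneg_nonneg sum_nonneg) auto
    fix n x assume n: "n > (0::nat)"
    have h0: "(hb w)\<^sup>2 \<ge> 0" for w by simp
    have "(LINT W|(noise n P). Z n (x, W)) = (LINT W|(noise n P). (\<Sum>i<n. \<Sum>j<n. entry (\<lambda>w. (hb w)\<^sup>2) W i j)) / real n powr (5/2)"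
      unfolding Z_def snd_conv by (rule integral_divide_zero)
    also have "\<dots> \<le> (real n)\<^sup>2 * Kh / real n powr (5/2)"
      unfolding Kh_def by (rule divide_right_mono[OF expected_entry_sum(2)[OF ih h0]]) simp
    finally show "integrable (noise n P) (\<lambda>W. Z n (x, W)) \<and> (LINT W|(noise n P). Z n (x, W)) \<le> (real n)\<^sup>2 * Kh / real n powr (5/2)"
      unfolding Z_def snd_conv using integrable_divide[OF expected_entry_sum(1)[OF ih h0]] by blast
  qed
  hence "eventually (\<lambda>b. (case b of (n, \<omega>) \<Rightarrow> Z n \<omega>) < 1) Gf" by (rule order_tendstoD) simp
  moreover have "eventually (\<lambda>(n, \<omega>). n > 0) Gf" by (rule n_eventually) (rule eventually_gt_at_top)
  ultimately show ?thesis
  proof eventually_elim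
    case (elim b)
    obtain n \<omega> where b: "b = (n, \<omega>)" by (cases b)
    have "(\<Sum>i<n. \<Sum>j<n. entry (\<lambda>w. (hb w)\<^sup>2) (snd \<omega>) i j) / real n powr (5/2) < 1" "real n powr (5/2) > 0"
      using elim by (simp_all add: b Z_def)
    hence "(\<Sum>i<n. \<Sum>j<n. entry (\<lambda>w. (hb w)\<^sup>2) (snd \<omega>) i j) \<le> real n powr (5/2)" by (simp only: divide_less_eq_1_pos less_imp_le)
    thus ?case by (simp add: b)
  qed
qed

text \<open>A fourth-order trace is what the available moments of \<open>f'\<close> allow, and it
  gives a norm of order \<open>n^(1/4)\<close>. The entrywise factor
  \<open>lam * sqrt n * x x^T\<close> later contributes \<open>n^(-7/16)\<close>, so any exponent
  strictly between \<open>1/4\<close> and \<open>7/16\<close> would do.\<close>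

lemma op_le_g2: "eventually (\<lambda>(n, \<omega>). op_le n (entry (g2 n) (snd \<omega>)) (real n powr (3/8))) Gf"
proof -
  define D where "D n = real n powr (3/8)" for n :: nat
  define Z where "Z n \<omega> = (\<Sum>i<n. hp n (entry (g2 n) (snd \<omega>)) 4 i i) / D n ^ 4" for n and \<omega> :: "(nat \<Rightarrow> real) \<times> (nat \<times> nat \<Rightarrow> real)"
  have D0: "D n \<ge> 0" for n by (simp add: D_def)
  have "(\<lambda>n. real n / (real n powr (3/8)) ^ 4) \<longlonglongrightarrow> 0" by real_asymp
  hence "(\<lambda>n. (152 * K4) ^ 4 * (real n / D n ^ 4)) \<longlonglongrightarrow> 0" unfolding D_def by (rule tendsto_mult_right_zero)
  hence e: "(\<lambda>n. real n * (152 * K4) ^ 4 / D n ^ 4) \<longlonglongrightarrow> 0" by (simp add: mult.commute)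
  have "((\<lambda>(n, \<omega>). Z n \<omega>) \<longlongrightarrow> 0) Gf"
  proof (rule conditional_limit_0[OF _ _ _ e])
    show "Z n \<in> borel_measurable (Om n)" for n
      unfolding Z_def[abs_def]
      by (intro borel_measurable_divide borel_measurable_sum measurable_hp measurable_g2 borel_measurable_const) auto
    have "(\<Sum>i<n. hp n (entry (g2 n) (snd \<omega>)) 4 i i) \<ge> 0" for n and \<omega> :: "(nat \<Rightarrow> real) \<times> (nat \<times> nat \<Rightarrow> real)"
      using trace_even_power_nonneg[where H = "entry (g2 n) (snd \<omega>)" and n = n and N = 2, OF entry_symmetric] by simp
    thus "Z n \<omega> \<ge> 0" for n \<omega> unfolding Z_def using D0[of n] by (intro divide_nonneg_nonneg) auto
    fix n x assume n: "n > (0::nat)"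
    have int: "integrable P (\<lambda>w. g2 n w ^ k)" if "k \<le> 4" for k
    proof -
      have "integrable P (\<lambda>w. (f' w - Fi) ^ k / sqrt (real n) ^ k)" using integrable_centred_deriv[of k] that by simp
      thus ?thesis by (simp add: g2_def power_divide)
    qed
    have K0: "K4 \<ge> 0" "K4 / sqrt (real n) \<ge> 0" using K4(1) by auto
    note tr = expected_trace_power[where N = 4 and \<xi> = "g2 n" and s = K4 and B = "K4 / sqrt (real n)" and n = n,
        OF prob(1) int step_bound_g2[OF n] K0]
    \<comment> \<open>For walks of four steps the bound has base 5. Since \<open>n \<ge> 1\<close>,
      it is at most \<open>2 + 125 + 25 = 152\<close> times \<open>K4\<close>.\<close>
    define A where "A = 2 * K4 + K4 * real (Suc 4) ^ 3 / real n + K4 / sqrt (real n) * (real (Suc 4))\<^sup>2"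
    have A: "0 \<le> A" "A \<le> 152 * K4"
    proof -
      show "0 \<le> A" using K0 by (simp add: A_def)
      have "K4 * 125 / real n \<le> K4 * 125 / 1" using n K0 by (intro divide_left_mono) auto
      moreover have "K4 / sqrt (real n) \<le> K4 / 1" using n K0 by (intro divide_left_mono) auto
      moreover have "A = 2 * K4 + K4 * 125 / real n + 25 * (K4 / sqrt (real n))" by (simp add: A_def)
      ultimately show "A \<le> 152 * K4" by linarith
    qed
    have "(LINT W|(noise n P). Z n (x, W)) = (LINT W|(noise n P). (\<Sum>i<n. hp n (entry (g2 n) W) 4 i i)) / D n ^ 4"
      unfolding Z_def snd_conv by (rule integral_divide_zero)
    also have "\<dots> \<le> real n * A ^ 4 / D n ^ 4"
      unfolding A_def by (rule divide_right_mono[OF tr(2)]) (simp_all add: D0)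
    also have "\<dots> \<le> real n * (152 * K4) ^ 4 / D n ^ 4"
      using A D0[of n] by (intro divide_right_mono mult_left_mono power_mono) auto
    finally show "integrable (noise n P) (\<lambda>W. Z n (x, W)) \<and> (LINT W|(noise n P). Z n (x, W)) \<le> real n * (152 * K4) ^ 4 / D n ^ 4"
      unfolding Z_def snd_conv using integrable_divide[OF tr(1)] by simp
  qed
  hence "eventually (\<lambda>b. (case b of (n, \<omega>) \<Rightarrow> Z n \<omega>) < 1) Gf" by (rule order_tendstoD) simp
  moreover have "eventually (\<lambda>(n, \<omega>). n > 0) Gf" by (rule n_eventually) (rule eventually_gt_at_top)
  ultimately show ?thesis
  proof eventually_elim
    case (elim b)
    obtain n \<omega> where b: "b = (n, \<omega>)" by (cases b)
    have "D n > 0" using elim by (simp add: b D_def)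
    hence "D n ^ 4 > 0" by simp
    moreover have "(\<Sum>i<n. hp n (entry (g2 n) (snd \<omega>)) 4 i i) / D n ^ 4 < 1" using elim by (simp add: b Z_def)
    ultimately have le: "(\<Sum>i<n. hp n (entry (g2 n) (snd \<omega>)) 4 i i) \<le> D n ^ 4" by (simp only: divide_less_eq_1_pos less_imp_le)
    have four: "2 * Suc 1 = 4" by simp
    have "op_le n (entry (g2 n) (snd \<omega>)) (D n)"
      by (rule op_le_trace_power[where k = 1]) (simp_all only: four le entry_symmetric[of _ _ j i for i j] D0)
    thus ?case by (simp add: b D_def)
  qed
qed

end

section \<open>Limits of the largest eigenvalue and its eigenvector\<close>

text \<open>The estimates hold for each fixed level \<open>k\<close>, whereas an \<open>o(1)\<close>
  error is a single sequence. The level \<open>\<kappa> n\<close> is the largest one among the first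
  \<open>n\<close> whose probability is already known to be close to 1 from \<open>n\<close> on, so
  it tends to infinity, possibly slowly.\<close>

lemma whp_diagonal:
  assumes M: "\<And>n. prob_space (M n)" and Q: "\<And>k. whp M (Q k)"
  shows "\<exists>\<kappa> :: nat \<Rightarrow> nat. filterlim \<kappa> at_top sequentially \<and> whp M (\<lambda>n. Q (\<kappa> n) n)"
proof -
  define a where "a k n = measure (M n) {\<omega> \<in> space (M n). Q k n \<omega>}" for k n
  have a: "a k \<longlonglongrightarrow> 1" for k using Q[of k] unfolding whp_def a_def[abs_def] .
  have "\<exists>N. \<forall>n\<ge>N. 1 - 1 / real (Suc k) < a k n" for k
    using order_tendstoD(1)[OF a[of k], of "1 - 1 / real (Suc k)"] by (simp add: eventually_sequentially)
  then obtain N where N: "\<And>k n. n \<ge> N k \<Longrightarrow> 1 - 1 / real (Suc k) < a k n" by metis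
  \<comment> \<open>The constraint \<open>k \<le> n\<close> makes the set finite, and the inserted 0
    makes it nonempty, so the maximum exists. Level 0 is itself reliable once
    \<open>n \<ge> N 0\<close>.\<close>
  define S where "S n = insert 0 {k. k \<le> n \<and> N k \<le> n}" for n
  define \<kappa> where "\<kappa> n = Max (S n)" for n
  have fin: "finite (S n)" for n
    by (rule finite_subset[of _ "{..n}"]) (auto simp: S_def)
  have \<kappa>_ge: "k \<le> \<kappa> n" if "k \<le> n" "N k \<le> n" for k n
    unfolding \<kappa>_def by (rule Max_ge[OF fin]) (use that in \<open>simp add: S_def\<close>)
  have \<kappa>_N: "N (\<kappa> n) \<le> n" if "N 0 \<le> n" for n
  proof -
    have "\<kappa> n \<in> S n" unfolding \<kappa>_def by (rule Max_in[OF fin]) (simp add: S_def)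
    thus ?thesis using that unfolding S_def by auto
  qed
  have lim: "filterlim \<kappa> at_top sequentially"
    unfolding filterlim_at_top
  proof
    fix k
    show "eventually (\<lambda>n. k \<le> \<kappa> n) sequentially"
      using eventually_ge_at_top[of "max k (N k)"] by eventually_elim (rule \<kappa>_ge, auto)
  qed
  have low: "eventually (\<lambda>n. 1 - 1 / real (Suc (\<kappa> n)) \<le> a (\<kappa> n) n) sequentially"
    using eventually_ge_at_top[of "N 0"] by eventually_elim (rule less_imp_le, rule N, rule \<kappa>_N)
  have "(\<lambda>k. 1 - 1 / real (Suc k)) \<longlonglongrightarrow> 1 - 0"
    by (intro tendsto_diff tendsto_const LIMSEQ_inverse_real_of_nat[unfolded inverse_eq_divide])
  from filterlim_compose[OF this lim] have l1: "(\<lambda>n. 1 - 1 / real (Suc (\<kappa> n))) \<longlonglongrightarrow> 1" by simp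
  have "(\<lambda>n. a (\<kappa> n) n) \<longlonglongrightarrow> 1"
    by (rule tendsto_sandwich[OF low _ l1 tendsto_const])
       (intro always_eventually allI, unfold a_def, rule prob_space.prob_le_1[OF M])
  thus ?thesis using lim unfolding whp_def a_def by blast
qed

lemma whp_cong:
  assumes "\<And>n. n > 0 \<Longrightarrow> \<forall>\<omega>\<in>space (M n). Q n \<omega> = R n \<omega>" and "whp M Q"
  shows "whp M R"
  unfolding whp_def
proof (rule Lim_transform_eventually[OF assms(2)[unfolded whp_def]])
  show "eventually (\<lambda>n. measure (M n) {\<omega> \<in> space (M n). Q n \<omega>} = measure (M n) {\<omega> \<in> space (M n). R n \<omega>}) sequentially"
    using eventually_gt_at_top[of 0]
  proof eventually_elim
    case (elim n)
    have "{\<omega> \<in> space (M n). Q n \<omega>} = {\<omega> \<in> space (M n). R n \<omega>}" using assms(1)[OF elim] by blast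
    thus ?case by simp
  qed
qed

text \<open>Passes between \<open>eigenvector\<close> and unit vectors attaining the largest value
  of the form, for which measurability is known. A vector attaining it is an eigenvector by
  \<open>qf_maximiser_eigenvector\<close>.\<close>

lemma top_eigenvector_iff:
  fixes a :: "nat \<Rightarrow> nat \<Rightarrow> real"
  assumes n: "n > 0" and sym: "\<And>i j. a i j = a j i"
  defines "A \<equiv> mat n n (\<lambda>(i, j). a i j)"
  shows "(\<forall>v. eigenvector A v (lambda_max A) \<and> scalar_prod v v = 1 \<longrightarrow> (scalar_prod v (vec n x))\<^sup>2 \<ge> c) \<longleftrightarrow>
    (\<forall>u. ip n u u = 1 \<and> ip n u (mv n a u) = lambda_max A \<longrightarrow> (ip n u x)\<^sup>2 \<ge> c)"
proof
  assume l: "\<forall>v. eigenvector A v (lambda_max A) \<and> scalar_prod v v = 1 \<longrightarrow> (scalar_prod v (vec n x))\<^sup>2 \<ge> c"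
  show "\<forall>u. ip n u u = 1 \<and> ip n u (mv n a u) = lambda_max A \<longrightarrow> (ip n u x)\<^sup>2 \<ge> c"
  proof (intro allI impI)
    fix u assume u: "ip n u u = 1 \<and> ip n u (mv n a u) = lambda_max A"
    define v where "v = vec n u"
    have vu: "vec_index v i = u i" if "i < n" for i using that by (simp add: v_def)
    have vc: "v \<in> carrier_vec n" by (simp add: v_def)
    have max: "ip n w (mv n a w) \<le> lambda_max A * ip n w w" for w
      unfolding A_def using lambda_max_attained[where n = n and a = a, OF n sym] by blast
    have ev: "mv n a u i = lambda_max A * u i" if "i < n" for i
      by (rule qf_maximiser_eigenvector[where n = n and a = a and v = u, OF sym max _ that]) (use u in simp)
    have ipv: "ip n (vec_index v) w = ip n u w" for w by (rule ip_cong) (simp_all add: vu)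
    have ipvv: "ip n (vec_index v) (vec_index v) = 1"
    proof -
      have "ip n u (vec_index v) = ip n u u" by (rule ip_cong) (simp_all add: vu)
      thus ?thesis unfolding ipv using u by simp
    qed
    have "v \<noteq> 0\<^sub>v n"
    proof
      assume "v = 0\<^sub>v n"
      hence "ip n (vec_index v) (vec_index v) = 0" by (simp add: ip_def)
      thus False using ipvv by simp
    qed
    moreover have "mv n a (vec_index v) = mv n a u" by (rule mv_cong) (rule vu)
    ultimately have "eigenvector A v (lambda_max A)"
      unfolding A_def eigenvector_mat_iff using vc ev vu unfolding A_def by simp
    moreover have "scalar_prod v v = 1" using ipvv scalar_prod_ip(1)[OF vc] by simp
    ultimately have "(scalar_prod v (vec n x))\<^sup>2 \<ge> c" using l by blast
    thus "(ip n u x)\<^sup>2 \<ge> c" unfolding scalar_prod_ip(2)[OF vc] ipv .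
  qed
next
  assume r: "\<forall>u. ip n u u = 1 \<and> ip n u (mv n a u) = lambda_max A \<longrightarrow> (ip n u x)\<^sup>2 \<ge> c"
  show "\<forall>v. eigenvector A v (lambda_max A) \<and> scalar_prod v v = 1 \<longrightarrow> (scalar_prod v (vec n x))\<^sup>2 \<ge> c"
  proof (intro allI impI)
    fix v assume v: "eigenvector A v (lambda_max A) \<and> scalar_prod v v = 1"
    have e: "v \<in> carrier_vec n" "\<And>i. i < n \<Longrightarrow> mv n a (vec_index v) i = lambda_max A * vec_index v i"
      using v unfolding A_def eigenvector_mat_iff by blast+
    have 1: "ip n (vec_index v) (vec_index v) = 1" using v scalar_prod_ip(1)[OF e(1)] by simp
    have "ip n (vec_index v) (mv n a (vec_index v)) = ip n (vec_index v) (\<lambda>i. lambda_max A * vec_index v i)"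
      by (rule ip_cong) (simp_all add: e(2))
    hence "ip n (vec_index v) (mv n a (vec_index v)) = lambda_max A" using 1 by (simp add: ip_scale_right)
    hence "(ip n (vec_index v) x)\<^sup>2 \<ge> c" using r 1 by blast
    thus "(scalar_prod v (vec n x))\<^sup>2 \<ge> c" unfolding scalar_prod_ip(2)[OF e(1)] .
  qed
qed

context spiked_model
begin

text \<open>The exponent is \<open>-1/2 + 1/32\<close>; from here on it no longer depends on
  \<open>alpha\<close>.\<close>

lemma x_small: "eventually (\<lambda>(n, \<omega>). \<forall>i<n. \<bar>fst \<omega> i\<bar> \<le> real n powr (-15/32)) Gf"
proof -
  have "eventually (\<lambda>(n, \<omega>). \<forall>i<n. \<bar>fst \<omega> i\<bar> \<le> real n powr (- 1/2 + alpha)) Gf"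
    by (rule lift_X[OF whp_imp_eventually[where M = X, OF X_prob deloc(2)]])
  moreover have "eventually (\<lambda>(n, \<omega>). n > 0) Gf" by (rule n_eventually) (rule eventually_gt_at_top)
  ultimately show ?thesis
  proof eventually_elim
    case (elim b)
    obtain n \<omega> where b: "b = (n, \<omega>)" by (cases b)
    have n: "real n \<ge> 1" using elim(2) by (simp add: b)
    have "real n powr (- 1/2 + alpha) \<le> real n powr (-15/32)" by (rule powr_mono) (use n deloc(1) in auto)
    moreover have "\<bar>fst \<omega> i\<bar> \<le> real n powr (- 1/2 + alpha)" if "i < n" for i using elim(1) that by (simp add: b)
    ultimately have "\<forall>i<n. \<bar>fst \<omega> i\<bar> \<le> real n powr (-15/32)" using order_trans by blast
    thus ?case by (simp add: b)
  qed
qed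

lemma th_nonneg: "th \<ge> 0" using lam Fi_pos by (simp add: th_def)

text \<open>An exact identity in which the mean \<open>Fi\<close> of \<open>f'\<close> is cancelled
  by the signal \<open>th\<close>. What remains is the mean shifted by truncation, the fluctuation
  of \<open>f'\<close> and the Taylor remainder, still written as a difference.\<close>

lemma Err_offdiag:
  assumes n: "n > 0" and ij: "i \<noteq> j" and tail: "tail (Tn n) (snd \<omega> (edge i j)) = 0"
  defines "w \<equiv> snd \<omega> (edge i j)" and "t \<equiv> lam * sqrt (real n) * (fst \<omega> i * fst \<omega> j)"
  shows "Err n \<omega> i j = tmean (Tn n) / sqrt (real n) + lam * sqrt (real n) * (fst \<omega> i * fst \<omega> j) * entry (g2 n) (snd \<omega>) i j
    + (f (w + t) - f w - f' w * t) / sqrt (real n)"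
proof -
  have r: "sqrt (real n) > 0" using n by simp
  have H: "Hn n \<omega> i j = (f w - tmean (Tn n)) / sqrt (real n)"
    using ij tail by (simp add: entry_def xi_def trunc_def w_def)
  have G: "entry (g2 n) (snd \<omega>) i j = (f' w - Fi) / sqrt (real n)"
    using ij by (simp add: entry_def g2_def w_def)
  have A: "amat n \<omega> i j = f (w + t)" unfolding w_def t_def by (rule amat_shift[OF n ij])
  have "a / r - (c - u) / r - lam * Fi * z = u / r + lam * r * z * ((d - Fi) / r) + (a - c - d * (lam * r * z)) / r"
    if "r > 0" for a c d u z r :: real
    using that by (simp add: field_simps)
  from this[OF r] show ?thesis unfolding Err_def H G A th_def unfolding t_def .
qed

text \<open>Four parts with norms at most \<open>r1\<close> to \<open>r4\<close>: the constant
  matrix of truncated means, the fluctuation of \<open>f'\<close> damped by \<open>x x^T\<close>,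
  the Taylor remainder, and the diagonal of the spike. These bounds are at most of order
  \<open>n^(-13/10)\<close>, \<open>n^(-1/16)\<close>, \<open>n^(-1/8)\<close> and
  \<open>n^(-7/16)\<close>. All but the second are Frobenius bounds.\<close>

lemma op_le_Err:
  assumes e: "\<epsilon> > 0"
  shows "eventually (\<lambda>(n, \<omega>). op_le n (Err n \<omega>) \<epsilon>) Gf"
proof -
  define ax where "ax n = real n powr (-15/32)" for n :: nat
  define \<tau> where "\<tau> n = lam * sqrt (real n) * (ax n)\<^sup>2" for n
  define r1 where "r1 n = sqrt (real n) * \<bar>tmean (Tn n)\<bar>" for n
  define r2 where "r2 n = lam * sqrt (real n) * (ax n)\<^sup>2 * real n powr (3/8)" for n
  define r3 where "r3 n = real n powr (3/4) * (\<tau> n)\<^sup>2" for n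
  define r4 where "r4 n = sqrt (real n) * (th * (ax n)\<^sup>2)" for n
  have lim\<tau>: "\<tau> \<longlonglongrightarrow> 0"
  proof -
    have "(\<lambda>n. sqrt (real n) * (real n powr (-15/32))\<^sup>2) \<longlonglongrightarrow> 0" by real_asymp
    hence "(\<lambda>n. lam * (sqrt (real n) * (real n powr (-15/32))\<^sup>2)) \<longlonglongrightarrow> 0" by (rule tendsto_mult_right_zero)
    thus ?thesis unfolding \<tau>_def[abs_def] ax_def by (simp only: mult.assoc)
  qed
  have l1: "r1 \<longlonglongrightarrow> 0"
  proof -
    have "(\<lambda>n. sqrt (real n) / (real n powr (9/20)) ^ 4) \<longlonglongrightarrow> 0" by real_asymp
    hence lim: "(\<lambda>n. M5 * (sqrt (real n) / (real n powr (9/20)) ^ 4)) \<longlonglongrightarrow> 0" by (rule tendsto_mult_right_zero)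
    show ?thesis
    proof (rule Lim_null_comparison[OF _ lim])
      show "eventually (\<lambda>n. norm (r1 n) \<le> M5 * (sqrt (real n) / (real n powr (9/20)) ^ 4)) sequentially"
        using eventually_gt_at_top[of 0]
      proof eventually_elim
        case (elim n)
        have "sqrt (real n) * \<bar>tmean (Tn n)\<bar> \<le> sqrt (real n) * (M5 / Tn n ^ 4)"
          by (rule mult_left_mono[OF tmean_small[OF Tn_pos[OF elim]]]) simp
        thus ?case by (simp add: r1_def Tn_def mult.commute)
      qed
    qed
  qed
  have l2: "r2 \<longlonglongrightarrow> 0"
  proof -
    have "(\<lambda>n. sqrt (real n) * (real n powr (-15/32))\<^sup>2 * real n powr (3/8)) \<longlonglongrightarrow> 0" by real_asymp
    hence "(\<lambda>n. lam * (sqrt (real n) * (real n powr (-15/32))\<^sup>2 * real n powr (3/8))) \<longlonglongrightarrow> 0" by (rule tendsto_mult_right_zero)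
    thus ?thesis unfolding r2_def[abs_def] ax_def by (simp only: mult.assoc)
  qed
  have l3: "r3 \<longlonglongrightarrow> 0"
  proof -
    have "(\<lambda>n. real n powr (3/4) * (sqrt (real n) * (real n powr (-15/32))\<^sup>2)\<^sup>2) \<longlonglongrightarrow> 0" by real_asymp
    hence "(\<lambda>n. lam\<^sup>2 * (real n powr (3/4) * (sqrt (real n) * (real n powr (-15/32))\<^sup>2)\<^sup>2)) \<longlonglongrightarrow> 0" by (rule tendsto_mult_right_zero)
    thus ?thesis unfolding r3_def[abs_def] \<tau>_def ax_def by (simp only: power_mult_distrib mult_ac)
  qed
  have l4: "r4 \<longlonglongrightarrow> 0"
  proof -
    have "(\<lambda>n. sqrt (real n) * (real n powr (-15/32))\<^sup>2) \<longlonglongrightarrow> 0" by real_asymp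
    hence "(\<lambda>n. th * (sqrt (real n) * (real n powr (-15/32))\<^sup>2)) \<longlonglongrightarrow> 0" by (rule tendsto_mult_right_zero)
    thus ?thesis unfolding r4_def[abs_def] ax_def by (simp only: mult_ac)
  qed
  have "(\<lambda>n. r1 n + r2 n + r3 n + r4 n) \<longlonglongrightarrow> 0 + 0 + 0 + 0" by (intro tendsto_add l1 l2 l3 l4)
  hence lr: "(\<lambda>n. r1 n + r2 n + r3 n + r4 n) \<longlonglongrightarrow> 0" by simp
  have ev: "eventually (\<lambda>n. n > 0 \<and> \<tau> n < 1 \<and> r1 n + r2 n + r3 n + r4 n < \<epsilon>) sequentially"
    by (intro eventually_conj eventually_gt_at_top order_tendstoD(2)[OF lim\<tau>] order_tendstoD(2)[OF lr] e) simp
  show ?thesis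
    using n_eventually[OF ev] x_small tail_vanishes remainder_bounded op_le_g2
  proof eventually_elim
    case (elim b)
    obtain n \<omega> where b: "b = (n, \<omega>)" by (cases b)
    define x where "x = fst \<omega>"
    have n: "n > 0" and t1: "\<tau> n < 1" and re: "r1 n + r2 n + r3 n + r4 n < \<epsilon>" using elim(1) by (auto simp: b)
    have xs: "\<bar>x i\<bar> \<le> ax n" if "i < n" for i using elim(2) that by (simp add: b x_def ax_def)
    have tl: "entry (tail (Tn n)) (snd \<omega>) i j = 0" if "i < n" "j < n" for i j using elim(3) that by (simp add: b)
    have S: "(\<Sum>i<n. \<Sum>j<n. entry (\<lambda>w. (hb w)\<^sup>2) (snd \<omega>) i j) \<le> real n powr (5/2)" using elim(4) by (simp add: b)
    have G: "op_le n (entry (g2 n) (snd \<omega>)) (real n powr (3/8))" using elim(5) by (simp add: b)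
    have ax0: "ax n \<ge> 0" by (simp add: ax_def)
    have sn: "sqrt (real n) > 0" using n by simp
    have lam0: "lam * sqrt (real n) \<ge> 0" using lam by simp
    have \<tau>0: "\<tau> n \<ge> 0" unfolding \<tau>_def by (rule mult_nonneg_nonneg[OF lam0]) simp
    define E1 where "E1 i j = (if i = j then 0 else tmean (Tn n) / sqrt (real n))" for i j :: nat
    define E2 where "E2 i j = lam * sqrt (real n) * (x i * x j) * entry (g2 n) (snd \<omega>) i j" for i j
    \<comment> \<open>Both \<open>amat\<close> and \<open>Hn\<close> vanish on the diagonal, so the
      diagonal of the spike has to be taken off again.\<close>
    define E4 where "E4 i j = (if i = j then - (th * (x i)\<^sup>2) else 0)" for i j :: nat
    define E3 where "E3 i j = Err n \<omega> i j - E1 i j - E2 i j - E4 i j" for i j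
    have o1: "op_le n E1 (r1 n)"
    proof (rule op_le_frobenius)
      have "(E1 i j)\<^sup>2 \<le> (tmean (Tn n))\<^sup>2 / real n" for i j by (simp add: E1_def power_divide)
      hence "(\<Sum>i<n. \<Sum>j<n. (E1 i j)\<^sup>2) \<le> (\<Sum>i<n. \<Sum>j<n. (tmean (Tn n))\<^sup>2 / real n)" by (intro sum_mono)
      also have "\<dots> = (r1 n)\<^sup>2" using n by (simp add: r1_def power_mult_distrib)
      finally show "(\<Sum>i<n. \<Sum>j<n. (E1 i j)\<^sup>2) \<le> (r1 n)\<^sup>2" .
    qed (simp add: r1_def)
    have o2: "op_le n E2 (r2 n)"
      unfolding E2_def[abs_def] r2_def by (rule op_le_hadamard_rank_one[OF G xs ax0 _ lam0]) simp_all
    have o4: "op_le n E4 (r4 n)"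
    proof (rule op_le_frobenius)
      have "(E4 i j)\<^sup>2 \<le> (if j = i then (th * (ax n)\<^sup>2)\<^sup>2 else 0)" if "i < n" for i j
      proof (cases "j = i")
        case True
        have "(x i)\<^sup>2 \<le> (ax n)\<^sup>2" using power_mono[OF xs[OF that] abs_ge_zero, of 2] by simp
        hence "th * (x i)\<^sup>2 \<le> th * (ax n)\<^sup>2" by (rule mult_left_mono) (rule th_nonneg)
        hence "(th * (x i)\<^sup>2)\<^sup>2 \<le> (th * (ax n)\<^sup>2)\<^sup>2" by (rule power_mono) (simp add: th_nonneg)
        thus ?thesis using True by (simp add: E4_def)
      qed (simp add: E4_def)
      hence "(\<Sum>i<n. \<Sum>j<n. (E4 i j)\<^sup>2) \<le> (\<Sum>i<n. \<Sum>j<n. if j = i then (th * (ax n)\<^sup>2)\<^sup>2 else 0)" by (intro sum_mono) simp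
      also have "\<dots> = real n * (th * (ax n)\<^sup>2)\<^sup>2" by simp
      also have "\<dots> = (r4 n)\<^sup>2" by (simp add: r4_def power_mult_distrib)
      finally show "(\<Sum>i<n. \<Sum>j<n. (E4 i j)\<^sup>2) \<le> (r4 n)\<^sup>2" .
    qed (simp add: r4_def th_nonneg)
    have e3: "(E3 i j)\<^sup>2 \<le> (\<tau> n) ^ 4 / real n * entry (\<lambda>w. (hb w)\<^sup>2) (snd \<omega>) i j" if ij: "i < n" "j < n" for i j
    proof (cases "i = j")
      case True
      have "E3 i j = 0"
        using True by (simp add: E3_def Err_def amat_def E1_def E2_def E4_def entry_def x_def power2_eq_square)
      thus ?thesis using True by (simp add: entry_def)
    next
      case False
      define w where "w = snd \<omega> (edge i j)"
      define t where "t = lam * sqrt (real n) * (x i * x j)"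
      have tz: "tail (Tn n) w = 0" using tl[OF ij] False by (simp add: entry_def w_def)
      have "E3 i j = Err n \<omega> i j - (tmean (Tn n) / sqrt (real n) + E2 i j)"
        using False by (simp add: E3_def E1_def E4_def)
      also have "Err n \<omega> i j = tmean (Tn n) / sqrt (real n) + E2 i j + (f (w + t) - f w - f' w * t) / sqrt (real n)"
        unfolding E2_def w_def t_def x_def by (rule Err_offdiag[OF n False tz[unfolded w_def]])
      finally have E: "E3 i j = (f (w + t) - f w - f' w * t) / sqrt (real n)" by simp
      have "\<bar>x i * x j\<bar> \<le> (ax n)\<^sup>2"
        unfolding abs_mult power2_eq_square by (intro mult_mono xs ij ax0 abs_ge_zero)
      hence "lam * sqrt (real n) * \<bar>x i * x j\<bar> \<le> \<tau> n" unfolding \<tau>_def by (rule mult_left_mono) (rule lam0)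
      hence t: "\<bar>t\<bar> \<le> \<tau> n" unfolding t_def abs_mult[of "lam * sqrt (real n)"] using lam0 by (simp only: abs_of_nonneg)
      have t2: "t\<^sup>2 \<le> (\<tau> n)\<^sup>2" using power_mono[OF t abs_ge_zero, of 2] by simp
      have hb0: "hb w \<ge> 0" unfolding hb_def using growth(1) by simp
      have "\<bar>f (w + t) - f w - f' w * t\<bar> \<le> hb w * t\<^sup>2"
        unfolding hb_def by (rule taylor_score) (use t t1 in linarith)
      also have "\<dots> \<le> hb w * (\<tau> n)\<^sup>2" using t2 hb0 by (rule mult_left_mono)
      finally have "\<bar>f (w + t) - f w - f' w * t\<bar> \<le> hb w * (\<tau> n)\<^sup>2" .
      hence "(f (w + t) - f w - f' w * t)\<^sup>2 \<le> (hb w * (\<tau> n)\<^sup>2)\<^sup>2"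
        using power_mono[OF _ abs_ge_zero, of "f (w + t) - f w - f' w * t" "hb w * (\<tau> n)\<^sup>2" 2] by simp
      also have "\<dots> = (\<tau> n) ^ 4 * (hb w)\<^sup>2" by (simp add: power_mult_distrib power_mult[symmetric])
      finally have "(f (w + t) - f w - f' w * t)\<^sup>2 / real n \<le> (\<tau> n) ^ 4 * (hb w)\<^sup>2 / real n" by (rule divide_right_mono) simp
      thus ?thesis unfolding E power_divide using False n by (simp add: entry_def w_def)
    qed
    have o3: "op_le n E3 (r3 n)"
    proof (rule op_le_frobenius)
      have "(\<Sum>i<n. \<Sum>j<n. (E3 i j)\<^sup>2) \<le> (\<Sum>i<n. \<Sum>j<n. (\<tau> n) ^ 4 / real n * entry (\<lambda>w. (hb w)\<^sup>2) (snd \<omega>) i j)"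
        by (intro sum_mono e3) auto
      also have "\<dots> = (\<tau> n) ^ 4 / real n * (\<Sum>i<n. \<Sum>j<n. entry (\<lambda>w. (hb w)\<^sup>2) (snd \<omega>) i j)"
        by (simp only: sum_distrib_left)
      also have "\<dots> \<le> (\<tau> n) ^ 4 / real n * real n powr (5/2)" using S by (rule mult_left_mono) simp
      also have "\<dots> = (r3 n)\<^sup>2"
      proof -
        have "real n powr (5/2) = real n powr 1 * (real n powr (3/4) * real n powr (3/4))"
          by (simp only: powr_add[symmetric]) simp
        hence "real n powr (5/2) / real n = (real n powr (3/4))\<^sup>2" using n by (simp add: power2_eq_square)
        moreover have "(\<tau> n) ^ 4 = ((\<tau> n)\<^sup>2)\<^sup>2" by (simp add: power_mult[symmetric])
        moreover have "(\<tau> n) ^ 4 / real n * real n powr (5/2) = (real n powr (5/2) / real n) * (\<tau> n) ^ 4" by simp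
        ultimately show ?thesis by (simp only: r3_def power_mult_distrib)
      qed
      finally show "(\<Sum>i<n. \<Sum>j<n. (E3 i j)\<^sup>2) \<le> (r3 n)\<^sup>2" .
    qed (simp add: r3_def)
    have "op_le n (\<lambda>i j. E1 i j + E2 i j + E3 i j + E4 i j) (r1 n + r2 n + r3 n + r4 n)"
      by (intro op_le_add o1 o2 o3 o4)
    hence "op_le n (Err n \<omega>) (r1 n + r2 n + r3 n + r4 n)" by (rule op_le_cong) (simp add: E3_def)
    hence "op_le n (Err n \<omega>) \<epsilon>" by (rule op_le_mono) (use re in simp)
    thus ?case by (simp add: b)
  qed
qed

section \<open>The model as an instance of the Krylov scheme\<close>

definition yv :: "nat \<Rightarrow> nat \<times> (nat \<Rightarrow> real) \<times> (nat \<times> nat \<Rightarrow> real) \<Rightarrow> nat \<Rightarrow> real" where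
  "yv k b = kry (fst b) (Hn (fst b) (snd b)) (fst (snd b)) k"

definition pv :: "nat \<Rightarrow> nat \<times> (nat \<Rightarrow> real) \<times> (nat \<times> nat \<Rightarrow> real) \<Rightarrow> nat \<Rightarrow> real" where
  "pv = (\<lambda>k b i. if k = 0 then 0 else yv (k - 1) b i)"

definition rv :: "nat \<Rightarrow> nat \<times> (nat \<Rightarrow> real) \<times> (nat \<times> nat \<Rightarrow> real) \<Rightarrow> nat \<Rightarrow> real" where
  "rv = (\<lambda>k b i. mv (fst b) (Hn (fst b) (snd b)) (yv k b) i - yv (Suc k) b i - Fi * pv k b i)"

lemma yv_0: "i < fst b \<Longrightarrow> yv 0 b i = fst (snd b) i"
  by (simp add: yv_def kry_0)

lemma ip_yv_0: "ip (fst b) (yv 0 b) u = ip (fst b) (fst (snd b)) u"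
  by (rule ip_cong) (simp_all add: yv_0)

lemma yv_Suc_Suc:
  assumes "i < fst b"
  shows "mv (fst b) (Hn (fst b) (snd b)) (yv (Suc k) b) i = yv (Suc (Suc k)) b i +
    vn (fst b) * real (fst b - Suc k) * yv k b i + kry_rem (fst b) (xi (fst b)) (vn (fst b)) (snd (snd b)) (fst (snd b)) (Suc k) i"
  unfolding yv_def by (rule mv_kry_Suc[OF assms])

lemma vn_le_Fi: "eventually (\<lambda>b. \<bar>vn (fst b) * real (fst b - k)\<bar> \<le> Fi + 1) Gf"
proof -
  have "(\<lambda>n. \<bar>vn n * real (n - k)\<bar>) \<longlonglongrightarrow> \<bar>Fi\<bar>" by (rule tendsto_rabs[OF vn_limit])
  hence "eventually (\<lambda>n. \<bar>vn n * real (n - k)\<bar> < Fi + 1) sequentially" by (rule order_tendstoD) (use Fi_pos in simp)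
  from n_eventually[OF this] show ?thesis by eventually_elim (simp add: case_prod_unfold)
qed

text \<open>Boundedness has to precede the remainder estimate: the true recursion has the
  coefficient \<open>vn n * (n - k)\<close> in place of \<open>Fi\<close>, and replacing it is a
  small error only against bounded vectors. Hence the induction runs on the exact recursion, outside
  \<open>krylov_limit\<close>.\<close>

lemma nrm_yv_bounded: "\<exists>D. eventually (\<lambda>b. nrm (fst b) (yv k b) \<le> D \<and> nrm (fst b) (yv (Suc k) b) \<le> D) Gf"
proof (induction k)
  case 0
  have o: "eventually (\<lambda>b. op_le (fst b) (Hn (fst b) (snd b)) (2 * sg + 1)) Gf"
    using op_le_H[of 1] by (simp add: case_prod_unfold)
  have "eventually (\<lambda>b. nrm (fst b) (yv 0 b) \<le> 2 + (2 * sg + 1) * 2 \<and> nrm (fst b) (yv (Suc 0) b) \<le> 2 + (2 * sg + 1) * 2) Gf"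
    using o ip_x_le
  proof eventually_elim
    case (elim b)
    have "(nrm (fst b) (fst (snd b)))\<^sup>2 \<le> 2\<^sup>2" using elim(2) by (simp add: case_prod_unfold ip_self)
    hence x2: "nrm (fst b) (fst (snd b)) \<le> 2" by (rule power2_le_imp_le) simp
    have y0: "nrm (fst b) (yv 0 b) = nrm (fst b) (fst (snd b))" by (rule nrm_cong) (rule yv_0)
    have "nrm (fst b) (yv (Suc 0) b) = nrm (fst b) (mv (fst b) (Hn (fst b) (snd b)) (yv 0 b))"
      unfolding yv_def by (rule nrm_cong) (rule mv_kry_0[symmetric])
    also have "\<dots> \<le> (2 * sg + 1) * nrm (fst b) (yv 0 b)" by (rule op_leD[OF elim(1)])
    also have "\<dots> \<le> (2 * sg + 1) * 2" unfolding y0 using x2 sg by (intro mult_left_mono) auto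
    finally have "nrm (fst b) (yv (Suc 0) b) \<le> (2 * sg + 1) * 2" .
    thus ?case using x2 y0 sg(1) by simp
  qed
  thus ?case by (rule exI)
next
  case (Suc k)
  then obtain D where D: "eventually (\<lambda>b. nrm (fst b) (yv k b) \<le> D \<and> nrm (fst b) (yv (Suc k) b) \<le> D) Gf" by (rule exE)
  have o: "eventually (\<lambda>b. op_le (fst b) (Hn (fst b) (snd b)) (2 * sg + 1)) Gf"
    using op_le_H[of 1] by (simp add: case_prod_unfold)
  let ?R = "\<lambda>b. kry_rem (fst b) (xi (fst b)) (vn (fst b)) (snd (snd b)) (fst (snd b)) (Suc k)"
  have r: "eventually (\<lambda>b. nrm (fst b) (?R b) < 1) Gf"
    using order_tendstoD(2)[OF kry_rem_limit[of "Suc k"], of 1] by (simp add: case_prod_unfold)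
  have "eventually (\<lambda>b. nrm (fst b) (yv (Suc k) b) \<le> D + ((2 * sg + 1) * D + (Fi + 1) * D + 1) \<and>
      nrm (fst b) (yv (Suc (Suc k)) b) \<le> D + ((2 * sg + 1) * D + (Fi + 1) * D + 1)) Gf"
    using D o r vn_le_Fi[of "Suc k"]
  proof eventually_elim
    case (elim b)
    let ?n = "fst b" and ?H = "Hn (fst b) (snd b)"
    have D0: "D \<ge> 0" using elim(1) L2_set_nonneg[of "yv k b" "{..<?n}"] by linarith
    have "nrm ?n (yv (Suc (Suc k)) b) = nrm ?n (\<lambda>i. (mv ?n ?H (yv (Suc k) b) i - vn ?n * real (?n - Suc k) * yv k b i) - ?R b i)"
      by (rule nrm_cong) (simp add: yv_Suc_Suc)
    also have "\<dots> \<le> nrm ?n (\<lambda>i. mv ?n ?H (yv (Suc k) b) i - vn ?n * real (?n - Suc k) * yv k b i) + nrm ?n (?R b)"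
      by (rule nrm_diff_le)
    also have "nrm ?n (\<lambda>i. mv ?n ?H (yv (Suc k) b) i - vn ?n * real (?n - Suc k) * yv k b i) \<le>
        nrm ?n (mv ?n ?H (yv (Suc k) b)) + nrm ?n (\<lambda>i. vn ?n * real (?n - Suc k) * yv k b i)" by (rule nrm_diff_le)
    also have "nrm ?n (mv ?n ?H (yv (Suc k) b)) \<le> (2 * sg + 1) * nrm ?n (yv (Suc k) b)" by (rule op_leD[OF elim(2)])
    also have "\<dots> \<le> (2 * sg + 1) * D" using elim(1) sg by (intro mult_left_mono) auto
    also have "nrm ?n (\<lambda>i. vn ?n * real (?n - Suc k) * yv k b i) = \<bar>vn ?n * real (?n - Suc k)\<bar> * nrm ?n (yv k b)"
      by (rule nrm_scale)
    also have "\<dots> \<le> (Fi + 1) * D"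
      by (rule mult_mono[OF elim(4)]) (use elim(1) Fi_pos in \<open>auto simp: L2_set_nonneg\<close>)
    finally have a: "nrm ?n (yv (Suc (Suc k)) b) \<le> (2 * sg + 1) * D + (Fi + 1) * D + 1" using elim(3) by linarith
    have "0 \<le> (2 * sg + 1) * D" "0 \<le> (Fi + 1) * D" using D0 sg Fi_pos by auto
    thus ?case using a elim(1) D0 by linarith
  qed
  thus ?case by (rule exI)
qed

lemma rv_limit: "((\<lambda>b. nrm (fst b) (rv k b)) \<longlongrightarrow> 0) Gf"
proof (cases k)
  case 0
  have "nrm (fst b) (rv k b) = 0" for b
  proof -
    have "nrm (fst b) (rv k b) = nrm (fst b) (\<lambda>_. 0)"
      by (rule nrm_cong) (simp add: 0 rv_def pv_def yv_def mv_kry_0)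
    thus ?thesis by (simp add: L2_set_def)
  qed
  thus ?thesis by simp
next
  case (Suc l)
  let ?R = "\<lambda>b. kry_rem (fst b) (xi (fst b)) (vn (fst b)) (snd (snd b)) (fst (snd b)) (Suc l)"
  obtain D where D: "eventually (\<lambda>b. nrm (fst b) (yv l b) \<le> D \<and> nrm (fst b) (yv (Suc l) b) \<le> D) Gf"
    using nrm_yv_bounded[of l] by (rule exE)
  have "((\<lambda>b. \<bar>vn (fst b) * real (fst b - Suc l) - Fi\<bar> * D + nrm (fst b) (?R b)) \<longlongrightarrow> \<bar>Fi - Fi\<bar> * D + 0) Gf"
  proof (intro tendsto_add tendsto_mult tendsto_const tendsto_rabs tendsto_diff)
    show "((\<lambda>b. vn (fst b) * real (fst b - Suc l)) \<longlongrightarrow> Fi) Gf"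
      using n_limit[OF vn_limit[of "Suc l"]] by (simp only: case_prod_unfold)
    show "((\<lambda>b. nrm (fst b) (?R b)) \<longlongrightarrow> 0) Gf"
      using kry_rem_limit[of "Suc l"] by (simp only: case_prod_unfold)
  qed
  hence lim: "((\<lambda>b. \<bar>vn (fst b) * real (fst b - Suc l) - Fi\<bar> * D + nrm (fst b) (?R b)) \<longlongrightarrow> 0) Gf" by simp
  show ?thesis
  proof (rule Lim_null_comparison[OF _ lim])
    show "eventually (\<lambda>b. norm (nrm (fst b) (rv k b)) \<le> \<bar>vn (fst b) * real (fst b - Suc l) - Fi\<bar> * D + nrm (fst b) (?R b)) Gf"
      using D
    proof eventually_elim
      case (elim b)
      let ?c = "vn (fst b) * real (fst b - Suc l) - Fi"
      have "nrm (fst b) (rv k b) = nrm (fst b) (\<lambda>i. ?c * yv l b i + ?R b i)"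
        by (rule nrm_cong) (simp add: Suc rv_def pv_def yv_Suc_Suc left_diff_distrib)
      also have "\<dots> \<le> nrm (fst b) (\<lambda>i. ?c * yv l b i) + nrm (fst b) (?R b)" by (rule L2_set_triangle_ineq)
      also have "nrm (fst b) (\<lambda>i. ?c * yv l b i) = \<bar>?c\<bar> * nrm (fst b) (yv l b)" by (rule nrm_scale)
      also have "\<dots> \<le> \<bar>?c\<bar> * D" using elim by (intro mult_left_mono) auto
      finally have "nrm (fst b) (rv k b) \<le> \<bar>?c\<bar> * D + nrm (fst b) (?R b)" by linarith
      thus ?case by (simp add: L2_set_nonneg)
    qed
  qed
qed

lemma krylov: "krylov_limit Gf fst (\<lambda>b. Hn (fst b) (snd b)) yv sg Fi rv pv"
proof unfold_locales
  show "pv = (\<lambda>k b i. if k = 0 then 0 else yv (k - 1) b i)" by (rule pv_def)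
  show "rv = (\<lambda>k b i. mv (fst b) (Hn (fst b) (snd b)) (yv k b) i - yv (Suc k) b i - Fi * pv k b i)" by (rule rv_def)
  show "Hn (fst b) (snd b) i j = Hn (fst b) (snd b) j i" for b i j by (rule entry_symmetric)
  show "sg > 0" "Fi = sg\<^sup>2" using sg by simp_all
  show "eventually (\<lambda>b. op_le (fst b) (Hn (fst b) (snd b)) (2 * sg + \<epsilon>)) Gf" if "\<epsilon> > 0" for \<epsilon>
    using op_le_H[OF that] by (simp only: case_prod_unfold)
  show "((\<lambda>b. nrm (fst b) (rv k b)) \<longlongrightarrow> 0) Gf" for k by (rule rv_limit)
  have "ip (fst b) (yv 0 b) (yv 0 b) = ip (fst b) (fst (snd b)) (fst (snd b))" for b
    by (rule ip_cong) (simp_all add: yv_0)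
  thus "((\<lambda>b. ip (fst b) (yv 0 b) (yv 0 b)) \<longlongrightarrow> 1) Gf" using ip_x_limit by (simp only: case_prod_unfold)
  show "((\<lambda>b. ip (fst b) (yv 0 b) (yv (Suc k) b)) \<longlongrightarrow> 0) Gf" for k
    unfolding ip_yv_0 using ip_kry_limit[of k] by (simp only: case_prod_unfold yv_def)
qed

end

section \<open>The limiting eigenvalue and the overlap with the spike\<close>

context spiked_model
begin

lemma qf_split:
  assumes n: "n > 0"
  shows "ip n v (mv n (amat n \<omega>) v) =
    sqrt (real n) * (ip n v (mv n (Hn n \<omega>) v) + th * (ip n (fst \<omega>) v)\<^sup>2 + ip n v (mv n (Err n \<omega>) v))"
proof -
  define x where "x = fst \<omega>"
  define r where "r = sqrt (real n)"
  have r: "r \<noteq> 0" using n by (simp add: r_def)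
  have a: "amat n \<omega> i j = r * (Hn n \<omega> i j + th * (x i * x j) + Err n \<omega> i j)" for i j
    unfolding Err_def r_def[symmetric] x_def[symmetric] using r by (simp add: field_simps)
  have "mv n (amat n \<omega>) v i = r * (mv n (Hn n \<omega>) v i + (th * ip n x v) * x i + mv n (Err n \<omega>) v i)" for i
    unfolding mv_def ip_def a by (simp only: sum_distrib_left sum_distrib_right sum.distrib[symmetric] ring_distribs mult_ac)
  hence "mv n (amat n \<omega>) v = (\<lambda>i. r * (mv n (Hn n \<omega>) v i + (th * ip n x v) * x i + mv n (Err n \<omega>) v i))" by (rule ext)
  hence "ip n v (mv n (amat n \<omega>) v) = r * (ip n v (mv n (Hn n \<omega>) v) + (th * ip n x v) * ip n v x + ip n v (mv n (Err n \<omega>) v))"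
    by (simp only: ip_linear)
  also have "ip n v x = ip n x v" by (rule ip_commute)
  finally show ?thesis by (simp add: r_def x_def power2_eq_square mult.assoc)
qed

definition topval :: real where "topval = (if th > sg then th + Fi / th else 2 * sg)"

text \<open>At or below the threshold the signal is raised to \<open>sg + \<epsilon> / 2\<close>,
  which only increases the form and makes the Krylov bound applicable. Since
  \<open>Fi / \<theta> \<le> sg\<close> there, the value is at most
  \<open>2 * sg + \<epsilon>\<close>, slack included.\<close>

lemma perturbed_upper:
  assumes e: "\<epsilon> > 0"
  shows "eventually (\<lambda>(n, \<omega>). \<forall>v. ip n v (mv n (Hn n \<omega>) v) + th * (ip n (fst \<omega>) v)\<^sup>2 \<le> (topval + \<epsilon>) * ip n v v) Gf"
proof -
  define \<theta> where "\<theta> = (if th > sg then th else sg + \<epsilon> / 2)"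
  have \<theta>: "\<theta> > sg" "th \<le> \<theta>" using e by (auto simp: \<theta>_def)
  have "\<theta> + Fi / \<theta> + \<epsilon> / 2 \<le> topval + \<epsilon>"
  proof (cases "th > sg")
    case False
    have "Fi / \<theta> \<le> sg"
    proof -
      have "Fi \<le> sg * \<theta>" unfolding sg(2)[symmetric] power2_eq_square using sg(1) \<theta>(1) by (intro mult_left_mono) auto
      thus ?thesis using \<theta>(1) sg(1) by (simp add: divide_le_eq)
    qed
    moreover have "topval = 2 * sg" "\<theta> = sg + \<epsilon> / 2" using False by (simp_all add: topval_def \<theta>_def)
    ultimately show ?thesis by linarith
  qed (use e in \<open>simp add: topval_def \<theta>_def\<close>)
  note le = this
  from krylov_limit.upper_bound[OF krylov \<theta>(1), of "\<epsilon> / 2"] e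
  have "eventually (\<lambda>b. \<forall>v. ip (fst b) v (mv (fst b) (Hn (fst b) (snd b)) v) + \<theta> * (ip (fst b) (yv 0 b) v)\<^sup>2 \<le>
    (\<theta> + Fi / \<theta> + \<epsilon> / 2) * ip (fst b) v v) Gf" by simp
  thus ?thesis
  proof eventually_elim
    case (elim b)
    obtain n \<omega> where b: "b = (n, \<omega>)" by (cases b)
    have "ip n v (mv n (Hn n \<omega>) v) + th * (ip n (fst \<omega>) v)\<^sup>2 \<le> (topval + \<epsilon>) * ip n v v" for v
    proof -
      have "ip (fst b) v (mv (fst b) (Hn (fst b) (snd b)) v) + \<theta> * (ip (fst b) (yv 0 b) v)\<^sup>2 \<le>
          (\<theta> + Fi / \<theta> + \<epsilon> / 2) * ip (fst b) v v" using elim by blast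
      hence "ip n v (mv n (Hn n \<omega>) v) + \<theta> * (ip n (fst \<omega>) v)\<^sup>2 \<le> (\<theta> + Fi / \<theta> + \<epsilon> / 2) * ip n v v"
        unfolding ip_yv_0 b by simp
      moreover have "th * (ip n (fst \<omega>) v)\<^sup>2 \<le> \<theta> * (ip n (fst \<omega>) v)\<^sup>2" by (rule mult_right_mono[OF \<theta>(2)]) simp
      moreover have "(\<theta> + Fi / \<theta> + \<epsilon> / 2) * ip n v v \<le> (topval + \<epsilon>) * ip n v v"
        by (rule mult_right_mono[OF le ip_self_nonneg])
      ultimately show ?thesis by linarith
    qed
    thus ?case by (simp add: b)
  qed
qed

text \<open>At or below the threshold the rank-one part is dropped as nonnegative, and the edge of
  the bulk is reached with the test vector belonging to a parameter slightly above
  \<open>sg\<close>.\<close>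

lemma perturbed_lower:
  assumes e: "\<epsilon> > 0"
  shows "eventually (\<lambda>(n, \<omega>). \<exists>v. ip n v v > 0 \<and>
    ip n v (mv n (Hn n \<omega>) v) + th * (ip n (fst \<omega>) v)\<^sup>2 \<ge> (topval - \<epsilon>) * ip n v v) Gf"
proof (cases "th > sg")
  case True
  from krylov_limit.lower_bounds(1)[OF krylov True e] show ?thesis
  proof eventually_elim
    case (elim b)
    obtain n \<omega> where b: "b = (n, \<omega>)" by (cases b)
    from elim obtain v where v: "ip (fst b) v v > 0"
      "ip (fst b) v (mv (fst b) (Hn (fst b) (snd b)) v) + th * (ip (fst b) (yv 0 b) v)\<^sup>2 \<ge> (th + Fi / th - \<epsilon>) * ip (fst b) v v"
      by blast
    have "ip n v v > 0 \<and> ip n v (mv n (Hn n \<omega>) v) + th * (ip n (fst \<omega>) v)\<^sup>2 \<ge> (topval - \<epsilon>) * ip n v v"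
      using v unfolding ip_yv_0 b using True by (simp add: topval_def)
    thus ?case unfolding b by auto
  qed
next
  case False
  define \<theta> where "\<theta> = sg + \<epsilon> / 4"
  have \<theta>: "\<theta> > sg" using e by (simp add: \<theta>_def)
  \<comment> \<open>The difference of two squares gives
    \<open>Fi / \<theta> \<ge> sg - \<epsilon> / 4\<close>, so doubling it uses one half of
    \<open>\<epsilon>\<close> and the Krylov estimate the other half.\<close>
  have "(sg - \<epsilon> / 4) * \<theta> \<le> Fi" unfolding \<theta>_def sg(2)[symmetric] by (simp add: power2_eq_square algebra_simps)
  hence "sg - \<epsilon> / 4 \<le> Fi / \<theta>" using \<theta> sg(1) by (simp add: le_divide_eq)
  hence le: "topval - \<epsilon> \<le> 2 * Fi / \<theta> - \<epsilon> / 2" using False by (simp add: topval_def)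
  have "\<epsilon> / 2 > 0" using e by simp
  from krylov_limit.lower_bounds(2)[OF krylov \<theta> this] show ?thesis
  proof eventually_elim
    case (elim b)
    obtain n \<omega> where b: "b = (n, \<omega>)" by (cases b)
    from elim obtain v where v: "ip (fst b) v v > 0"
      "ip (fst b) v (mv (fst b) (Hn (fst b) (snd b)) v) \<ge> (2 * Fi / \<theta> - \<epsilon> / 2) * ip (fst b) v v"
      by blast
    have "(topval - \<epsilon>) * ip n v v \<le> (2 * Fi / \<theta> - \<epsilon> / 2) * ip n v v" by (rule mult_right_mono[OF le ip_self_nonneg])
    also have "\<dots> \<le> ip n v (mv n (Hn n \<omega>) v)" using v(2) by (simp add: b)
    also have "\<dots> \<le> ip n v (mv n (Hn n \<omega>) v) + th * (ip n (fst \<omega>) v)\<^sup>2" using th_nonneg by simp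
    finally have "ip n v v > 0 \<and> ip n v (mv n (Hn n \<omega>) v) + th * (ip n (fst \<omega>) v)\<^sup>2 \<ge> (topval - \<epsilon>) * ip n v v"
      using v(1) by (simp add: b)
    thus ?case unfolding b by auto
  qed
qed

lemma lambda_max_score:
  assumes e: "\<epsilon> > 0"
  shows "eventually (\<lambda>(n, \<omega>). n > 0 \<and> \<bar>lambda_max (score_matrix n lam p \<omega>) - sqrt (real n) * topval\<bar> \<le> sqrt (real n) * \<epsilon>) Gf"
proof -
  have e2: "\<epsilon> / 2 > 0" using e by simp
  have "eventually (\<lambda>(n, \<omega>). n > 0) Gf" by (rule n_eventually) (rule eventually_gt_at_top)
  thus ?thesis using perturbed_upper[OF e2] perturbed_lower[OF e2] op_le_Err[OF e2]
  proof eventually_elim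
    case (elim b)
    obtain n \<omega> where b: "b = (n, \<omega>)" by (cases b)
    have n: "n > 0" using elim(1) by (simp add: b)
    let ?H = "\<lambda>v. ip n v (mv n (Hn n \<omega>) v) + th * (ip n (fst \<omega>) v)\<^sup>2"
    have U: "?H v \<le> (topval + \<epsilon> / 2) * ip n v v" for v using elim(2) by (simp add: b)
    have O: "op_le n (Err n \<omega>) (\<epsilon> / 2)" using elim(4) by (simp add: b)
    have r: "sqrt (real n) \<ge> 0" by simp
    have "ip n v (mv n (amat n \<omega>) v) \<le> (sqrt (real n) * (topval + \<epsilon>)) * ip n v v" for v
    proof -
      have "?H v + ip n v (mv n (Err n \<omega>) v) \<le> (topval + \<epsilon> / 2) * ip n v v + \<epsilon> / 2 * ip n v v"
        using U[of v] op_le_qf[OF O, of v] by linarith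
      also have "\<dots> = (topval + \<epsilon>) * ip n v v" by (simp add: algebra_simps)
      finally have "sqrt (real n) * (?H v + ip n v (mv n (Err n \<omega>) v)) \<le> sqrt (real n) * ((topval + \<epsilon>) * ip n v v)"
        by (rule mult_left_mono[OF _ r])
      thus ?thesis unfolding qf_split[OF n] by (simp only: mult.assoc)
    qed
    hence up: "lambda_max (score_matrix n lam p \<omega>) \<le> sqrt (real n) * (topval + \<epsilon>)"
      unfolding score_matrix_eq lambda_max_le_iff[where n = n and a = "amat n \<omega>", OF n amat_symmetric] by (rule allI)
    have "\<exists>v. ip n v v > 0 \<and> (topval - \<epsilon> / 2) * ip n v v \<le> ?H v" using elim(3) by (simp add: b)
    then obtain v where v: "ip n v v > 0" "(topval - \<epsilon> / 2) * ip n v v \<le> ?H v" by blast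
    have "(topval - \<epsilon>) * ip n v v = (topval - \<epsilon> / 2) * ip n v v - \<epsilon> / 2 * ip n v v" by (simp add: algebra_simps)
    also have "\<dots> \<le> ?H v + ip n v (mv n (Err n \<omega>) v)" using v(2) op_le_qf[OF O, of v] by linarith
    finally have "sqrt (real n) * ((topval - \<epsilon>) * ip n v v) \<le> sqrt (real n) * (?H v + ip n v (mv n (Err n \<omega>) v))"
      by (rule mult_left_mono[OF _ r])
    hence "(sqrt (real n) * (topval - \<epsilon>)) * ip n v v \<le> ip n v (mv n (amat n \<omega>) v)"
      unfolding qf_split[OF n] by (simp only: mult.assoc)
    hence "sqrt (real n) * (topval - \<epsilon>) \<le> lambda_max (score_matrix n lam p \<omega>)"
      unfolding score_matrix_eq by (rule lambda_max_ge[where n = n and a = "amat n \<omega>", OF n amat_symmetric v(1)])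
    with up n show ?case by (simp add: b abs_le_iff right_diff_distrib distrib_left)
  qed
qed

lemma measurable_amat:
  assumes "i < n" "j < n" shows "(\<lambda>\<omega>. amat n \<omega> i j) \<in> borel_measurable (Om n)"
proof (cases "i = j")
  case False
  have [measurable]: "(\<lambda>\<omega>. fst \<omega> i) \<in> borel_measurable (Om n)" "(\<lambda>\<omega>. fst \<omega> j) \<in> borel_measurable (Om n)"
    using assms measurable_x by auto
  have [measurable]: "(\<lambda>\<omega>. snd \<omega> (edge i j)) \<in> borel_measurable (Om n)"
    by (rule measurable_W[OF edge_in_edges[OF False assms], of "\<lambda>w. w"]) simp
  have "(\<lambda>\<omega>. sqrt (real n) * (lam * (fst \<omega> i * fst \<omega> j) + 1 / sqrt (real n) * snd \<omega> (edge i j))) \<in> borel_measurable (Om n)"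
    by measurable
  from measurable_compose[OF this measurable(2)] show ?thesis using False by (simp add: amat_def)
qed (simp add: amat_def)

lemma measurable_lambda_max_score:
  assumes "n > 0" shows "(\<lambda>\<omega>. lambda_max (score_matrix n lam p \<omega>)) \<in> borel_measurable (Om n)"
  unfolding score_matrix_eq
  by (rule measurable_lambda_max[where n = n and a = "amat n", OF assms amat_symmetric measurable_amat])

lemma lambda_max_limit:
  "tendsto_in_prob Om (\<lambda>n \<omega>. 1 / sqrt (real n) * lambda_max (score_matrix n lam p \<omega>)) topval"
  unfolding tendsto_in_prob_def
proof (intro allI impI)
  fix \<epsilon> :: real assume e: "\<epsilon> > 0"
  hence e2: "\<epsilon> / 2 > 0" by simp
  show "whp Om (\<lambda>n \<omega>. \<bar>1 / sqrt (real n) * lambda_max (score_matrix n lam p \<omega>) - topval\<bar> < \<epsilon>)"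
  proof (rule eventually_imp_whp[OF Om_prob])
    show "eventually (\<lambda>(n, \<omega>). \<bar>1 / sqrt (real n) * lambda_max (score_matrix n lam p \<omega>) - topval\<bar> < \<epsilon>) Gf"
      using lambda_max_score[OF e2]
    proof eventually_elim
      case (elim b)
      obtain n \<omega> where b: "b = (n, \<omega>)" by (cases b)
      define l where "l = lambda_max (score_matrix n lam p \<omega>)"
      define r where "r = sqrt (real n)"
      have r: "r > 0" and l: "\<bar>l - r * topval\<bar> \<le> r * (\<epsilon> / 2)" using elim by (simp_all add: b l_def r_def)
      have "1 / r * l - topval = (l - r * topval) / r" using r by (simp add: field_simps)
      hence "\<bar>1 / r * l - topval\<bar> = \<bar>l - r * topval\<bar> / r" using r by (simp add: abs_divide)
      also have "\<dots> \<le> \<epsilon> / 2" using l r by (simp add: divide_le_eq mult.commute)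
      finally have "\<bar>1 / r * l - topval\<bar> < \<epsilon>" using e by linarith
      thus ?case by (simp add: b l_def r_def)
    qed
    fix n :: nat assume n: "n > 0"
    have [measurable]: "(\<lambda>\<omega>. lambda_max (score_matrix n lam p \<omega>)) \<in> borel_measurable (Om n)"
      by (rule measurable_lambda_max_score[OF n])
    show "{\<omega> \<in> space (Om n). \<bar>1 / sqrt (real n) * lambda_max (score_matrix n lam p \<omega>) - topval\<bar> < \<epsilon>} \<in> sets (Om n)"
      by measurable
  qed
qed

definition aligned :: "real \<Rightarrow> nat \<Rightarrow> (nat \<Rightarrow> real) \<times> (nat \<times> nat \<Rightarrow> real) \<Rightarrow> bool" where
  "aligned c n \<omega> \<longleftrightarrow> (\<forall>u. ip n u u = 1 \<and> ip n u (mv n (amat n \<omega>) u) = lambda_max (mat n n (\<lambda>(i, j). amat n \<omega> i j)) \<longrightarrow>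
    (ip n u (fst \<omega>))\<^sup>2 \<ge> c)"

lemma aligned_whp:
  assumes th: "th > sg" and e: "\<epsilon> > 0"
  shows "whp Om (aligned ((1 - sg / th)\<^sup>2 - \<epsilon>))"
proof (rule eventually_imp_whp[OF Om_prob])
  \<comment> \<open>Three errors of size \<open>\<eta>\<close>, from the eigenvalue, from
    \<open>Hn\<close> and from \<open>Err\<close>, have to fit into
    \<open>th * \<epsilon> = 4 * \<eta>\<close>.\<close>
  define \<eta> where "\<eta> = th * \<epsilon> / 4"
  have th0: "th > 0" using th sg(1) by linarith
  have \<eta>: "\<eta> > 0" using th0 e by (simp add: \<eta>_def)
  show "eventually (\<lambda>(n, \<omega>). aligned ((1 - sg / th)\<^sup>2 - \<epsilon>) n \<omega>) Gf"
    using lambda_max_score[OF \<eta>] op_le_H[OF \<eta>] op_le_Err[OF \<eta>]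
  proof eventually_elim
    case (elim b)
    obtain n \<omega> where b: "b = (n, \<omega>)" by (cases b)
    define l where "l = lambda_max (score_matrix n lam p \<omega>)"
    have n: "n > 0" and l: "\<bar>l - sqrt (real n) * topval\<bar> \<le> sqrt (real n) * \<eta>" using elim(1) by (simp_all add: b l_def)
    have H: "op_le n (Hn n \<omega>) (2 * sg + \<eta>)" and E: "op_le n (Err n \<omega>) \<eta>" using elim by (simp_all add: b)
    have "(ip n u (fst \<omega>))\<^sup>2 \<ge> (1 - sg / th)\<^sup>2 - \<epsilon>"
      if u: "ip n u u = 1" and ul: "ip n u (mv n (amat n \<omega>) u) = l" for u
    proof -
      have "sqrt (real n) * (topval - \<eta>) \<le> l" using l by (simp add: abs_le_iff right_diff_distrib)
      hence "sqrt (real n) * (topval - \<eta>) \<le> sqrt (real n) *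
          (ip n u (mv n (Hn n \<omega>) u) + th * (ip n (fst \<omega>) u)\<^sup>2 + ip n u (mv n (Err n \<omega>) u))"
        unfolding ul[symmetric] qf_split[OF n] .
      hence "topval - \<eta> \<le> ip n u (mv n (Hn n \<omega>) u) + th * (ip n (fst \<omega>) u)\<^sup>2 + ip n u (mv n (Err n \<omega>) u)"
        by (rule mult_left_le_imp_le) (use n in simp)
      moreover have "ip n u (mv n (Hn n \<omega>) u) \<le> 2 * sg + \<eta>" using op_le_qf[OF H, of u] by (simp add: u)
      moreover have "ip n u (mv n (Err n \<omega>) u) \<le> \<eta>" using op_le_qf[OF E, of u] by (simp add: u)
      ultimately have 1: "topval - 2 * sg - 3 * \<eta> \<le> th * (ip n (fst \<omega>) u)\<^sup>2" by linarith
      have "topval - 2 * sg = th * (1 - sg / th)\<^sup>2"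
        using th th0 by (simp add: topval_def sg(2)[symmetric] power2_eq_square field_simps)
      hence "th * ((1 - sg / th)\<^sup>2 - \<epsilon>) = topval - 2 * sg - 4 * \<eta>" by (simp add: \<eta>_def right_diff_distrib)
      with 1 \<eta> have "th * ((1 - sg / th)\<^sup>2 - \<epsilon>) \<le> th * (ip n (fst \<omega>) u)\<^sup>2" by linarith
      hence "(1 - sg / th)\<^sup>2 - \<epsilon> \<le> (ip n (fst \<omega>) u)\<^sup>2" by (rule mult_left_le_imp_le) (rule th0)
      thus ?thesis by (simp only: ip_commute[of n u])
    qed
    thus ?case by (simp add: b aligned_def l_def score_matrix_eq)
  qed
  fix n :: nat assume n: "n > 0"
  show "{\<omega> \<in> space (Om n). aligned ((1 - sg / th)\<^sup>2 - \<epsilon>) n \<omega>} \<in> sets (Om n)"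
    unfolding aligned_def
    by (rule sets_top_eigenvector[where n = n and a = "amat n" and x = fst, OF n amat_symmetric measurable_amat measurable_x])
qed

lemma top_eigenvector_limit:
  assumes th: "th > sg"
  shows "\<exists>\<delta> :: nat \<Rightarrow> real. \<delta> \<longlonglongrightarrow> 0 \<and>
    whp Om (\<lambda>n \<omega>. \<forall>v. eigenvector (score_matrix n lam p \<omega>) v (lambda_max (score_matrix n lam p \<omega>)) \<and> scalar_prod v v = 1 \<longrightarrow>
      (scalar_prod v (vec n (fst \<omega>)))\<^sup>2 \<ge> (1 - sg / th)\<^sup>2 - \<delta> n)"
proof -
  have "whp Om (aligned ((1 - sg / th)\<^sup>2 - 1 / real (Suc k)))" for k
    by (rule aligned_whp[OF th]) simp
  from whp_diagonal[where M = Om and Q = "\<lambda>k. aligned ((1 - sg / th)\<^sup>2 - 1 / real (Suc k))", OF Om_prob this]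
  obtain \<kappa> where \<kappa>: "filterlim \<kappa> at_top sequentially"
    "whp Om (\<lambda>n. aligned ((1 - sg / th)\<^sup>2 - 1 / real (Suc (\<kappa> n))) n)" by (elim exE conjE)
  have "(\<lambda>k. 1 / real (Suc k)) \<longlonglongrightarrow> 0" by (rule LIMSEQ_inverse_real_of_nat[unfolded inverse_eq_divide])
  from filterlim_compose[OF this \<kappa>(1)] have "(\<lambda>n. 1 / real (Suc (\<kappa> n))) \<longlonglongrightarrow> 0" .
  moreover have "whp Om (\<lambda>n \<omega>. \<forall>v. eigenvector (score_matrix n lam p \<omega>) v (lambda_max (score_matrix n lam p \<omega>)) \<and> scalar_prod v v = 1 \<longrightarrow>
      (scalar_prod v (vec n (fst \<omega>)))\<^sup>2 \<ge> (1 - sg / th)\<^sup>2 - 1 / real (Suc (\<kappa> n)))"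
  proof (rule whp_cong[OF _ \<kappa>(2)], rule ballI)
    fix n \<omega> assume n: "(n :: nat) > 0"
    show "aligned ((1 - sg / th)\<^sup>2 - 1 / real (Suc (\<kappa> n))) n \<omega> =
      (\<forall>v. eigenvector (score_matrix n lam p \<omega>) v (lambda_max (score_matrix n lam p \<omega>)) \<and> scalar_prod v v = 1 \<longrightarrow>
        (scalar_prod v (vec n (fst \<omega>)))\<^sup>2 \<ge> (1 - sg / th)\<^sup>2 - 1 / real (Suc (\<kappa> n)))"
      unfolding aligned_def score_matrix_eq
      by (rule top_eigenvector_iff[where n = n and a = "amat n \<omega>", OF n amat_symmetric, symmetric])
  qed
  ultimately show ?thesis by (intro exI conjI)
qed

end

theorem theorem4p9:
  fixes lam alpha C :: real and m :: nat
    and X :: "nat \<Rightarrow> (nat \<Rightarrow> real) measure"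
    and P :: "real measure" and p :: "real \<Rightarrow> real"
  assumes lam: "lam \<ge> 0"
    and prior: "spike_prior X"
    and P: "prob_space P" "sets P = sets borel"
    and mean: "integrable P (\<lambda>w. w)" "(LINT w|P. w) = 0"
    and var: "integrable P (\<lambda>w. w\<^sup>2)" "prob_space.variance P (\<lambda>w. w) = 1"
    and deloc: "alpha < 1/32"
      "whp X (\<lambda>n x. \<forall>i<n. \<bar>x i\<bar> \<le> real n powr (- 1/2 + alpha))"
    and density: "P = density lborel (\<lambda>w. ennreal (p w))"
    and smooth: "\<And>k w. k < 3 \<Longrightarrow> (deriv ^^ k) p field_differentiable (at w)"
    and pos: "\<And>w. p w > 0"
    and growth: "C > 0" "even m" "m \<ge> 2"
      "\<And>l w. l \<le> 2 \<Longrightarrow> \<bar>(deriv ^^ l) (score p) w\<bar> \<le> C + w ^ m"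
    and moments: "\<And>k. 1 \<le> k \<Longrightarrow> k \<le> 5 * m \<Longrightarrow> integrable P (\<lambda>w. \<bar>w\<bar> ^ k)"
  defines "F \<equiv> fisher_info P p"
    and "\<Omega> \<equiv> \<lambda>n. wig_space n P (X n)"
    and "A \<equiv> \<lambda>n \<omega>. score_matrix n lam p \<omega>"
  shows "F = (LINT w|lborel. (deriv p w)\<^sup>2 / p w) \<and>
    (lam \<le> 1 / sqrt F \<longrightarrow>
      tendsto_in_prob \<Omega> (\<lambda>n \<omega>. 1 / sqrt (real n) * lambda_max (A n \<omega>)) (2 * sqrt F)) \<and>
    (lam > 1 / sqrt F \<longrightarrow>
      tendsto_in_prob \<Omega> (\<lambda>n \<omega>. 1 / sqrt (real n) * lambda_max (A n \<omega>)) (lam * F + 1 / lam) \<and>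
      lam * F + 1 / lam > 2 * sqrt F \<and>
      (\<exists>\<delta> :: nat \<Rightarrow> real. \<delta> \<longlonglongrightarrow> 0 \<and>
        whp \<Omega> (\<lambda>n \<omega>. \<forall>v. eigenvector (A n \<omega>) v (lambda_max (A n \<omega>)) \<and> scalar_prod v v = 1 \<longrightarrow>
          (scalar_prod v (vec n (fst \<omega>)))\<^sup>2 \<ge> (lam - 1 / sqrt F)\<^sup>2 / lam\<^sup>2 - \<delta> n)))"
proof -
  interpret spiked_model P p m C lam alpha X
    by (rule spiked_model.intro[OF score_model.intro spiked_model_axioms.intro])
      (fact P density smooth pos growth moments lam prior deloc)+
  have F: "F = Fi" by (simp add: F_def Fi_def)
  have sqrtF: "sqrt F = sg" by (simp add: F sg_def)
  \<comment> \<open>As \<open>th = lam * sg^2\<close>, dividing \<open>th > sg\<close> by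
    \<open>sg^2\<close> gives the threshold of the statement.\<close>
  have less: "1 / sqrt F < lam \<longleftrightarrow> sg < th"
    unfolding sqrtF th_def sg(2)[symmetric] using sg(1) by (simp add: divide_less_eq power2_eq_square)
  have crit: "topval = 2 * sqrt F" if "lam \<le> 1 / sqrt F"
    using that less unfolding sqrtF by (simp add: topval_def)
  have super: "topval = lam * F + 1 / lam \<and> lam * F + 1 / lam > 2 * sqrt F \<and>
      (1 - sg / th)\<^sup>2 = (lam - 1 / sqrt F)\<^sup>2 / lam\<^sup>2" if l: "lam > 1 / sqrt F"
  proof -
    have lp: "lam > 0" using l sg(1) unfolding sqrtF using less_trans[of 0 "1 / sg" lam] by simp
    have th: "th > sg" using l less by simp
    \<comment> \<open>The gap to the bulk edge is a perfect square over \<open>lam\<close>, nonzero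
      because \<open>lam * sg > 1\<close>.\<close>
    have "lam * F + 1 / lam - 2 * sqrt F = (lam * sg - 1)\<^sup>2 / lam"
      unfolding sqrtF unfolding F sg(2)[symmetric] using lp by (simp add: power2_eq_square field_simps)
    moreover have "lam * sg - 1 > 0" using l sg(1) unfolding sqrtF by (simp add: divide_less_eq)
    ultimately have "lam * F + 1 / lam - 2 * sqrt F > 0" using lp by simp
    moreover have "topval = lam * F + 1 / lam"
      unfolding topval_def F using th lp Fi_pos by (simp add: th_def)
    moreover have "1 - sg / th = (lam - 1 / sqrt F) / lam"
      unfolding sqrtF th_def sg(2)[symmetric] using lp sg(1) by (simp add: power2_eq_square field_simps)
    hence "(1 - sg / th)\<^sup>2 = (lam - 1 / sqrt F)\<^sup>2 / lam\<^sup>2" by (simp only: power_divide)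
    ultimately show ?thesis by simp
  qed
  show ?thesis
  proof (intro conjI impI)
    show "F = (LINT w|lborel. (deriv p w)\<^sup>2 / p w)" unfolding F_def by (rule fisher_info_lborel)
    assume "lam \<le> 1 / sqrt F"
    show "tendsto_in_prob \<Omega> (\<lambda>n \<omega>. 1 / sqrt (real n) * lambda_max (A n \<omega>)) (2 * sqrt F)"
      unfolding \<Omega>_def A_def crit[OF \<open>lam \<le> 1 / sqrt F\<close>, symmetric] by (rule lambda_max_limit)
  next
    assume l: "lam > 1 / sqrt F"
    note s = super[OF l]
    show "tendsto_in_prob \<Omega> (\<lambda>n \<omega>. 1 / sqrt (real n) * lambda_max (A n \<omega>)) (lam * F + 1 / lam)"
      unfolding \<Omega>_def A_def s[THEN conjunct1, symmetric] by (rule lambda_max_limit)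
    show "lam * F + 1 / lam > 2 * sqrt F" using s by simp
    show "\<exists>\<delta> :: nat \<Rightarrow> real. \<delta> \<longlonglongrightarrow> 0 \<and>
        whp \<Omega> (\<lambda>n \<omega>. \<forall>v. eigenvector (A n \<omega>) v (lambda_max (A n \<omega>)) \<and> scalar_prod v v = 1 \<longrightarrow>
          (scalar_prod v (vec n (fst \<omega>)))\<^sup>2 \<ge> (lam - 1 / sqrt F)\<^sup>2 / lam\<^sup>2 - \<delta> n)"
      unfolding \<Omega>_def A_def s[THEN conjunct2, THEN conjunct2, symmetric]
      by (rule top_eigenvector_limit) (use l less in simp)
  qed
qed

end
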